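(* Let $(\ell,u_0)\in Y'\times H$. Consider the problem of finding $(\theta,u)\in Y\times X$ such that $$ \begin{cases} A\theta+\mathrm{d}_t u=\ell & \text{in } Y',\\ \mathrm{d}_t'\theta-(A u+\gamma_T'\gamma_T u)=-(\ell+\gamma_0'u_0) & \text{in } X'. \end{cases} $$ The unique solution $(\theta,u)$ of this system is given by $\theta=u=B_e^{-1}(\ell,u_0)$, i.e. both components are equal to the unique $u\in X$ with $\mathrm{d}_t u+Au=\ell$ in $Y'$ and $\gamma_0u=u_0$.
   Context: All linear spaces are over $\mathbb R$. $V\hookrightarrow H\simeq H'\hookrightarrow V'$ is a Gelfand triple of Hilbert spaces, $T>0$, $\Xi:=(0,T)$. Set $Y:=L_2(\Xi;V)$ and $X:=L_2(\Xi;V)\cap H^1(\Xi;V')$. It is known that $X\hookrightarrow C(\overline\Xi;H)$, and $\gamma_t\colon X\to H$ denotes the trace $w\mapsto w(t)$. Define $\mathrm{d}_t\colon X\to Y'$ by $(\mathrm{d}_t w)(v):=\int_\Xi (\tfrac{\mathrm{d}w}{\mathrm{d}t}(t))(v(t))\,\mathrm{d}t$. For a.e. $t\in\Xi$, $A(t)\colon V\to V'$ is a possibly nonlinear operator, and $A\colon Y\to Y'$ is defined by $(Aw)(v):=\int_\Xi (A(t)w(t))(v(t))\,\mathrm{d}t$. It is assumed that $A\colon Y\to Y'$ is Lipschitz continuous, $\|Aw-Av\|_{Y'}\le L_A\|w-v\|_Y$, and strongly monotone, $(Aw-Av)(w-v)\ge m_A\|w-v\|_Y^2$, for all $w,v\in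 Y$, with constants $L_A,m_A>0$. A prime on a space denotes the dual, a prime on a linear operator its adjoint; so $\mathrm{d}_t'\colon Y\to X'$, $(\mathrm{d}_t'\theta)(v)=(\mathrm{d}_tv)(\theta)$, $(\gamma_T'\gamma_Tu)(v)=\langle u(T),v(T)\rangle_H$, $(\gamma_0'u_0)(v)=\langle u_0,v(0)\rangle_H$. Functionals in $Y'$ are viewed in $X'$ by restriction to $X\subset Y$. $B_e\colon X\to Y'\times H$ is $B_eu:=(\mathrm{d}_tu+Au,\gamma_0u)$; it is known that for such $A$ the equation $B_eu=(\ell,u_0)$ has a unique solution for every $(\ell,u_0)\in Y'\times H$. *)

theory Defs
  imports "HOL-Analysis.Analysis"
begin

section \<open>Bochner spaces\<close>

text \<open>
  The library's Bochner integral is restricted to second-countable target spaces. No separability is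
  assumed here (and the dual \<open>'v \<Rightarrow>\<^sub>L real\<close> is not second countable as a type), so
  \<open>has_strong_integral\<close> repeats the definition of \<open>has_bochner_integral\<close> with Borel measurability
  replaced by strong measurability.

  Elements of Lebesgue--Bochner spaces are represented by functions; equality in these spaces is
  equality almost everywhere.
\<close>

definition strongly_measurable :: "'a measure \<Rightarrow> ('a \<Rightarrow> 'b::real_normed_vector) \<Rightarrow> bool" where
  "strongly_measurable M f \<longleftrightarrow>
     (\<exists>s. (\<forall>i. simple_function M (s i)) \<and> (AE x in M. (\<lambda>i. s i x) \<longlonglongrightarrow> f x))"

definition has_strong_integral ::
    "'a measure \<Rightarrow> ('a \<Rightarrow> 'b::real_normed_vector) \<Rightarrow> 'b \<Rightarrow> bool" where
  "has_strong_integral M f I \<longleftrightarrow> strongly_measurable M f \<and>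
     (\<exists>s. (\<forall>i. Bochner_Integration.simple_bochner_integrable M (s i)) \<and>
          (\<lambda>i. \<integral>\<^sup>+x. ennreal (norm (f x - s i x)) \<partial>M) \<longlonglongrightarrow> 0 \<and>
          (\<lambda>i. Bochner_Integration.simple_bochner_integral M (s i)) \<longlonglongrightarrow> I)"

definition bochner_L2 :: "'a measure \<Rightarrow> ('a \<Rightarrow> 'b::real_normed_vector) set" where
  "bochner_L2 M = {f. strongly_measurable M f \<and> integrable M (\<lambda>x. (norm (f x))\<^sup>2)}"

definition bochner_L2_norm :: "'a measure \<Rightarrow> ('a \<Rightarrow> 'b::real_normed_vector) \<Rightarrow> real" where
  "bochner_L2_norm M f = sqrt (LINT x|M. (norm (f x))\<^sup>2)"

text \<open>
  A functional is only relevant on the space it acts on; equality of functionals is \<open>dual_eq\<close>.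
  Boundedness in the seminorm makes members of \<open>bochner_L2_dual\<close> respect equality almost everywhere.
\<close>

definition bochner_L2_dual ::
    "'a measure \<Rightarrow> (('a \<Rightarrow> 'b::real_normed_vector) \<Rightarrow> real) set" where
  "bochner_L2_dual M = {F.
     (\<forall>v\<in>bochner_L2 M. \<forall>w\<in>bochner_L2 M. F (\<lambda>x. v x + w x) = F v + F w) \<and>
     (\<forall>c. \<forall>v\<in>bochner_L2 M. F (\<lambda>x. c *\<^sub>R v x) = c * F v) \<and>
     (\<exists>C. \<forall>v\<in>bochner_L2 M. \<bar>F v\<bar> \<le> C * bochner_L2_norm M v)}"

definition bochner_L2_dual_norm ::
    "'a measure \<Rightarrow> (('a \<Rightarrow> 'b::real_normed_vector) \<Rightarrow> real) \<Rightarrow> real" where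
  "bochner_L2_dual_norm M F =
     (SUP v \<in> {v \<in> bochner_L2 M. bochner_L2_norm M v \<le> 1}. \<bar>F v\<bar>)"

definition dual_eq :: "'f set \<Rightarrow> ('f \<Rightarrow> real) \<Rightarrow> ('f \<Rightarrow> real) \<Rightarrow> bool" where
  "dual_eq S F G \<longleftrightarrow> (\<forall>v\<in>S. F v = G v)"


section \<open>Weak derivatives on the time interval\<close>

abbreviation time_measure :: "real \<Rightarrow> real measure" where
  "time_measure T \<equiv> lebesgue_on {0<..<T}"

definition test_functions :: "real \<Rightarrow> (real \<Rightarrow> real) set" where
  "test_functions T = {\<phi>. (\<forall>n t. ((deriv ^^ n) \<phi>) differentiable (at t)) \<and>
     compact (closure {t. \<phi> t \<noteq> 0}) \<and> closure {t. \<phi> t \<noteq> 0} \<subseteq> {0<..<T}}"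

definition has_weak_derivative ::
    "real \<Rightarrow> (real \<Rightarrow> 'b::real_normed_vector) \<Rightarrow> (real \<Rightarrow> 'b) \<Rightarrow> bool" where
  "has_weak_derivative T f g \<longleftrightarrow> (\<forall>\<phi>\<in>test_functions T. \<exists>I.
     has_strong_integral (time_measure T) (\<lambda>t. deriv \<phi> t *\<^sub>R f t) I \<and>
     has_strong_integral (time_measure T) (\<lambda>t. \<phi> t *\<^sub>R g t) (- I))"

definition bochner_H1 :: "real \<Rightarrow> (real \<Rightarrow> 'b::real_normed_vector) set" where
  "bochner_H1 T = {f \<in> bochner_L2 (time_measure T).
     \<exists>g\<in>bochner_L2 (time_measure T). has_weak_derivative T f g}"

definition weak_derivative :: "real \<Rightarrow> (real \<Rightarrow> 'b::real_normed_vector) \<Rightarrow> real \<Rightarrow> 'b" where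
  "weak_derivative T f =
     (SOME g. g \<in> bochner_L2 (time_measure T) \<and> has_weak_derivative T f g)"


section \<open>Gelfand triples and the parabolic operators\<close>

text \<open>
  The bounded map \<open>j\<close> is the embedding of $V$ into $H$. Identifying $H$ with its dual,
  \<open>pivot_embed j\<close> is the embedding of $H$ into $V'$.
\<close>

definition gelfand_triple ::
    "('v::{real_inner,complete_space} \<Rightarrow>\<^sub>L 'h::{real_inner,complete_space}) \<Rightarrow> bool" where
  "gelfand_triple j \<longleftrightarrow>
     inj (blinfun_apply j) \<and> closure (range (blinfun_apply j)) = UNIV"

definition pivot_embed ::
    "('v::real_normed_vector \<Rightarrow>\<^sub>L 'h::real_inner) \<Rightarrow> 'h \<Rightarrow> ('v \<Rightarrow>\<^sub>L real)" where
  "pivot_embed j h = blinfun_inner_left h o\<^sub>L j"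

definition Y_space :: "real \<Rightarrow> (real \<Rightarrow> 'v::real_normed_vector) set" where
  "Y_space T = bochner_L2 (time_measure T)"

definition X_space ::
    "real \<Rightarrow> ('v::real_normed_vector \<Rightarrow>\<^sub>L 'h::real_inner) \<Rightarrow> (real \<Rightarrow> 'v) set" where
  "X_space T j =
     {w \<in> bochner_L2 (time_measure T). (\<lambda>t. pivot_embed j (blinfun_apply j (w t))) \<in> bochner_H1 T}"

definition d_t ::
    "real \<Rightarrow> ('v::real_normed_vector \<Rightarrow>\<^sub>L 'h::real_inner) \<Rightarrow> (real \<Rightarrow> 'v) \<Rightarrow> (real \<Rightarrow> 'v) \<Rightarrow> real" where
  "d_t T j w v = (LINT t|time_measure T.
     blinfun_apply (weak_derivative T (\<lambda>s. pivot_embed j (blinfun_apply j (w s))) t) (v t))"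

definition d_t_adj ::
    "real \<Rightarrow> ('v::real_normed_vector \<Rightarrow>\<^sub>L 'h::real_inner) \<Rightarrow> (real \<Rightarrow> 'v) \<Rightarrow> (real \<Rightarrow> 'v) \<Rightarrow> real" where
  "d_t_adj T j \<theta> v = d_t T j v \<theta>"

text \<open>The trace is evaluation of the representative that is continuous on $[0,T]$ with values in $H$.\<close>

definition continuous_rep ::
    "real \<Rightarrow> ('v::real_normed_vector \<Rightarrow>\<^sub>L 'h::real_normed_vector) \<Rightarrow> (real \<Rightarrow> 'v) \<Rightarrow> real \<Rightarrow> 'h" where
  "continuous_rep T j w =
     (SOME c. continuous_on {0..T} c \<and> (AE t in time_measure T. c t = blinfun_apply j (w t)))"

definition trace_at ::
    "real \<Rightarrow> ('v::real_normed_vector \<Rightarrow>\<^sub>L 'h::real_normed_vector) \<Rightarrow> real \<Rightarrow> (real \<Rightarrow> 'v) \<Rightarrow> 'h" where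
  "trace_at T j t w = continuous_rep T j w t"

definition trace_adj ::
    "real \<Rightarrow> ('v::real_normed_vector \<Rightarrow>\<^sub>L 'h::real_inner) \<Rightarrow> real \<Rightarrow> 'h \<Rightarrow> (real \<Rightarrow> 'v) \<Rightarrow> real" where
  "trace_adj T j t h v = h \<bullet> trace_at T j t v"

definition induced_op ::
    "real \<Rightarrow> (real \<Rightarrow> 'v::real_normed_vector \<Rightarrow> ('v \<Rightarrow>\<^sub>L real)) \<Rightarrow> (real \<Rightarrow> 'v) \<Rightarrow> (real \<Rightarrow> 'v) \<Rightarrow> real" where
  "induced_op T A w v = (LINT t|time_measure T. blinfun_apply (A t (w t)) (v t))"

text \<open>Integrability is demanded separately because the integral of a non-integrable function is 0.\<close>

definition maps_Y_to_dual ::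
    "real \<Rightarrow> (real \<Rightarrow> 'v::real_normed_vector \<Rightarrow> ('v \<Rightarrow>\<^sub>L real)) \<Rightarrow> bool" where
  "maps_Y_to_dual T A \<longleftrightarrow> (\<forall>w\<in>Y_space T.
     (\<forall>v\<in>Y_space T. integrable (time_measure T) (\<lambda>t. blinfun_apply (A t (w t)) (v t))) \<and>
     induced_op T A w \<in> bochner_L2_dual (time_measure T))"

definition lipschitz_op ::
    "real \<Rightarrow> (real \<Rightarrow> 'v::real_normed_vector \<Rightarrow> ('v \<Rightarrow>\<^sub>L real)) \<Rightarrow> real \<Rightarrow> bool" where
  "lipschitz_op T A L \<longleftrightarrow> (\<forall>w\<in>Y_space T. \<forall>v\<in>Y_space T.
     bochner_L2_dual_norm (time_measure T) (\<lambda>z. induced_op T A w z - induced_op T A v z)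
       \<le> L * bochner_L2_norm (time_measure T) (\<lambda>t. w t - v t))"

definition strongly_monotone_op ::
    "real \<Rightarrow> (real \<Rightarrow> 'v::real_normed_vector \<Rightarrow> ('v \<Rightarrow>\<^sub>L real)) \<Rightarrow> real \<Rightarrow> bool" where
  "strongly_monotone_op T A m \<longleftrightarrow> (\<forall>w\<in>Y_space T. \<forall>v\<in>Y_space T.
     induced_op T A w (\<lambda>t. w t - v t) - induced_op T A v (\<lambda>t. w t - v t)
       \<ge> m * (bochner_L2_norm (time_measure T) (\<lambda>t. w t - v t))\<^sup>2)"

definition B_e ::
    "real \<Rightarrow> ('v::real_normed_vector \<Rightarrow>\<^sub>L 'h::real_inner) \<Rightarrow>
     (real \<Rightarrow> 'v \<Rightarrow> ('v \<Rightarrow>\<^sub>L real)) \<Rightarrow> (real \<Rightarrow> 'v) \<Rightarrow> ((real \<Rightarrow> 'v) \<Rightarrow> real) \<times> 'h" where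
  "B_e T j A u = (\<lambda>v. d_t T j u v + induced_op T A u v, trace_at T j 0 u)"

definition B_e_solution ::
    "real \<Rightarrow> ('v::real_normed_vector \<Rightarrow>\<^sub>L 'h::real_inner) \<Rightarrow>
     (real \<Rightarrow> 'v \<Rightarrow> ('v \<Rightarrow>\<^sub>L real)) \<Rightarrow> ((real \<Rightarrow> 'v) \<Rightarrow> real) \<Rightarrow> 'h \<Rightarrow> (real \<Rightarrow> 'v) \<Rightarrow> bool" where
  "B_e_solution T j A l u0 u \<longleftrightarrow> u \<in> X_space T j \<and>
     dual_eq (Y_space T) (fst (B_e T j A u)) l \<and> snd (B_e T j A u) = u0"

definition system_solution ::
    "real \<Rightarrow> ('v::real_normed_vector \<Rightarrow>\<^sub>L 'h::real_inner) \<Rightarrow>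
     (real \<Rightarrow> 'v \<Rightarrow> ('v \<Rightarrow>\<^sub>L real)) \<Rightarrow> ((real \<Rightarrow> 'v) \<Rightarrow> real) \<Rightarrow> 'h \<Rightarrow>
     (real \<Rightarrow> 'v) \<Rightarrow> (real \<Rightarrow> 'v) \<Rightarrow> bool" where
  "system_solution T j A l u0 \<theta> u \<longleftrightarrow> \<theta> \<in> Y_space T \<and> u \<in> X_space T j \<and>
     dual_eq (Y_space T) (\<lambda>v. induced_op T A \<theta> v + d_t T j u v) l \<and>
     dual_eq (X_space T j)
       (\<lambda>v. d_t_adj T j \<theta> v - (induced_op T A u v + trace_adj T j T (trace_at T j T u) v))
       (\<lambda>v. - (l v + trace_adj T j 0 u0 v))"

end

theory Submission
  imports Defs "HOL-Computational_Algebra.Polynomial"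
begin

text \<open>
  Identify \<open>V'\<close> with \<open>V\<close> by the Riesz map. The embedding of \<open>V\<close> into \<open>V'\<close> becomes the positive
  injective operator \<open>S = j\<^sup>* j\<close> on \<open>V\<close>, functionals on \<open>Y\<close> become elements of \<open>Y\<close>, and \<open>u \<in> X\<close>
  means that \<open>S u\<close> has a derivative \<open>z\<close> in \<open>Y\<close> (\<open>weak_pair u z\<close>), so that \<open>d\<^sub>t u\<close> is the
  functional \<open>v \<mapsto> \<integral> z \<bullet> v\<close>.

  The theorem rests on the formula of integration by parts \<open>(d\<^sub>t u)(v) + (d\<^sub>t v)(u) = \<langle>u(T),
  v(T)\<rangle> - \<langle>u(0), v(0)\<rangle>\<close> on \<open>X\<close> (\<open>integration_by_parts\<close>). If \<open>u\<close> solves the initial value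
  problem, then \<open>\<theta> = u\<close> satisfies the first equation, and the second is the first one integrated
  by parts. Conversely, let \<open>(\<theta>, w)\<close> solve the system. Eliminating \<open>l\<close> and integrating by parts,
  the difference \<open>y = \<theta> - w\<close> satisfies \<open>(d\<^sub>t v)(y) + (A \<theta> - A w)(v) + \<langle>u\<^sub>0 - w(0), v(0)\<rangle> = 0\<close>
  for all \<open>v \<in> X\<close>. Read as a variational problem with natural boundary conditions
  (\<open>variational_problem\<close>), this says \<open>d\<^sub>t y = A \<theta> - A w\<close>, \<open>y(T) = 0\<close> and \<open>y(0) = u\<^sub>0 - w(0)\<close>.
  Therefore \<open>(A \<theta> - A w)(\<theta> - w) = - \<bar>y(0)\<bar>\<^sup>2 / 2 \<le> 0\<close>, and strong monotonicity gives \<open>\<theta> = w\<close>.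
  Now \<open>y = 0\<close>, so \<open>w(0) = u\<^sub>0\<close>, and \<open>w\<close> solves the initial value problem. Its solution is unique
  by the same energy argument.

  Existence (\<open>B_e_solution_exists\<close>) is reduced by a contraction to the linear equation \<open>d\<^sub>t u +
  \<kappa> u = g\<close>, which is solved by least squares (\<open>linear_problem_solvable\<close>): the residual of a
  minimizer solves a homogeneous backward equation and vanishes.

  The Hilbert spaces need not be separable, so the facts about Bochner spaces are proved for
  strongly measurable functions: completeness and the Riesz theorem (\<open>L2_complete\<close>, \<open>L2_Riesz\<close>),
  the product rule for primitives (\<open>primitive_product_rule\<close>), and the density in \<open>X\<close> of
  functions with a derivative in \<open>Y\<close> (\<open>regular_pairs_dense\<close>), which carries the product rule
  over to \<open>X\<close>. Density and the linear problem both follow from one abstract lemma on minimizing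
  sequences and from the variational problem. Distributional derivatives are tied to primitives
  by the lemma of du Bois-Reymond (\<open>weak_derivative_weak_pair\<close>).
\<close>

section \<open>Minimizing sequences and bounded functionals\<close>

lemma discriminant_le:
  fixes a b d :: real
  assumes nonneg: "\<And>c. 0 \<le> a + 2 * c * b + c\<^sup>2 * d" and d: "0 \<le> d"
  shows "b\<^sup>2 \<le> a * d"
proof (cases "d = 0")
  case True
  have "b = 0"
  proof (rule ccontr)
    assume "b \<noteq> 0"
    then show False
      using nonneg[of "- (a + 1) / (2 * b)"] True by (simp add: field_simps)
  qed
  then show ?thesis using True by simp
next
  case False
  then show ?thesis
    using nonneg[of "- b / d"] d by (simp add: field_simps power2_eq_square)
qed

text \<open>
  A bounded functional \<open>L\<close> on a semi-inner product space is represented by any sequence that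
  minimizes \<open>ip p p - 2 * L p\<close>: the excess of the energy over its infimum controls both the
  residual of the Euler--Lagrange equation and the distance between two members of the sequence.
  The space is given by an operation \<open>comb c p q\<close> in the role of \<open>p + c q\<close>, so that one lemma
  yields the Riesz theorem in \<open>V\<close> and in the Bochner space, the density of regular functions in
  \<open>X\<close>, and the solution of the linear problem.
\<close>

lemma minimizing_sequence_represents_functional:
  fixes ip :: "'a \<Rightarrow> 'a \<Rightarrow> real" and L :: "'a \<Rightarrow> real" and comb :: "real \<Rightarrow> 'a \<Rightarrow> 'a \<Rightarrow> 'a"
  assumes ne: "S \<noteq> {}"
    and comb: "\<And>c p q. p \<in> S \<Longrightarrow> q \<in> S \<Longrightarrow> comb c p q \<in> S"
    and ip_comb: "\<And>c p q r. p \<in> S \<Longrightarrow> q \<in> S \<Longrightarrow> r \<in> S \<Longrightarrow>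
      ip (comb c p q) r = ip p r + c * ip q r"
    and sym: "\<And>p q. p \<in> S \<Longrightarrow> q \<in> S \<Longrightarrow> ip p q = ip q p"
    and nonneg: "\<And>p. p \<in> S \<Longrightarrow> 0 \<le> ip p p"
    and L_comb: "\<And>c p q. p \<in> S \<Longrightarrow> q \<in> S \<Longrightarrow> L (comb c p q) = L p + c * L q"
    and bound: "\<And>p. p \<in> S \<Longrightarrow> (L p)\<^sup>2 \<le> C * ip p p" and C: "0 \<le> C"
  obtains p where "\<And>n::nat. p n \<in> S"
    and "\<And>e. 0 < e \<Longrightarrow>
      \<exists>N. \<forall>m\<ge>N. \<forall>n\<ge>N. ip (comb (-1) (p m) (p n)) (comb (-1) (p m) (p n)) < e"
    and "\<And>q. q \<in> S \<Longrightarrow> (\<lambda>n. ip (p n) q) \<longlonglongrightarrow> L q"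
proof -
  define J where "J p = ip p p - 2 * L p" for p
  define m where "m = Inf (J ` S)"
  have lower: "- C \<le> J p" if p: "p \<in> S" for p
  proof -
    have "(2 * L p)\<^sup>2 \<le> 4 * (C * ip p p)"
      using bound[OF p] by (simp add: power_mult_distrib)
    also have "\<dots> \<le> (C + ip p p)\<^sup>2"
      using sum_squares_ge_zero[of "C - ip p p" 0] by (simp add: power2_eq_square algebra_simps)
    finally have "\<bar>2 * L p\<bar> \<le> \<bar>C + ip p p\<bar>"
      by (simp only: abs_le_square_iff)
    then show ?thesis
      using nonneg[OF p] C by (simp add: J_def)
  qed
  have bdd: "bdd_below (J ` S)"
    using lower by (auto intro!: bdd_belowI[of _ "- C"])
  have m_le: "m \<le> J p" if "p \<in> S" for p
    unfolding m_def using bdd that by (intro cInf_lower) auto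
  have "\<exists>p\<in>S. J p < m + 1 / real (Suc n)" for n
    using cInf_less_iff[of "J ` S" "m + 1 / real (Suc n)"] ne bdd by (auto simp: m_def)
  then obtain p where p: "\<And>n. p n \<in> S" "\<And>n. J (p n) < m + 1 / real (Suc n)"
    by metis
  have J_comb: "J (comb c u q) = J u + 2 * c * (ip u q - L q) + c\<^sup>2 * ip q q"
    if "u \<in> S" "q \<in> S" for c u q
    using that by (simp add: J_def ip_comb L_comb comb sym[of u "comb c u q"] sym[of q "comb c u q"]
        sym[of q u] power2_eq_square algebra_simps)
  \<comment> \<open>Almost minimality makes the Euler--Lagrange equation hold up to the excess energy.\<close>
  have key: "(ip (p n) q - L q)\<^sup>2 \<le> 1 / real (Suc n) * ip q q" if q: "q \<in> S" for n q
  proof (rule discriminant_le)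
    show "0 \<le> 1 / real (Suc n) + 2 * c * (ip (p n) q - L q) + c\<^sup>2 * ip q q" for c
      using m_le[OF comb[OF p(1) q], of c n] p(2)[of n] J_comb[OF p(1) q, of c n] by simp
  qed (rule nonneg[OF q])
  have conv: "(\<lambda>n. ip (p n) q) \<longlonglongrightarrow> L q" if q: "q \<in> S" for q
  proof -
    have "(\<lambda>n. 1 / real (Suc n)) \<longlonglongrightarrow> 0"
      using LIMSEQ_inverse_real_of_nat by (simp add: inverse_eq_divide)
    then have "(\<lambda>n. 1 / real (Suc n) * ip q q) \<longlonglongrightarrow> 0"
      by (rule tendsto_mult_left_zero)
    then have "(\<lambda>n. (ip (p n) q - L q)\<^sup>2) \<longlonglongrightarrow> 0"
      by (rule Lim_null_comparison[rotated]) (use key[OF q] in auto)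
    then have "(\<lambda>n. sqrt ((ip (p n) q - L q)\<^sup>2)) \<longlonglongrightarrow> sqrt 0"
      by (rule tendsto_real_sqrt)
    then show ?thesis
      by (simp add: tendsto_rabs_zero_iff LIM_zero_iff)
  qed
  have cauchy: "\<exists>N. \<forall>k\<ge>N. \<forall>n\<ge>N. ip (comb (-1) (p k) (p n)) (comb (-1) (p k) (p n)) < e"
    if e: "0 < e" for e
  proof -
    obtain N where N: "4 / e < real N" using reals_Archimedean2 by blast
    show ?thesis
    proof (intro exI allI impI)
      fix k n assume kn: "N \<le> k" "N \<le> n"
      define q where "q = comb (-1) (p k) (p n)"
      have q: "q \<in> S" using comb p by (simp add: q_def)
      let ?a = "ip (p k) q - L q" and ?b = "ip (p n) q - L q"
      have eq: "ip q q = ?a - ?b"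
        using ip_comb[OF p(1) p(1) q, of "-1" k n] by (simp add: q_def)
      have "(ip q q)\<^sup>2 \<le> 2 * ?a\<^sup>2 + 2 * ?b\<^sup>2"
        unfolding eq using sum_squares_ge_zero[of "?a + ?b" 0]
        by (simp add: power2_eq_square algebra_simps)
      also have "\<dots> \<le> (2 / real (Suc k) + 2 / real (Suc n)) * ip q q"
        using key[OF q, of k] key[OF q, of n] by (simp add: algebra_simps)
      finally have "ip q q * ip q q \<le> (2 / real (Suc k) + 2 / real (Suc n)) * ip q q"
        by (simp add: power2_eq_square)
      then have "ip q q \<le> 2 / real (Suc k) + 2 / real (Suc n)"
        using nonneg[OF q] by (cases "ip q q = 0") (auto simp: add_nonneg_nonneg)
      also have "\<dots> < e"
      proof -
        have "4 < e * real N" using N e by (simp add: field_simps)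
        then have "4 < e * real (Suc k)" "4 < e * real (Suc n)"
          using kn e mult_left_mono[of "real N" "real (Suc k)" e] mult_left_mono[of "real N" "real (Suc n)" e]
          by (simp_all add: algebra_simps)
        then have "2 / real (Suc k) < e / 2" "2 / real (Suc n) < e / 2"
          by (simp_all add: divide_simps algebra_simps)
        then show ?thesis by simp
      qed
      finally show "ip (comb (-1) (p k) (p n)) (comb (-1) (p k) (p n)) < e"
        by (simp add: q_def)
    qed
  qed
  show ?thesis using that p(1) cauchy conv by blast
qed

section \<open>Strongly measurable functions\<close>

lemma strongly_measurable_simple: "simple_function M s \<Longrightarrow> strongly_measurable M s"
  unfolding strongly_measurable_def by (intro exI[of _ "\<lambda>_. s"]) auto

lemma strongly_measurable_const: "strongly_measurable M (\<lambda>_. c)"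
  by (rule strongly_measurable_simple) simp

lemma strongly_measurable_cong_AE:
  assumes "strongly_measurable M f" "AE x in M. f x = g x"
  shows "strongly_measurable M g"
proof -
  obtain s where "\<And>i. simple_function M (s i)" "AE x in M. (\<lambda>i. s i x) \<longlonglongrightarrow> f x"
    using assms(1) by (auto simp: strongly_measurable_def)
  moreover from this(2) assms(2) have "AE x in M. (\<lambda>i. s i x) \<longlonglongrightarrow> g x" by eventually_elim simp
  ultimately show ?thesis by (auto simp: strongly_measurable_def)
qed

lemma strongly_measurable_compose2:
  assumes h: "continuous_on UNIV (\<lambda>p. h (fst p) (snd p))"
    and f: "strongly_measurable M f" and g: "strongly_measurable M g"
  shows "strongly_measurable M (\<lambda>x. h (f x) (g x))"
proof -
  obtain s where s: "\<And>i. simple_function M (s i)" "AE x in M. (\<lambda>i. s i x) \<longlonglongrightarrow> f x"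
    using f by (auto simp: strongly_measurable_def)
  obtain t where t: "\<And>i. simple_function M (t i)" "AE x in M. (\<lambda>i. t i x) \<longlonglongrightarrow> g x"
    using g by (auto simp: strongly_measurable_def)
  have "AE x in M. (\<lambda>i. h (s i x) (t i x)) \<longlonglongrightarrow> h (f x) (g x)"
    using s(2) t(2)
  proof eventually_elim
    fix x assume "(\<lambda>i. s i x) \<longlonglongrightarrow> f x" "(\<lambda>i. t i x) \<longlonglongrightarrow> g x"
    then have "(\<lambda>i. (s i x, t i x)) \<longlonglongrightarrow> (f x, g x)" by (rule tendsto_Pair)
    from continuous_on_tendsto_compose[OF h this] show "(\<lambda>i. h (s i x) (t i x)) \<longlonglongrightarrow> h (f x) (g x)"
      by simp
  qed
  moreover have "simple_function M (\<lambda>x. h (s i x) (t i x))" for i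
    by (rule simple_function_compose2[OF s(1) t(1)])
  ultimately show ?thesis
    unfolding strongly_measurable_def by (intro exI[of _ "\<lambda>i x. h (s i x) (t i x)"] conjI allI)
qed

lemma strongly_measurable_compose:
  assumes "continuous_on UNIV h" "strongly_measurable M f"
  shows "strongly_measurable M (\<lambda>x. h (f x))"
proof (rule strongly_measurable_compose2[where h = "\<lambda>a b. h a", OF _ assms(2) assms(2)])
  show "continuous_on UNIV (\<lambda>p. h (fst p))"
    by (rule continuous_on_compose2[OF assms(1)]) (auto intro: continuous_intros)
qed

lemma strongly_measurable_add:
  "strongly_measurable M f \<Longrightarrow> strongly_measurable M g \<Longrightarrow> strongly_measurable M (\<lambda>x. f x + g x)"
  by (rule strongly_measurable_compose2[where h = "\<lambda>a b. a + b"]) (auto intro!: continuous_intros)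

lemma strongly_measurable_scaleR:
  "strongly_measurable M f \<Longrightarrow> strongly_measurable M g \<Longrightarrow> strongly_measurable M (\<lambda>x. f x *\<^sub>R g x)"
  by (rule strongly_measurable_compose2[where h = "\<lambda>a b. a *\<^sub>R b"]) (auto intro!: continuous_intros)

lemma strongly_measurable_inner:
  "strongly_measurable M f \<Longrightarrow> strongly_measurable M g \<Longrightarrow> strongly_measurable M (\<lambda>x. f x \<bullet> g x)"
  by (rule strongly_measurable_compose2[where h = "\<lambda>a b. a \<bullet> b"]) (auto intro!: continuous_intros)

lemma strongly_measurable_norm:
  "strongly_measurable M f \<Longrightarrow> strongly_measurable M (\<lambda>x. norm (f x))"
  by (rule strongly_measurable_compose) (auto intro!: continuous_intros)

lemma strongly_measurable_bounded_linear:
  "bounded_linear h \<Longrightarrow> strongly_measurable M f \<Longrightarrow> strongly_measurable M (\<lambda>x. h (f x))"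
  by (rule strongly_measurable_compose) (auto intro: linear_continuous_on)

lemma strongly_measurable_borel:
  fixes f :: "'a \<Rightarrow> real"
  assumes "f \<in> borel_measurable M"
  shows "strongly_measurable M f"
  using borel_measurable_implies_sequence_metric[OF assms, of 0] unfolding strongly_measurable_def
  by (auto intro!: AE_I2)

locale complete_finite_measure = complete_measure M + finite_measure M for M :: "'a measure"
begin

text \<open>
  Completeness of the measure enters here: an almost everywhere limit of simple functions is
  measurable.
\<close>

lemma borel_measurable_AE:
  fixes f g :: "'a \<Rightarrow> real"
  assumes f: "f \<in> borel_measurable M" and fg: "AE x in M. f x = g x"
  shows "g \<in> borel_measurable M"
proof (rule measurableI)
  fix A :: "real set" assume A: "A \<in> sets borel"
  show "g -` A \<inter> space M \<in> sets M"
  proof (rule in_sets_AE)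
    show "f -` A \<inter> space M \<in> sets M" using f A by (rule measurable_sets)
    show "AE x in M. x \<in> f -` A \<inter> space M \<longleftrightarrow> x \<in> g -` A \<inter> space M"
      using fg by eventually_elim auto
  qed auto
qed auto

lemma borel_measurable_strongly:
  fixes f :: "'a \<Rightarrow> real"
  assumes "strongly_measurable M f"
  shows "f \<in> borel_measurable M"
proof -
  obtain s where s: "\<And>i. simple_function M (s i)" "AE x in M. (\<lambda>i. s i x) \<longlonglongrightarrow> f x"
    using assms by (auto simp: strongly_measurable_def)
  have [measurable]: "s i \<in> borel_measurable M" for i
    using s(1) by (rule borel_measurable_simple_function)
  have "(\<lambda>x. lim (\<lambda>i. s i x)) \<in> borel_measurable M" by measurable
  moreover have "AE x in M. lim (\<lambda>i. s i x) = f x"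
    using s(2) by eventually_elim (rule limI)
  ultimately show ?thesis by (rule borel_measurable_AE)
qed

lemma borel_measurable_norm_strongly:
  "strongly_measurable M f \<Longrightarrow> (\<lambda>x. norm (f x)) \<in> borel_measurable M"
  by (rule borel_measurable_strongly[OF strongly_measurable_norm])

lemma borel_measurable_inner_strongly:
  "strongly_measurable M f \<Longrightarrow> strongly_measurable M g \<Longrightarrow> (\<lambda>x. f x \<bullet> g x) \<in> borel_measurable M"
  by (rule borel_measurable_strongly[OF strongly_measurable_inner])

section \<open>The space of square integrable functions\<close>

lemma L2_strongly_measurable: "f \<in> bochner_L2 M \<Longrightarrow> strongly_measurable M f"
  by (simp add: bochner_L2_def)

lemma L2_integrable_norm2: "f \<in> bochner_L2 M \<Longrightarrow> integrable M (\<lambda>x. (norm (f x))\<^sup>2)"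
  by (simp add: bochner_L2_def)

lemma L2_cong_AE:
  assumes f: "f \<in> bochner_L2 M" and fg: "AE x in M. f x = g x"
  shows "g \<in> bochner_L2 M"
proof -
  have g: "strongly_measurable M g"
    using strongly_measurable_cong_AE[OF L2_strongly_measurable[OF f] fg] .
  have "integrable M (\<lambda>x. (norm (g x))\<^sup>2)"
  proof (rule integrable_cong_AE_imp[OF L2_integrable_norm2[OF f]])
    show "(\<lambda>x. (norm (g x))\<^sup>2) \<in> borel_measurable M"
      using borel_measurable_norm_strongly[OF g] by measurable
    show "AE x in M. (norm (f x))\<^sup>2 = (norm (g x))\<^sup>2" using fg by eventually_elim simp
  qed
  then show ?thesis using g by (simp add: bochner_L2_def)
qed

lemma L2_dominated:
  assumes f: "f \<in> bochner_L2 M" and g: "strongly_measurable M g"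
    and le: "AE x in M. norm (g x) \<le> C * norm (f x)"
  shows "g \<in> bochner_L2 M"
proof -
  have "integrable M (\<lambda>x. (norm (g x))\<^sup>2)"
  proof (rule Bochner_Integration.integrable_bound)
    show "integrable M (\<lambda>x. C\<^sup>2 * (norm (f x))\<^sup>2)"
      using f by (simp add: bochner_L2_def)
    show "(\<lambda>x. (norm (g x))\<^sup>2) \<in> borel_measurable M"
      using borel_measurable_norm_strongly[OF g] by measurable
    show "AE x in M. norm ((norm (g x))\<^sup>2) \<le> norm (C\<^sup>2 * (norm (f x))\<^sup>2)"
      using le by eventually_elim (simp add: power_mono flip: power_mult_distrib)
  qed
  then show ?thesis using g by (simp add: bochner_L2_def)
qed

lemma L2_add [intro]:
  assumes f: "f \<in> bochner_L2 M" and g: "g \<in> bochner_L2 M"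
  shows "(\<lambda>x. f x + g x) \<in> bochner_L2 M"
proof -
  have s: "strongly_measurable M (\<lambda>x. f x + g x)"
    using f g by (simp add: L2_strongly_measurable strongly_measurable_add)
  have "integrable M (\<lambda>x. (norm (f x + g x))\<^sup>2)"
  proof (rule Bochner_Integration.integrable_bound)
    show "integrable M (\<lambda>x. 2 * (norm (f x))\<^sup>2 + 2 * (norm (g x))\<^sup>2)"
      using f g by (simp add: bochner_L2_def)
    show "(\<lambda>x. (norm (f x + g x))\<^sup>2) \<in> borel_measurable M"
      using borel_measurable_norm_strongly[OF s] by measurable
    have "(norm (f x + g x))\<^sup>2 \<le> 2 * (norm (f x))\<^sup>2 + 2 * (norm (g x))\<^sup>2" for x
    proof -
      have "(norm (f x + g x))\<^sup>2 \<le> (norm (f x) + norm (g x))\<^sup>2"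
        by (intro power_mono norm_triangle_ineq norm_ge_zero)
      also have "\<dots> \<le> 2 * (norm (f x))\<^sup>2 + 2 * (norm (g x))\<^sup>2"
        using sum_squares_ge_zero[of "norm (f x) - norm (g x)" 0]
        by (simp add: power2_eq_square algebra_simps)
      finally show ?thesis .
    qed
    then show "AE x in M. norm ((norm (f x + g x))\<^sup>2) \<le> norm (2 * (norm (f x))\<^sup>2 + 2 * (norm (g x))\<^sup>2)"
      by simp
  qed
  then show ?thesis using s by (simp add: bochner_L2_def)
qed

lemma L2_bounded_linear:
  assumes h: "bounded_linear h" and f: "f \<in> bochner_L2 M"
  shows "(\<lambda>x. h (f x)) \<in> bochner_L2 M"
proof -
  obtain K where K: "\<And>x. norm (h x) \<le> norm x * K" using bounded_linear.bounded[OF h] by blast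
  show ?thesis
    using K by (intro L2_dominated[OF f strongly_measurable_bounded_linear[OF h L2_strongly_measurable[OF f]], where C = K])
      (simp add: mult.commute)
qed

lemma L2_scaleR [intro]: "f \<in> bochner_L2 M \<Longrightarrow> (\<lambda>x. c *\<^sub>R f x) \<in> bochner_L2 M"
  by (rule L2_bounded_linear[OF bounded_linear_scaleR_right])

lemma L2_uminus [intro]: "f \<in> bochner_L2 M \<Longrightarrow> (\<lambda>x. - f x) \<in> bochner_L2 M"
  by (rule L2_bounded_linear[OF bounded_linear_minus[OF bounded_linear_ident]])

lemma L2_diff [intro]: "f \<in> bochner_L2 M \<Longrightarrow> g \<in> bochner_L2 M \<Longrightarrow> (\<lambda>x. f x - g x) \<in> bochner_L2 M"
  using L2_add[OF _ L2_uminus, of f g] by simp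

lemma L2_bounded:
  assumes "strongly_measurable M f" "\<And>x. x \<in> space M \<Longrightarrow> norm (f x) \<le> C"
  shows "f \<in> bochner_L2 M"
proof -
  have "(\<lambda>x. 1 :: real) \<in> bochner_L2 M"
    by (simp add: bochner_L2_def strongly_measurable_const)
  then show ?thesis using assms by (rule_tac L2_dominated[where C = C]) auto
qed

lemma L2_const [intro]: "(\<lambda>x. c) \<in> bochner_L2 M"
  by (rule L2_bounded[where C = "norm c"]) (auto simp: strongly_measurable_const)

lemma L2_integrable_inner:
  assumes f: "f \<in> bochner_L2 M" and g: "g \<in> bochner_L2 M"
  shows "integrable M (\<lambda>x. f x \<bullet> g x)"
proof (rule Bochner_Integration.integrable_bound)
  show "integrable M (\<lambda>x. (norm (f x))\<^sup>2 + (norm (g x))\<^sup>2)"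
    using f g by (simp add: bochner_L2_def)
  show "(\<lambda>x. f x \<bullet> g x) \<in> borel_measurable M"
    using f g by (simp add: L2_strongly_measurable borel_measurable_inner_strongly)
  have "\<bar>f x \<bullet> g x\<bar> \<le> (norm (f x))\<^sup>2 + (norm (g x))\<^sup>2" for x
  proof -
    have "2 * (norm (f x) * norm (g x)) \<le> (norm (f x))\<^sup>2 + (norm (g x))\<^sup>2"
      using sum_squares_ge_zero[of "norm (f x) - norm (g x)" 0]
      by (simp add: power2_eq_square algebra_simps)
    then show ?thesis
      using Cauchy_Schwarz_ineq2[of "f x" "g x"] mult_nonneg_nonneg[of "norm (f x)" "norm (g x)"] by simp
  qed
  then show "AE x in M. norm (f x \<bullet> g x) \<le> norm ((norm (f x))\<^sup>2 + (norm (g x))\<^sup>2)" by simp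
qed

lemma L2_integrable_norm:
  assumes f: "f \<in> bochner_L2 M"
  shows "integrable M (\<lambda>x. norm (f x))"
  using L2_integrable_inner[of "\<lambda>_. 1 :: real" "\<lambda>x. norm (f x)"] f
  by (auto simp: bochner_L2_def strongly_measurable_const strongly_measurable_norm)

end

definition L2_inner :: "'a measure \<Rightarrow> ('a \<Rightarrow> 'b::real_inner) \<Rightarrow> ('a \<Rightarrow> 'b) \<Rightarrow> real" where
  "L2_inner M f g = (LINT x|M. f x \<bullet> g x)"

lemma L2_inner_commute: "L2_inner M f g = L2_inner M g f"
  by (simp add: L2_inner_def inner_commute)

lemma L2_norm_nonneg [simp]: "0 \<le> bochner_L2_norm M f"
  by (simp add: bochner_L2_norm_def)

lemma L2_norm_power2: "(bochner_L2_norm M f)\<^sup>2 = L2_inner M f f"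
  by (simp add: bochner_L2_norm_def L2_inner_def dot_square_norm)

lemma L2_inner_self_nonneg: "0 \<le> L2_inner M f f"
  by (simp flip: L2_norm_power2)

context complete_finite_measure
begin

lemma L2_inner_cong_AE:
  assumes "f \<in> bochner_L2 M" "g \<in> bochner_L2 M" "AE x in M. f x = f' x" "AE x in M. g x = g' x"
  shows "L2_inner M f g = L2_inner M f' g'"
proof -
  have "f' \<in> bochner_L2 M" "g' \<in> bochner_L2 M" using assms L2_cong_AE by blast+
  then have "integrable M (\<lambda>x. f' x \<bullet> g' x)" by (rule L2_integrable_inner)
  moreover have "integrable M (\<lambda>x. f x \<bullet> g x)" using assms by (intro L2_integrable_inner)
  moreover have "AE x in M. f x \<bullet> g x = f' x \<bullet> g' x" using assms(3,4) by eventually_elim simp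
  ultimately show ?thesis unfolding L2_inner_def by (intro integral_cong_AE) auto
qed

lemma L2_inner_add_left:
  "f \<in> bochner_L2 M \<Longrightarrow> g \<in> bochner_L2 M \<Longrightarrow> h \<in> bochner_L2 M \<Longrightarrow>
    L2_inner M (\<lambda>x. f x + g x) h = L2_inner M f h + L2_inner M g h"
  by (simp add: L2_inner_def inner_add_left L2_integrable_inner)

lemma L2_inner_diff_left:
  "f \<in> bochner_L2 M \<Longrightarrow> g \<in> bochner_L2 M \<Longrightarrow> h \<in> bochner_L2 M \<Longrightarrow>
    L2_inner M (\<lambda>x. f x - g x) h = L2_inner M f h - L2_inner M g h"
  by (simp add: L2_inner_def inner_diff_left L2_integrable_inner)

lemma L2_inner_scaleR_left: "L2_inner M (\<lambda>x. c *\<^sub>R f x) h = c * L2_inner M f h"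
  by (simp add: L2_inner_def)

lemma L2_inner_add_right:
  "f \<in> bochner_L2 M \<Longrightarrow> g \<in> bochner_L2 M \<Longrightarrow> h \<in> bochner_L2 M \<Longrightarrow>
    L2_inner M h (\<lambda>x. f x + g x) = L2_inner M h f + L2_inner M h g"
  by (simp add: L2_inner_commute[of M h] L2_inner_add_left)

lemma L2_inner_diff_right:
  "f \<in> bochner_L2 M \<Longrightarrow> g \<in> bochner_L2 M \<Longrightarrow> h \<in> bochner_L2 M \<Longrightarrow>
    L2_inner M h (\<lambda>x. f x - g x) = L2_inner M h f - L2_inner M h g"
  by (simp add: L2_inner_commute[of M h] L2_inner_diff_left)

lemma L2_inner_scaleR_right: "L2_inner M h (\<lambda>x. c *\<^sub>R f x) = c * L2_inner M h f"
  by (simp add: L2_inner_def)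

lemmas L2_inner_linear = L2_inner_add_left L2_inner_add_right L2_inner_diff_left L2_inner_diff_right
  L2_inner_scaleR_left L2_inner_scaleR_right L2_add L2_diff L2_scaleR

lemma L2_Cauchy_Schwarz:
  assumes f: "f \<in> bochner_L2 M" and g: "g \<in> bochner_L2 M"
  shows "\<bar>L2_inner M f g\<bar> \<le> bochner_L2_norm M f * bochner_L2_norm M g"
proof -
  have "(L2_inner M f g)\<^sup>2 \<le> L2_inner M f f * L2_inner M g g"
  proof (rule discriminant_le)
    fix c
    have "0 \<le> L2_inner M (\<lambda>x. f x + c *\<^sub>R g x) (\<lambda>x. f x + c *\<^sub>R g x)"
      by (rule L2_inner_self_nonneg)
    also have "\<dots> = L2_inner M f f + 2 * c * L2_inner M f g + c\<^sup>2 * L2_inner M g g"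
      using f g by (simp add: L2_inner_linear L2_inner_commute[of M g f] power2_eq_square algebra_simps)
    finally show "0 \<le> \<dots>" .
  qed (rule L2_inner_self_nonneg)
  also have "\<dots> = (bochner_L2_norm M f * bochner_L2_norm M g)\<^sup>2"
    by (simp add: L2_norm_power2 power_mult_distrib)
  finally show ?thesis by (simp add: power2_le_iff_abs_le)
qed

lemma L2_norm_triangle:
  assumes f: "f \<in> bochner_L2 M" and g: "(g :: 'a \<Rightarrow> 'b::real_inner) \<in> bochner_L2 M"
  shows "bochner_L2_norm M (\<lambda>x. f x + g x) \<le> bochner_L2_norm M f + bochner_L2_norm M g"
proof (rule power2_le_imp_le)
  have "(bochner_L2_norm M (\<lambda>x. f x + g x))\<^sup>2
      = (bochner_L2_norm M f)\<^sup>2 + 2 * L2_inner M f g + (bochner_L2_norm M g)\<^sup>2"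
    using f g by (simp add: L2_norm_power2 L2_inner_linear L2_inner_commute[of M g f])
  also have "\<dots> \<le> (bochner_L2_norm M f + bochner_L2_norm M g)\<^sup>2"
    using L2_Cauchy_Schwarz[OF f g] by (simp add: power2_sum)
  finally show "(bochner_L2_norm M (\<lambda>x. f x + g x))\<^sup>2 \<le> (bochner_L2_norm M f + bochner_L2_norm M g)\<^sup>2" .
qed simp

lemma L2_norm_scaleR: "bochner_L2_norm M (\<lambda>x. c *\<^sub>R f x) = \<bar>c\<bar> * bochner_L2_norm M f"
  by (simp add: bochner_L2_norm_def power_mult_distrib real_sqrt_mult)

lemma L2_norm_minus_commute: "bochner_L2_norm M (\<lambda>x. f x - g x) = bochner_L2_norm M (\<lambda>x. g x - f x)"
  by (simp add: bochner_L2_norm_def norm_minus_commute)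

lemma L2_norm_triangle_diff:
  assumes "f \<in> bochner_L2 M" "g \<in> bochner_L2 M" "(h :: 'a \<Rightarrow> 'b::real_inner) \<in> bochner_L2 M"
  shows "bochner_L2_norm M (\<lambda>x. f x - h x)
    \<le> bochner_L2_norm M (\<lambda>x. f x - g x) + bochner_L2_norm M (\<lambda>x. g x - h x)"
  using L2_norm_triangle[OF L2_diff[OF assms(1,2)] L2_diff[OF assms(2,3)]] by simp

lemma L2_norm_eq_0_iff:
  assumes f: "f \<in> bochner_L2 M"
  shows "bochner_L2_norm M f = 0 \<longleftrightarrow> (AE x in M. f x = 0)"
  using integral_nonneg_eq_0_iff_AE[OF L2_integrable_norm2[OF f]] by (simp add: bochner_L2_norm_def)

lemma L2_norm_cong_AE:
  assumes f: "f \<in> bochner_L2 M" and fg: "AE x in M. f x = g x"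
  shows "bochner_L2_norm M f = bochner_L2_norm M g"
proof -
  have "(LINT x|M. (norm (f x))\<^sup>2) = (LINT x|M. (norm (g x))\<^sup>2)"
    using L2_integrable_norm2[OF f] L2_integrable_norm2[OF L2_cong_AE[OF f fg]] fg
    by (intro integral_cong_AE) auto
  then show ?thesis by (simp add: bochner_L2_norm_def)
qed

lemma L2_norm_bounded_linear_le:
  assumes h: "bounded_linear h" and K: "\<And>x. norm (h x) \<le> K * norm x" and f: "f \<in> bochner_L2 M"
  shows "bochner_L2_norm M (\<lambda>x. h (f x)) \<le> \<bar>K\<bar> * bochner_L2_norm M f"
proof -
  have "(LINT x|M. (norm (h (f x)))\<^sup>2) \<le> (LINT x|M. K\<^sup>2 * (norm (f x))\<^sup>2)"
  proof (rule integral_mono)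
    show "(norm (h (f x)))\<^sup>2 \<le> K\<^sup>2 * (norm (f x))\<^sup>2" for x
      using power_mono[OF K[of "f x"] norm_ge_zero, of 2] by (simp add: power_mult_distrib)
  qed (use L2_integrable_norm2[OF f] L2_integrable_norm2[OF L2_bounded_linear[OF h f]] in auto)
  then have "sqrt (LINT x|M. (norm (h (f x)))\<^sup>2) \<le> sqrt (K\<^sup>2 * (LINT x|M. (norm (f x))\<^sup>2))"
    by (intro real_sqrt_le_mono) simp
  then show ?thesis by (simp add: bochner_L2_norm_def real_sqrt_mult)
qed

lemma L1_le_L2:
  assumes f: "f \<in> bochner_L2 M"
  shows "(LINT x|M. norm (f x)) \<le> sqrt (measure M (space M)) * bochner_L2_norm M f"
proof -
  have g: "(\<lambda>x. norm (f x)) \<in> bochner_L2 M"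
    using f by (simp add: bochner_L2_def strongly_measurable_norm)
  have "\<bar>L2_inner M (\<lambda>_. 1 :: real) (\<lambda>x. norm (f x))\<bar>
      \<le> bochner_L2_norm M (\<lambda>_. 1 :: real) * bochner_L2_norm M (\<lambda>x. norm (f x))"
    by (rule L2_Cauchy_Schwarz[OF L2_const g])
  then show ?thesis by (simp add: L2_inner_def bochner_L2_norm_def)
qed

subsection \<open>Simple functions are dense\<close>

lemma L2_simple:
  assumes "simple_function M s"
  shows "s \<in> bochner_L2 M"
proof -
  have "finite (s ` space M)" using assms by (simp add: simple_function_def)
  then obtain C where "\<And>y. y \<in> s ` space M \<Longrightarrow> norm y \<le> C"
    using bounded_iff finite_imp_bounded by metis
  then show ?thesis
    by (intro L2_bounded[OF strongly_measurable_simple[OF assms], where C = C]) auto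
qed

text \<open>
  A sequence of simple functions that converges almost everywhere is made dominated by dropping
  its values where they exceed twice the norm of the limit; dominated convergence does the rest.
\<close>

lemma L2_approx_simple:
  assumes f: "f \<in> bochner_L2 M"
  obtains s where "\<And>i::nat. simple_function M (s i)"
    and "(\<lambda>i. bochner_L2_norm M (\<lambda>x. f x - s i x)) \<longlonglongrightarrow> 0"
proof -
  obtain s where s: "\<And>i::nat. simple_function M (s i)" "AE x in M. (\<lambda>i. s i x) \<longlonglongrightarrow> f x"
    using L2_strongly_measurable[OF f] by (auto simp: strongly_measurable_def)
  have nf [measurable]: "(\<lambda>x. norm (f x)) \<in> borel_measurable M"
    using L2_strongly_measurable[OF f] by (rule borel_measurable_norm_strongly)
  define t where "t i x = (if norm (s i x) \<le> 2 * norm (f x) then s i x else 0)" for i x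
  have t: "simple_function M (t i)" for i
  proof -
    have [measurable]: "(\<lambda>x. norm (s i x)) \<in> borel_measurable M"
      using simple_function_compose1[OF s(1), of norm] by (rule borel_measurable_simple_function)
    have "{x \<in> space M. norm (s i x) \<le> 2 * norm (f x)} \<in> sets M" by measurable
    then show ?thesis
      unfolding t_def by (intro simple_function_If[OF s(1) simple_function_const])
  qed
  have ft: "(\<lambda>x. f x - t i x) \<in> bochner_L2 M" for i
    using f L2_simple[OF t] by (rule L2_diff)
  have "(\<lambda>i. LINT x|M. (norm (f x - t i x))\<^sup>2) \<longlonglongrightarrow> (LINT x|M. 0)"
  proof (rule integral_dominated_convergence)
    show "integrable M (\<lambda>x. 9 * (norm (f x))\<^sup>2)" using L2_integrable_norm2[OF f] by simp
    show "(\<lambda>x. (norm (f x - t i x))\<^sup>2) \<in> borel_measurable M" for i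
      using L2_integrable_norm2[OF ft] by (rule borel_measurable_integrable)
    show "AE x in M. (\<lambda>i. (norm (f x - t i x))\<^sup>2) \<longlonglongrightarrow> 0"
      using s(2)
    proof eventually_elim
      fix x assume lim: "(\<lambda>i. s i x) \<longlonglongrightarrow> f x"
      have "(\<lambda>i. t i x) \<longlonglongrightarrow> f x"
      proof (cases "f x = 0")
        case True
        then have "t i x = 0" for i by (simp add: t_def)
        then show ?thesis using True by simp
      next
        case False
        then have "norm (f x) < 2 * norm (f x)" by simp
        then have "\<forall>\<^sub>F i in sequentially. norm (s i x) < 2 * norm (f x)"
          using order_tendstoD(2)[OF tendsto_norm[OF lim]] by blast
        then have "\<forall>\<^sub>F i in sequentially. s i x = t i x"
          by eventually_elim (simp add: t_def)
        then show ?thesis using lim by (rule Lim_transform_eventually[rotated])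
      qed
      then have "(\<lambda>i. (norm (f x - t i x))\<^sup>2) \<longlonglongrightarrow> (norm (f x - f x))\<^sup>2"
        by (intro tendsto_intros)
      then show "(\<lambda>i. (norm (f x - t i x))\<^sup>2) \<longlonglongrightarrow> 0" by simp
    qed
    have "norm (f x - t i x) \<le> 3 * norm (f x)" for i x
    proof -
      have "norm (t i x) \<le> 2 * norm (f x)" by (simp add: t_def)
      then show ?thesis using norm_triangle_ineq4[of "f x" "t i x"] by simp
    qed
    then have "(norm (f x - t i x))\<^sup>2 \<le> (3 * norm (f x))\<^sup>2" for i x
      by (intro power_mono) auto
    then show "AE x in M. norm ((norm (f x - t i x))\<^sup>2) \<le> 9 * (norm (f x))\<^sup>2" for i
      by (simp add: power_mult_distrib)
  qed simp
  then have "(\<lambda>i. bochner_L2_norm M (\<lambda>x. f x - t i x)) \<longlonglongrightarrow> sqrt 0"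
    unfolding bochner_L2_norm_def by (intro tendsto_real_sqrt) simp
  then show ?thesis using that[OF t] by simp
qed

subsection \<open>Completeness\<close>

text \<open>
  The limit of a sequence that stays in a ball around \<open>g\<close> lies in that ball. This is how almost
  everywhere convergence is turned into membership and into convergence in norm.
\<close>

lemma L2_Fatou:
  fixes f :: "'a \<Rightarrow> 'b::real_inner"
  assumes s: "\<And>n::nat. s n \<in> bochner_L2 M" and f: "strongly_measurable M f"
    and lim: "AE x in M. (\<lambda>n. s n x) \<longlonglongrightarrow> f x" and g: "g \<in> bochner_L2 M"
    and le: "\<And>n. k \<le> n \<Longrightarrow> bochner_L2_norm M (\<lambda>x. s n x - g x) \<le> C"
  shows "f \<in> bochner_L2 M" and "bochner_L2_norm M (\<lambda>x. f x - g x) \<le> C"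
proof -
  have C: "0 \<le> C" using le[of k] L2_norm_nonneg[of M] order_trans by blast
  have sg: "(\<lambda>x. s n x - g x) \<in> bochner_L2 M" for n using s g by (rule L2_diff)
  have fg: "strongly_measurable M (\<lambda>x. f x - g x)"
    using strongly_measurable_add[OF f L2_strongly_measurable[OF L2_uminus[OF g]]] by simp
  have [measurable]: "(\<lambda>x. norm (f x - g x)) \<in> borel_measurable M"
    "(\<lambda>x. norm (s n x - g x)) \<in> borel_measurable M" for n
    using borel_measurable_norm_strongly[OF fg]
      borel_measurable_norm_strongly[OF L2_strongly_measurable[OF sg]] by auto
  have int_le: "(\<integral>\<^sup>+x. ennreal ((norm (s n x - g x))\<^sup>2) \<partial>M) \<le> ennreal (C\<^sup>2)" if "k \<le> n" for n
  proof -
    have "(LINT x|M. (norm (s n x - g x))\<^sup>2) \<le> C\<^sup>2"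
      using le[OF that] power_mono[of "bochner_L2_norm M (\<lambda>x. s n x - g x)" C 2]
      by (simp add: bochner_L2_norm_def)
    then show ?thesis
      using nn_integral_eq_integral[OF L2_integrable_norm2[OF sg]] by (simp add: ennreal_leI)
  qed
  have "(\<integral>\<^sup>+x. ennreal ((norm (f x - g x))\<^sup>2) \<partial>M)
      = (\<integral>\<^sup>+x. liminf (\<lambda>n. ennreal ((norm (s n x - g x))\<^sup>2)) \<partial>M)"
  proof (rule nn_integral_cong_AE)
    show "AE x in M. ennreal ((norm (f x - g x))\<^sup>2) = liminf (\<lambda>n. ennreal ((norm (s n x - g x))\<^sup>2))"
      using lim
    proof eventually_elim
      fix x assume "(\<lambda>n. s n x) \<longlonglongrightarrow> f x"
      then have "(\<lambda>n. ennreal ((norm (s n x - g x))\<^sup>2)) \<longlonglongrightarrow> ennreal ((norm (f x - g x))\<^sup>2)"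
        by (intro tendsto_intros)
      then show "ennreal ((norm (f x - g x))\<^sup>2) = liminf (\<lambda>n. ennreal ((norm (s n x - g x))\<^sup>2))"
        by (simp add: lim_imp_Liminf del: tendsto_ennreal_iff)
    qed
  qed
  also have "\<dots> \<le> liminf (\<lambda>n. \<integral>\<^sup>+x. ennreal ((norm (s n x - g x))\<^sup>2) \<partial>M)"
    by (rule nn_integral_liminf) measurable
  also have "\<dots> \<le> ennreal (C\<^sup>2)"
  proof (rule Liminf_le)
    show "\<forall>\<^sub>F n in sequentially. (\<integral>\<^sup>+x. ennreal ((norm (s n x - g x))\<^sup>2) \<partial>M) \<le> ennreal (C\<^sup>2)"
      using eventually_ge_at_top[of k] by eventually_elim (rule int_le)
  qed simp
  finally have le_C: "(\<integral>\<^sup>+x. ennreal ((norm (f x - g x))\<^sup>2) \<partial>M) \<le> ennreal (C\<^sup>2)" .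
  have "integrable M (\<lambda>x. (norm (f x - g x))\<^sup>2)"
    using le_C by (intro integrableI_bounded) (auto simp: order.strict_trans1[OF _ ennreal_less_top])
  then have fg2: "(\<lambda>x. f x - g x) \<in> bochner_L2 M" using fg by (simp add: bochner_L2_def)
  from L2_add[OF this g] show "f \<in> bochner_L2 M" by simp
  have "ennreal (LINT x|M. (norm (f x - g x))\<^sup>2) \<le> ennreal (C\<^sup>2)"
    using le_C nn_integral_eq_integral[OF L2_integrable_norm2[OF fg2]] by simp
  then have "(LINT x|M. (norm (f x - g x))\<^sup>2) \<le> C\<^sup>2" by simp
  then show "bochner_L2_norm M (\<lambda>x. f x - g x) \<le> C"
    unfolding bochner_L2_norm_def using C real_sqrt_le_mono by fastforce
qed

text \<open>
  The sum of the increments has finite integral, hence is finite almost everywhere, so that the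
  sequence is Cauchy at almost every point.
\<close>

lemma L2_fast_sequence_converges_AE:
  fixes s :: "nat \<Rightarrow> 'a \<Rightarrow> 'b::{real_inner,complete_space}"
  assumes s: "\<And>n. s n \<in> bochner_L2 M"
    and fast: "\<And>n. bochner_L2_norm M (\<lambda>x. s (Suc n) x - s n x) \<le> K * (1 / 2) ^ n"
  shows "AE x in M. convergent (\<lambda>n. s n x)"
proof -
  define d where "d n x = norm (s (Suc n) x - s n x)" for n x
  have sd: "(\<lambda>x. s (Suc n) x - s n x) \<in> bochner_L2 M" for n using s s by (rule L2_diff)
  have d_int: "integrable M (d n)" for n
    unfolding d_def by (rule L2_integrable_norm[OF sd])
  then have [measurable]: "d n \<in> borel_measurable M" for n by simp
  define c where "c = sqrt (measure M (space M)) * K"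
  have K: "0 \<le> K" using order_trans[OF L2_norm_nonneg fast[of 0]] by simp
  have d_le: "(\<integral>\<^sup>+x. ennreal (d n x) \<partial>M) \<le> ennreal (c * (1 / 2) ^ n)" for n
  proof -
    have "(LINT x|M. d n x) \<le> sqrt (measure M (space M)) * bochner_L2_norm M (\<lambda>x. s (Suc n) x - s n x)"
      unfolding d_def by (rule L1_le_L2[OF sd])
    also have "\<dots> \<le> sqrt (measure M (space M)) * (K * (1 / 2) ^ n)"
      using fast by (intro mult_left_mono) auto
    finally show ?thesis
      using nn_integral_eq_integral[OF d_int, of n]
      by (simp add: c_def mult.assoc ennreal_leI d_def[abs_def])
  qed
  have summ: "summable (\<lambda>n. c * (1 / 2) ^ n)" by (intro summable_mult summable_geometric) simp
  have "(\<integral>\<^sup>+x. (\<Sum>n. ennreal (d n x)) \<partial>M) = (\<Sum>n. \<integral>\<^sup>+x. ennreal (d n x) \<partial>M)"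
    by (rule nn_integral_suminf) measurable
  also have "\<dots> \<le> (\<Sum>n. ennreal (c * (1 / 2) ^ n))"
    by (intro suminf_le d_le) auto
  also have "\<dots> = ennreal (\<Sum>n. c * (1 / 2) ^ n)"
    using K summ by (intro suminf_ennreal2) (auto simp: c_def)
  finally have "(\<integral>\<^sup>+x. (\<Sum>n. ennreal (d n x)) \<partial>M) \<noteq> \<infinity>"
    by (auto simp: top_unique)
  then have "AE x in M. (\<Sum>n. ennreal (d n x)) \<noteq> \<infinity>"
    by (intro nn_integral_noteq_infinite) measurable
  then show ?thesis
  proof eventually_elim
    fix x assume fin: "(\<Sum>n. ennreal (d n x)) \<noteq> \<infinity>"
    have sum: "summable (\<lambda>n. d n x)"
      using fin by (intro summable_suminf_not_top) (auto simp: d_def)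
    have "Cauchy (\<lambda>n. s n x)"
    proof (rule CauchyI)
      fix e :: real assume "0 < e"
      then obtain N where N: "\<And>m n. N \<le> m \<Longrightarrow> norm (\<Sum>i\<in>{m..<n}. d i x) < e"
        using sum[unfolded summable_Cauchy] by blast
      have *: "norm (s m x - s n x) < e" if "N \<le> m" "m \<le> n" for m n
      proof -
        have "s n x - s m x = (\<Sum>i\<in>{m..<n}. s (Suc i) x - s i x)"
          using that by (subst sum_Suc_diff'[where f = "\<lambda>i. s i x"]) auto
        then have "norm (s n x - s m x) \<le> (\<Sum>i\<in>{m..<n}. d i x)"
          by (simp add: d_def norm_sum)
        then show ?thesis using N[OF that(1), of n] by (simp add: norm_minus_commute)
      qed
      show "\<exists>M. \<forall>m\<ge>M. \<forall>n\<ge>M. norm (s m x - s n x) < e"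
        using * by (metis nle_le norm_minus_commute)
    qed
    then show "convergent (\<lambda>n. s n x)" by (rule Cauchy_convergent)
  qed
qed

text \<open>
  Strong measurability of the limit is immediate if it is the limit of simple functions. The
  limit is therefore taken along simple functions that approximate a fast subsequence with the
  same rate.
\<close>

theorem L2_complete:
  fixes F :: "nat \<Rightarrow> 'a \<Rightarrow> 'b::{real_inner,complete_space}"
  assumes F: "\<And>n. F n \<in> bochner_L2 M"
    and cauchy: "\<And>e. 0 < e \<Longrightarrow> \<exists>N. \<forall>m\<ge>N. \<forall>n\<ge>N. bochner_L2_norm M (\<lambda>x. F m x - F n x) < e"
  obtains f where "f \<in> bochner_L2 M" "(\<lambda>n. bochner_L2_norm M (\<lambda>x. F n x - f x)) \<longlonglongrightarrow> 0"
proof -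
  let ?N = "bochner_L2_norm M"
  have "\<exists>N. \<forall>m\<ge>N. \<forall>n\<ge>N. ?N (\<lambda>x. F m x - F n x) < (1 / 2) ^ k" for k :: nat
    by (rule cauchy) simp
  then obtain r where r: "\<And>k m n. r k \<le> m \<Longrightarrow> r k \<le> n \<Longrightarrow> ?N (\<lambda>x. F m x - F n x) < (1 / 2) ^ k"
    by metis
  \<comment> \<open>Consecutive indices of the subsequence both lie beyond the threshold \<open>r k\<close>.\<close>
  define q where "q k = Max (r ` {..k})" for k :: nat
  have q: "r k \<le> q k" "r k \<le> q (Suc k)" for k by (auto simp: q_def)
  have "\<exists>s. simple_function M s \<and> ?N (\<lambda>x. F (q k) x - s x) < (1 / 2) ^ k" for k
  proof -
    obtain s where s: "\<And>i::nat. simple_function M (s i)" "(\<lambda>i. ?N (\<lambda>x. F (q k) x - s i x)) \<longlonglongrightarrow> 0"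
      using L2_approx_simple[OF F] by blast
    have "\<forall>\<^sub>F i in sequentially. ?N (\<lambda>x. F (q k) x - s i x) < (1 / 2) ^ k"
      using order_tendstoD(2)[OF s(2)] by simp
    then show ?thesis using s(1) eventually_happens'[OF sequentially_bot] by blast
  qed
  then obtain s where s: "\<And>k. simple_function M (s k)" "\<And>k. ?N (\<lambda>x. F (q k) x - s k x) < (1 / 2) ^ k"
    by metis
  have sL: "s k \<in> bochner_L2 M" for k using s(1) by (rule L2_simple)
  have step: "?N (\<lambda>x. s (Suc k) x - s k x) \<le> 3 * (1 / 2) ^ k" for k
  proof -
    have "?N (\<lambda>x. s (Suc k) x - s k x)
        \<le> ?N (\<lambda>x. s (Suc k) x - F (q (Suc k)) x) + ?N (\<lambda>x. F (q (Suc k)) x - s k x)"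
      by (rule L2_norm_triangle_diff[OF sL F sL])
    also have "?N (\<lambda>x. F (q (Suc k)) x - s k x)
        \<le> ?N (\<lambda>x. F (q (Suc k)) x - F (q k) x) + ?N (\<lambda>x. F (q k) x - s k x)"
      by (rule L2_norm_triangle_diff[OF F F sL])
    finally have "?N (\<lambda>x. s (Suc k) x - s k x) \<le> ?N (\<lambda>x. s (Suc k) x - F (q (Suc k)) x)
        + (?N (\<lambda>x. F (q (Suc k)) x - F (q k) x) + ?N (\<lambda>x. F (q k) x - s k x))" by simp
    moreover have "?N (\<lambda>x. s (Suc k) x - F (q (Suc k)) x) \<le> (1 / 2) ^ k"
      unfolding L2_norm_minus_commute[of "s (Suc k)"]
      by (rule order_trans[OF less_imp_le[OF s(2)]]) simp
    ultimately show ?thesis using s(2)[of k] r[OF q(2) q(1), of k] by simp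
  qed
  have tail: "?N (\<lambda>x. s (k + i) x - s k x) \<le> 6 * (1 / 2) ^ k * (1 - (1 / 2) ^ i)" for k i
  proof (induction i)
    case 0
    then show ?case by (simp add: bochner_L2_norm_def)
  next
    case (Suc i)
    have "?N (\<lambda>x. s (k + Suc i) x - s k x)
        \<le> ?N (\<lambda>x. s (k + Suc i) x - s (k + i) x) + ?N (\<lambda>x. s (k + i) x - s k x)"
      by (rule L2_norm_triangle_diff[OF sL sL sL])
    also have "\<dots> \<le> 3 * (1 / 2) ^ (k + i) + 6 * (1 / 2) ^ k * (1 - (1 / 2) ^ i)"
      using Suc step[of "k + i"] by simp
    also have "\<dots> = 6 * (1 / 2) ^ k * (1 - (1 / 2) ^ Suc i)"
      by (simp add: power_add algebra_simps)
    finally show ?case .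
  qed
  have tail': "?N (\<lambda>x. s n x - s k x) \<le> 6 * (1 / 2) ^ k" if "k \<le> n" for k n
  proof -
    have "6 * (1 / 2) ^ k * (1 - (1 / 2) ^ (n - k)) \<le> 6 * (1 / 2 :: real) ^ k"
      by (simp add: mult_left_le)
    with tail[of k "n - k"] have "?N (\<lambda>x. s (k + (n - k)) x - s k x) \<le> 6 * (1 / 2) ^ k"
      by (rule order_trans)
    then show ?thesis using that by simp
  qed
  define f where "f x = lim (\<lambda>n. s n x)" for x
  have lim: "AE x in M. (\<lambda>n. s n x) \<longlonglongrightarrow> f x"
    using L2_fast_sequence_converges_AE[OF sL step]
    by eventually_elim (simp add: f_def convergent_LIMSEQ_iff)
  have f: "strongly_measurable M f"
    unfolding strongly_measurable_def by (intro exI[of _ s] conjI allI s(1) lim)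
  have fL: "f \<in> bochner_L2 M"
    by (rule L2_Fatou(1)[where s = s and g = "s 0" and k = 0, OF sL f lim sL tail'])
  have dist: "?N (\<lambda>x. f x - s k x) \<le> 6 * (1 / 2) ^ k" for k
    by (rule L2_Fatou(2)[where s = s and g = "s k" and k = k, OF sL f lim sL tail'])
  have "(\<lambda>n. ?N (\<lambda>x. F n x - f x)) \<longlonglongrightarrow> 0"
  proof (rule LIMSEQ_I)
    fix e :: real assume e: "0 < e"
    obtain k where k: "(1 / 2 :: real) ^ k < e / 8"
      using real_arch_pow_inv[of "e / 8" "1 / 2"] e by auto
    show "\<exists>no. \<forall>n\<ge>no. norm (?N (\<lambda>x. F n x - f x) - 0) < e"
    proof (intro exI allI impI)
      fix n assume n: "r k \<le> n"
      have "?N (\<lambda>x. F n x - f x) \<le> ?N (\<lambda>x. F n x - F (q k) x) + ?N (\<lambda>x. F (q k) x - f x)"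
        by (rule L2_norm_triangle_diff[OF F F fL])
      also have "?N (\<lambda>x. F (q k) x - f x) \<le> ?N (\<lambda>x. F (q k) x - s k x) + ?N (\<lambda>x. s k x - f x)"
        by (rule L2_norm_triangle_diff[OF F sL fL])
      finally have "?N (\<lambda>x. F n x - f x) < (1 / 2) ^ k + ((1 / 2) ^ k + 6 * (1 / 2) ^ k)"
        using r[OF n q(1)] s(2)[of k] dist[of k] by (simp add: L2_norm_minus_commute[of "s k"])
      then show "norm (?N (\<lambda>x. F n x - f x) - 0) < e" using k by simp
    qed
  qed
  then show ?thesis using that fL by blast
qed

subsection \<open>Limits and the Riesz representation\<close>

lemma L2_inner_tendsto:
  fixes F G :: "nat \<Rightarrow> 'a \<Rightarrow> 'b::real_inner"
  assumes F: "\<And>n. F n \<in> bochner_L2 M" and f: "f \<in> bochner_L2 M"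
    and G: "\<And>n. G n \<in> bochner_L2 M" and g: "g \<in> bochner_L2 M"
    and Ff: "(\<lambda>n. bochner_L2_norm M (\<lambda>x. F n x - f x)) \<longlonglongrightarrow> 0"
    and Gg: "(\<lambda>n. bochner_L2_norm M (\<lambda>x. G n x - g x)) \<longlonglongrightarrow> 0"
  shows "(\<lambda>n. L2_inner M (F n) (G n)) \<longlonglongrightarrow> L2_inner M f g"
proof -
  let ?N = "bochner_L2_norm M"
  have "(\<lambda>n. L2_inner M (F n) (G n) - L2_inner M f g) \<longlonglongrightarrow> 0"
  proof (rule Lim_null_comparison)
    have "norm (L2_inner M (F n) (G n) - L2_inner M f g)
      \<le> ?N (\<lambda>x. F n x - f x) * ?N (\<lambda>x. G n x - g x)
        + ?N (\<lambda>x. F n x - f x) * ?N g + ?N f * ?N (\<lambda>x. G n x - g x)" for n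
    proof -
      have "L2_inner M (F n) (G n) - L2_inner M f g
          = L2_inner M (\<lambda>x. F n x - f x) (\<lambda>x. G n x - g x)
            + L2_inner M (\<lambda>x. F n x - f x) g + L2_inner M f (\<lambda>x. G n x - g x)"
        using F[of n] G[of n] f g by (simp add: L2_inner_linear)
      then show ?thesis
        using L2_Cauchy_Schwarz[OF L2_diff[OF F[of n] f] L2_diff[OF G[of n] g]]
          L2_Cauchy_Schwarz[OF L2_diff[OF F[of n] f] g]
          L2_Cauchy_Schwarz[OF f L2_diff[OF G[of n] g]] by simp
    qed
    then show "\<forall>\<^sub>F n in sequentially. norm (L2_inner M (F n) (G n) - L2_inner M f g)
      \<le> ?N (\<lambda>x. F n x - f x) * ?N (\<lambda>x. G n x - g x)
        + ?N (\<lambda>x. F n x - f x) * ?N g + ?N f * ?N (\<lambda>x. G n x - g x)" by simp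
    show "(\<lambda>n. ?N (\<lambda>x. F n x - f x) * ?N (\<lambda>x. G n x - g x)
        + ?N (\<lambda>x. F n x - f x) * ?N g + ?N f * ?N (\<lambda>x. G n x - g x)) \<longlonglongrightarrow> 0"
      using Ff Gg by (auto intro!: tendsto_eq_intros)
  qed
  then show ?thesis by (rule LIM_zero_cancel)
qed

lemma L2_tendsto_bounded_linear:
  fixes F :: "nat \<Rightarrow> 'a \<Rightarrow> 'b::real_inner"
  assumes h: "bounded_linear h" and F: "\<And>n. F n \<in> bochner_L2 M" and f: "f \<in> bochner_L2 M"
    and Ff: "(\<lambda>n. bochner_L2_norm M (\<lambda>x. F n x - f x)) \<longlonglongrightarrow> 0"
  shows "(\<lambda>n. bochner_L2_norm M (\<lambda>x. h (F n x) - h (f x))) \<longlonglongrightarrow> 0"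
proof -
  obtain K where K: "\<And>x. norm (h x) \<le> K * norm x"
    using bounded_linear.bounded[OF h] by (metis mult.commute)
  show ?thesis
  proof (rule Lim_null_comparison)
    show "\<forall>\<^sub>F n in sequentially. norm (bochner_L2_norm M (\<lambda>x. h (F n x) - h (f x)))
        \<le> \<bar>K\<bar> * bochner_L2_norm M (\<lambda>x. F n x - f x)"
      using L2_norm_bounded_linear_le[OF h K L2_diff[OF F f]]
      by (simp add: linear_diff[OF bounded_linear.linear[OF h]])
    show "(\<lambda>n. \<bar>K\<bar> * bochner_L2_norm M (\<lambda>x. F n x - f x)) \<longlonglongrightarrow> 0"
      using Ff by (rule tendsto_mult_right_zero)
  qed
qed

theorem L2_Riesz:
  fixes F :: "('a \<Rightarrow> 'b::{real_inner,complete_space}) \<Rightarrow> real"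
  assumes F: "F \<in> bochner_L2_dual M"
  obtains w where "w \<in> bochner_L2 M" "\<And>v. v \<in> bochner_L2 M \<Longrightarrow> F v = L2_inner M w v"
proof -
  let ?Y = "bochner_L2 M :: ('a \<Rightarrow> 'b) set"
  let ?comb = "\<lambda>(c::real) (p :: 'a \<Rightarrow> 'b) q x. p x + c *\<^sub>R q x"
  obtain C where C: "\<And>v. v \<in> ?Y \<Longrightarrow> \<bar>F v\<bar> \<le> C * bochner_L2_norm M v"
    using F unfolding bochner_L2_dual_def by blast
  have add: "F (?comb c p q) = F p + c * F q" if "p \<in> ?Y" "q \<in> ?Y" for c p q
    using F that L2_scaleR[OF that(2), of c] by (simp add: bochner_L2_dual_def)
  have bound: "(F p)\<^sup>2 \<le> C\<^sup>2 * L2_inner M p p" if "p \<in> ?Y" for p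
    using power_mono[OF C[OF that] abs_ge_zero, of 2]
    by (simp add: power_mult_distrib L2_norm_power2)
  obtain p where p: "\<And>n::nat. p n \<in> ?Y"
    and cauchy: "\<And>e. 0 < e \<Longrightarrow> \<exists>N. \<forall>m\<ge>N. \<forall>n\<ge>N.
      L2_inner M (?comb (-1) (p m) (p n)) (?comb (-1) (p m) (p n)) < e"
    and lim: "\<And>q. q \<in> ?Y \<Longrightarrow> (\<lambda>n. L2_inner M (p n) q) \<longlonglongrightarrow> F q"
  proof (rule minimizing_sequence_represents_functional
      [where S = ?Y and ip = "L2_inner M" and L = F and comb = ?comb and C = "C\<^sup>2"])
    show "?Y \<noteq> {}" by auto
  qed (use add bound L2_inner_commute L2_inner_self_nonneg in \<open>auto simp: L2_inner_linear\<close>)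
  have "\<exists>N. \<forall>m\<ge>N. \<forall>n\<ge>N. bochner_L2_norm M (\<lambda>x. p m x - p n x) < e" if "0 < e" for e
    using cauchy[of "e\<^sup>2"] that power2_less_imp_less[of "bochner_L2_norm M _" e]
    by (simp flip: L2_norm_power2) blast
  then obtain w where w: "w \<in> ?Y" "(\<lambda>n. bochner_L2_norm M (\<lambda>x. p n x - w x)) \<longlonglongrightarrow> 0"
    by (rule L2_complete[OF p])
  have "F v = L2_inner M w v" if v: "v \<in> ?Y" for v
  proof (rule LIMSEQ_unique[OF lim[OF v]])
    show "(\<lambda>n. L2_inner M (p n) v) \<longlonglongrightarrow> L2_inner M w v"
      by (rule L2_inner_tendsto[OF p w(1) v v w(2)]) (simp add: bochner_L2_norm_def)
  qed
  then show ?thesis using that w(1) by blast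
qed

end

theorem blinfun_Riesz:
  fixes f :: "'v::{real_inner,complete_space} \<Rightarrow>\<^sub>L real"
  shows "\<exists>z. \<forall>x. blinfun_apply f x = z \<bullet> x"
proof -
  let ?comb = "\<lambda>(c::real) (p :: 'v) q. p + c *\<^sub>R q"
  obtain p :: "nat \<Rightarrow> 'v"
    where cauchy: "\<And>e. 0 < e \<Longrightarrow> \<exists>N. \<forall>m\<ge>N. \<forall>n\<ge>N.
      ?comb (-1) (p m) (p n) \<bullet> ?comb (-1) (p m) (p n) < e"
    and lim: "\<And>q. (\<lambda>n. p n \<bullet> q) \<longlonglongrightarrow> blinfun_apply f q"
  proof (rule minimizing_sequence_represents_functional
      [where S = UNIV and ip = inner and L = "blinfun_apply f" and comb = ?comb and C = "(norm f)\<^sup>2"])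
    show "(blinfun_apply f p)\<^sup>2 \<le> (norm f)\<^sup>2 * (p \<bullet> p)" for p
      using power_mono[OF norm_blinfun[of f p] norm_ge_zero, of 2]
      by (simp add: power_mult_distrib dot_square_norm)
  qed (auto simp: inner_add_left inner_add_right inner_commute blinfun.bilinear_simps)
  have "Cauchy p"
  proof (rule CauchyI)
    fix e :: real assume "0 < e"
    then show "\<exists>M. \<forall>m\<ge>M. \<forall>n\<ge>M. norm (p m - p n) < e"
      using cauchy[of "e\<^sup>2"] power2_less_imp_less[of "norm _" e] by (simp add: dot_square_norm) blast
  qed
  then obtain z where z: "p \<longlonglongrightarrow> z" using Cauchy_convergent convergent_def by blast
  have "blinfun_apply f x = z \<bullet> x" for x
    by (rule LIMSEQ_unique[OF lim]) (intro tendsto_intros z)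
  then show ?thesis by (intro exI[of _ z] allI)
qed

section \<open>Strong integrals of square integrable functions\<close>

text \<open>
  This evaluates the strong integrals in the definition of the weak derivative by integrals of
  real functions: the images of the simple approximants approximate the image.
\<close>

lemma has_strong_integral_functional:
  fixes h :: "'b::real_normed_vector \<Rightarrow> real"
  assumes f: "has_strong_integral M f I" and h: "bounded_linear h" and M: "complete_finite_measure M"
  shows "has_bochner_integral M (\<lambda>x. h (f x)) (h I)"
proof -
  interpret complete_finite_measure M by (rule M)
  obtain s where fm: "strongly_measurable M f"
    and s: "\<And>i. Bochner_Integration.simple_bochner_integrable M (s i)"
    and lim: "(\<lambda>i. \<integral>\<^sup>+x. ennreal (norm (f x - s i x)) \<partial>M) \<longlonglongrightarrow> 0"
    and I: "(\<lambda>i. Bochner_Integration.simple_bochner_integral M (s i)) \<longlonglongrightarrow> I"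
    using f by (auto simp: has_strong_integral_def)
  obtain K where K: "0 \<le> K" "\<And>x. norm (h x) \<le> norm x * K"
    using bounded_linear.nonneg_bounded[OF h] by blast
  have lin: "linear h" using h by (rule bounded_linear.linear)
  have hf: "(\<lambda>x. h (f x)) \<in> borel_measurable M"
    by (rule borel_measurable_strongly[OF strongly_measurable_bounded_linear[OF h fm]])
  show ?thesis
  proof (rule has_bochner_integral.intros[OF hf])
    show hs: "Bochner_Integration.simple_bochner_integrable M (\<lambda>x. h (s i x))" for i
      using Bochner_Integration.simple_bochner_integrable_compose2[of "\<lambda>a b. h a", OF _ s[of i] s[of i]]
        linear_0[OF lin] by simp
    have "simple_function M (s i)" for i using s[of i] by (simp add: Bochner_Integration.simple_bochner_integrable.simps)
    then have [measurable]: "(\<lambda>x. norm (f x - s i x)) \<in> borel_measurable M" for i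
      using L2_simple[THEN L2_uminus, THEN L2_strongly_measurable, THEN strongly_measurable_add[OF fm],
          THEN borel_measurable_norm_strongly, of "s i"] by simp
    show "(\<lambda>i. \<integral>\<^sup>+x. ennreal (norm (h (f x) - h (s i x))) \<partial>M) \<longlonglongrightarrow> 0"
    proof (rule tendsto_sandwich[OF _ _ tendsto_const])
      have "(\<integral>\<^sup>+x. ennreal (norm (h (f x) - h (s i x))) \<partial>M)
          \<le> (\<integral>\<^sup>+x. ennreal K * ennreal (norm (f x - s i x)) \<partial>M)" for i
      proof (rule nn_integral_mono)
        show "ennreal (norm (h (f x) - h (s i x))) \<le> ennreal K * ennreal (norm (f x - s i x))" for x
          using K(2)[of "f x - s i x"] K(1)
          by (simp add: linear_diff[OF lin] ennreal_mult[symmetric] mult.commute ennreal_leI)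
      qed
      then show "\<forall>\<^sub>F i in sequentially. (\<integral>\<^sup>+x. ennreal (norm (h (f x) - h (s i x))) \<partial>M)
          \<le> ennreal K * (\<integral>\<^sup>+x. ennreal (norm (f x - s i x)) \<partial>M)"
        by (simp add: nn_integral_cmult)
      show "(\<lambda>i. ennreal K * (\<integral>\<^sup>+x. ennreal (norm (f x - s i x)) \<partial>M)) \<longlonglongrightarrow> 0"
        using ennreal_tendsto_cmult[OF _ lim, of "ennreal K"] by simp
    qed simp
    show "(\<lambda>i. Bochner_Integration.simple_bochner_integral M (\<lambda>x. h (s i x))) \<longlonglongrightarrow> h I"
      using bounded_linear.tendsto[OF h I] s
      by (simp add: Bochner_Integration.simple_bochner_integral_linear[OF lin])
  qed
qed

context complete_finite_measure
begin

text \<open>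
  The integrals of simple approximants form a Cauchy sequence because the norm in \<open>L\<^sup>1\<close> is
  bounded by the norm in \<open>L\<^sup>2\<close> on a finite measure space.
\<close>

lemma L2_has_strong_integral:
  fixes f :: "'a \<Rightarrow> 'b::{real_normed_vector,complete_space}"
  assumes f: "f \<in> bochner_L2 M"
  obtains I where "has_strong_integral M f I"
proof -
  obtain s where s: "\<And>i::nat. simple_function M (s i)"
    and lim: "(\<lambda>i. bochner_L2_norm M (\<lambda>x. f x - s i x)) \<longlonglongrightarrow> 0"
    using L2_approx_simple[OF f] by blast
  have sL: "s i \<in> bochner_L2 M" for i by (rule L2_simple[OF s])
  have fs: "(\<lambda>x. f x - s i x) \<in> bochner_L2 M" for i using f sL by (rule L2_diff)
  have sb: "Bochner_Integration.simple_bochner_integrable M (s i)" for i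
    by (rule Bochner_Integration.simple_bochner_integrable.intros[OF s]) simp
  define e where "e i = (LINT x|M. norm (f x - s i x))" for i
  have e: "e \<longlonglongrightarrow> 0"
  proof (rule Lim_null_comparison)
    show "\<forall>\<^sub>F i in sequentially. norm (e i)
        \<le> sqrt (measure M (space M)) * bochner_L2_norm M (\<lambda>x. f x - s i x)"
      using L1_le_L2[OF fs] by (simp add: e_def)
    show "(\<lambda>i. sqrt (measure M (space M)) * bochner_L2_norm M (\<lambda>x. f x - s i x)) \<longlonglongrightarrow> 0"
      using lim by (rule tendsto_mult_right_zero)
  qed
  let ?I = "\<lambda>i. Bochner_Integration.simple_bochner_integral M (s i)"
  have dist: "norm (?I m - ?I n) \<le> e m + e n" for m n
  proof -
    have sb': "Bochner_Integration.simple_bochner_integrable M (\<lambda>x. s m x - s n x)"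
      by (rule Bochner_Integration.simple_bochner_integrable_compose2[OF _ sb sb]) simp
    then have sbn: "Bochner_Integration.simple_bochner_integrable M (\<lambda>x. norm (s m x - s n x))"
      using Bochner_Integration.simple_bochner_integrable_compose2[of "\<lambda>a b. norm a", OF _ sb' sb'] by simp
    have "norm (?I m - ?I n) \<le> Bochner_Integration.simple_bochner_integral M (\<lambda>x. norm (s m x - s n x))"
      using Bochner_Integration.simple_bochner_integral_norm_bound[OF sb']
      by (simp add: Bochner_Integration.simple_bochner_integral_diff[OF sb sb])
    also have "\<dots> = (LINT x|M. norm (s m x - s n x))"
      by (rule Bochner_Integration.simple_bochner_integrable_eq_integral[OF sbn])
    also have "\<dots> \<le> (LINT x|M. norm (f x - s m x) + norm (f x - s n x))"
    proof (rule integral_mono)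
      show "norm (s m x - s n x) \<le> norm (f x - s m x) + norm (f x - s n x)" for x
        using norm_triangle_ineq4[of "f x - s n x" "f x - s m x"] by (simp add: add.commute)
    qed (use L2_integrable_norm[OF L2_diff[OF sL sL]] L2_integrable_norm[OF fs] in auto)
    also have "\<dots> = e m + e n"
      using L2_integrable_norm[OF fs] by (simp add: e_def)
    finally show ?thesis .
  qed
  have "Cauchy ?I"
  proof (rule CauchyI)
    fix d :: real assume "0 < d"
    then have "\<forall>\<^sub>F i in sequentially. e i < d / 2" using order_tendstoD(2)[OF e, of "d / 2"] by simp
    then obtain N where "\<And>i. N \<le> i \<Longrightarrow> e i < d / 2" by (auto simp: eventually_sequentially)
    then show "\<exists>N. \<forall>m\<ge>N. \<forall>n\<ge>N. norm (?I m - ?I n) < d"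
      using dist by (intro exI[of _ N] allI impI) (smt (verit) field_sum_of_halves)
  qed
  then obtain I where I: "?I \<longlonglongrightarrow> I" using Cauchy_convergent convergent_def by blast
  have "(\<integral>\<^sup>+x. ennreal (norm (f x - s i x)) \<partial>M) = ennreal (e i)" for i
    using nn_integral_eq_integral[OF L2_integrable_norm[OF fs]] by (simp add: e_def)
  moreover have "(\<lambda>i. ennreal (e i)) \<longlonglongrightarrow> ennreal 0" by (rule tendsto_ennrealI[OF e])
  ultimately have "(\<lambda>i. \<integral>\<^sup>+x. ennreal (norm (f x - s i x)) \<partial>M) \<longlonglongrightarrow> 0" by simp
  then have "has_strong_integral M f I"
    unfolding has_strong_integral_def using sb I L2_strongly_measurable[OF f]
    by (intro conjI exI[of _ s] allI)
  then show ?thesis by (rule that)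
qed

text \<open>
  An element of \<open>V'\<close> is determined by its values, so the strong integral can be identified by
  integrals of real functions.
\<close>

lemma has_strong_integral_blinfunI:
  fixes f :: "'a \<Rightarrow> 'b::real_normed_vector \<Rightarrow>\<^sub>L real"
  assumes f: "f \<in> bochner_L2 M" and I: "\<And>x. (LINT t|M. blinfun_apply (f t) x) = blinfun_apply I x"
  shows "has_strong_integral M f I"
proof -
  obtain J where J: "has_strong_integral M f J" using L2_has_strong_integral[OF f] by blast
  have "blinfun_apply J x = blinfun_apply I x" for x
    using has_strong_integral_functional[OF J blinfun.bounded_linear_left[of x]
        complete_finite_measure_axioms] I[of x]
    by (simp add: has_bochner_integral_integral_eq)
  then have "J = I" by (rule blinfun_eqI)
  then show ?thesis using J by simp
qed

end

section \<open>The Riesz map and the adjoint of the embedding\<close>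

definition riesz :: "('v::{real_inner,complete_space} \<Rightarrow>\<^sub>L real) \<Rightarrow> 'v" where
  "riesz f = (SOME z. \<forall>x. blinfun_apply f x = z \<bullet> x)"

lemma riesz_inner: "riesz f \<bullet> x = blinfun_apply f x"
proof -
  have "\<forall>x. blinfun_apply f x = riesz f \<bullet> x"
    unfolding riesz_def by (rule someI_ex[OF blinfun_Riesz])
  from spec[OF this, of x] show ?thesis by (rule sym)
qed

lemma eq_if_inner_eq:
  fixes a b :: "'v::real_inner"
  assumes "\<And>x. a \<bullet> x = b \<bullet> x"
  shows "a = b"
proof -
  have "(a - b) \<bullet> (a - b) = 0" unfolding inner_diff_left assms by simp
  then show ?thesis by simp
qed

lemma bounded_linear_riesz: "bounded_linear (riesz :: ('v::{real_inner,complete_space} \<Rightarrow>\<^sub>L real) \<Rightarrow> 'v)"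
proof (rule bounded_linear_intro[where K = 1])
  fix f g :: "'v \<Rightarrow>\<^sub>L real" and c :: real
  show "riesz (f + g) = riesz f + riesz g"
    by (rule eq_if_inner_eq) (simp add: riesz_inner inner_add_left blinfun.add_left)
  show "riesz (c *\<^sub>R f) = c *\<^sub>R riesz f"
    by (rule eq_if_inner_eq) (simp add: riesz_inner blinfun.scaleR_left)
  have "norm (riesz f) * norm (riesz f) \<le> norm f * norm (riesz f)"
    using norm_blinfun[of f "riesz f"] by (simp add: riesz_inner[symmetric] dot_square_norm power2_eq_square)
  then show "norm (riesz f) \<le> norm f * 1"
    by (cases "riesz f = 0") auto
qed

text \<open>
  The Hilbert space adjoint of the embedding of \<open>V\<close> into \<open>H\<close>. After the Riesz identification of
  \<open>V'\<close> with \<open>V\<close>, it is the embedding of \<open>H\<close> into \<open>V'\<close>.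
\<close>

definition adj_embed :: "('v::{real_inner,complete_space} \<Rightarrow>\<^sub>L 'h::real_inner) \<Rightarrow> 'h \<Rightarrow> 'v" where
  "adj_embed j h = riesz (pivot_embed j h)"

lemma pivot_embed_apply: "blinfun_apply (pivot_embed j h) x = h \<bullet> blinfun_apply j x"
  by (simp add: pivot_embed_def inner_commute)

lemma adj_embed_inner: "adj_embed j h \<bullet> x = h \<bullet> blinfun_apply j x"
  by (simp add: adj_embed_def riesz_inner pivot_embed_apply)

lemma inner_adj_embed: "x \<bullet> adj_embed j h = h \<bullet> blinfun_apply j x"
  by (subst inner_commute) (rule adj_embed_inner)

lemma bounded_linear_pivot_embed: "bounded_linear (pivot_embed j)"
proof (rule bounded_linear_intro[where K = "norm j"])
  show "pivot_embed j (x + y) = pivot_embed j x + pivot_embed j y" for x y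
    by (rule blinfun_eqI) (simp add: pivot_embed_apply blinfun.add_left inner_add_left)
  show "pivot_embed j (c *\<^sub>R x) = c *\<^sub>R pivot_embed j x" for c x
    by (rule blinfun_eqI) (simp add: pivot_embed_apply blinfun.scaleR_left)
  show "norm (pivot_embed j x) \<le> norm x * norm j" for x
  proof (rule norm_blinfun_bound)
    fix y
    have "norm (blinfun_apply (pivot_embed j x) y) \<le> norm x * norm (blinfun_apply j y)"
      using Cauchy_Schwarz_ineq2[of x "blinfun_apply j y"] by (simp add: pivot_embed_apply)
    also have "\<dots> \<le> norm x * (norm j * norm y)"
      by (intro mult_left_mono norm_blinfun) simp
    finally show "norm (blinfun_apply (pivot_embed j x) y) \<le> norm x * norm j * norm y" by simp
  qed simp
qed

lemma bounded_linear_adj_embed: "bounded_linear (adj_embed j)"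
  unfolding adj_embed_def
  using bounded_linear_compose[OF bounded_linear_riesz bounded_linear_pivot_embed] .

text \<open>
  A vector in the kernel of the adjoint is orthogonal to the dense range of the embedding.
\<close>

lemma adj_embed_eq_0:
  assumes dense: "closure (range (blinfun_apply j)) = UNIV" and 0: "adj_embed j h = 0"
  shows "h = 0"
proof -
  have "h \<in> closure (range (blinfun_apply j))" using dense by simp
  then obtain x where x: "\<And>n. x n \<in> range (blinfun_apply j)" "x \<longlonglongrightarrow> h"
    by (auto simp: closure_sequential)
  have "h \<bullet> x n = 0" for n
    using x(1)[of n] 0 adj_embed_inner[of j h] by auto
  moreover have "(\<lambda>n. h \<bullet> x n) \<longlonglongrightarrow> h \<bullet> h" by (intro tendsto_intros x)
  ultimately have "h \<bullet> h = 0" by (simp add: LIMSEQ_const_iff)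
  then show ?thesis by simp
qed

section \<open>Primitives on the time interval\<close>

lemma complete_finite_measure_time: "complete_finite_measure (time_measure T)"
proof (intro complete_finite_measure.intro complete_measure.intro finite_measureI)
  fix A B :: "real set"
  assume BA: "B \<subseteq> A" and null: "A \<in> null_sets (time_measure T)"
  have A: "A \<subseteq> {0<..<T}" "A \<in> null_sets lebesgue"
    using null by (auto simp: null_sets_restrict_space)
  then have "B \<in> sets lebesgue" using completion.complete[OF BA] by blast
  then show "B \<in> sets (time_measure T)" using A(1) BA by (auto simp: sets_restrict_space_iff)
next
  show "emeasure (time_measure T) (space (time_measure T)) \<noteq> \<infinity>"
    by (cases "0 < T") (simp_all add: emeasure_restrict_space)
qed

text \<open>
  The segments are half-open so that consecutive ones are disjoint.
\<close>

definition seg :: "real \<Rightarrow> real \<Rightarrow> real \<Rightarrow> (real \<Rightarrow> real) \<Rightarrow> real" where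
  "seg T s t f = (LINT r|time_measure T. indicat_real {s<..t} r * f r)"

text \<open>
  \<open>p t = p 0 + \<integral>\<^sub>0\<^sup>t a\<close>, tested with vectors. The weak form avoids integrals with values in a
  space that need not be separable.
\<close>

definition primitive_on :: "real \<Rightarrow> (real \<Rightarrow> 'v::real_inner) \<Rightarrow> (real \<Rightarrow> 'v) \<Rightarrow> bool" where
  "primitive_on T a p \<longleftrightarrow> a \<in> bochner_L2 (time_measure T) \<and>
     (\<forall>t\<in>{0..T}. \<forall>x. (p t - p 0) \<bullet> x = seg T 0 t (\<lambda>r. a r \<bullet> x))"

locale time_interval =
  fixes T :: real
  assumes T_pos: "0 < T"
begin

abbreviation M :: "real measure" where "M \<equiv> time_measure T"

sublocale complete_finite_measure M
  by (rule complete_finite_measure_time)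

lemma space_M [simp]: "space M = {0<..<T}"
  by simp

lemma borel_measurable_M: "f \<in> borel_measurable borel \<Longrightarrow> f \<in> borel_measurable M"
  by (intro measurable_restrict_space1 measurable_completion) simp

lemma measure_segment:
  assumes "0 \<le> s" "s \<le> t" "t \<le> T"
  shows "(LINT r|M. indicat_real {s<..t} r) = t - s"
proof -
  have "(LINT r|M. indicat_real {s<..t} r) = (LINT r|lebesgue. indicat_real {0<..<T} r *\<^sub>R indicat_real {s<..t} r)"
    by (subst integral_restrict_space) auto
  also have "\<dots> = (LINT r|lebesgue. indicat_real ({0<..<T} \<inter> {s<..t}) r)"
    by (simp add: indicator_inter_arith)
  also have "\<dots> = measure lebesgue ({0<..<T} \<inter> {s<..t})" by simp
  also have "\<dots> = measure lebesgue {s<..t}"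
  proof (rule measure_eq_AE)
    have "AE x in lebesgue. x \<notin> {T}" by (rule AE_not_in) simp
    then show "AE x in lebesgue. x \<in> {0<..<T} \<inter> {s<..t} \<longleftrightarrow> x \<in> {s<..t}"
      by eventually_elim (use assms in auto)
  qed auto
  finally show ?thesis using assms by simp
qed

lemma integrable_segment:
  assumes "integrable M f"
  shows "integrable M (\<lambda>r. indicat_real {s<..t} r * f r)"
proof (rule Bochner_Integration.integrable_bound[OF assms])
  have "indicat_real {s<..t} \<in> borel_measurable M" by (rule borel_measurable_M) simp
  then show "(\<lambda>r. indicat_real {s<..t} r * f r) \<in> borel_measurable M"
    using assms by auto
qed (auto simp: indicator_def)

lemma seg_split:
  assumes "integrable M f" "s \<le> t" "t \<le> u"
  shows "seg T s u f = seg T s t f + seg T t u f"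
proof -
  have "indicat_real {s<..u} r * f r = indicat_real {s<..t} r * f r + indicat_real {t<..u} r * f r" for r
    using assms(2,3) by (auto simp: indicator_def)
  then show ?thesis
    unfolding seg_def using integrable_segment[OF assms(1)] by simp
qed

lemma seg_full: "seg T 0 T f = integral\<^sup>L M f"
  unfolding seg_def by (rule Bochner_Integration.integral_cong) (auto simp: indicator_def)

lemma seg_add:
  "integrable M f \<Longrightarrow> integrable M g \<Longrightarrow> seg T s t (\<lambda>r. f r + g r) = seg T s t f + seg T s t g"
  unfolding seg_def using integrable_segment by (simp add: distrib_left)

lemma seg_diff:
  "integrable M f \<Longrightarrow> integrable M g \<Longrightarrow> seg T s t (\<lambda>r. f r - g r) = seg T s t f - seg T s t g"
  unfolding seg_def using integrable_segment by (simp add: right_diff_distrib)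

lemma seg_cmult: "seg T s t (\<lambda>r. c * f r) = c * seg T s t f"
  unfolding seg_def by (simp add: mult.left_commute[of _ c])

lemma seg_abs_le:
  assumes f: "integrable M f" and g: "integrable M g"
    and le: "\<And>r. r \<in> {0<..<T} \<Longrightarrow> s < r \<Longrightarrow> r \<le> t \<Longrightarrow> \<bar>f r\<bar> \<le> g r"
  shows "\<bar>seg T s t f\<bar> \<le> seg T s t g"
proof -
  have "\<bar>seg T s t f\<bar> \<le> (LINT r|M. \<bar>indicat_real {s<..t} r * f r\<bar>)"
    unfolding seg_def by (rule integral_abs_bound)
  also have "\<dots> \<le> seg T s t g"
    unfolding seg_def
    using integrable_segment[OF f] integrable_segment[OF g] le
    by (intro integral_mono) (auto simp: indicator_def)
  finally show ?thesis .
qed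

lemma seg_le_full:
  assumes g: "integrable M g" and le: "\<And>r. 0 \<le> g r"
  shows "seg T s t g \<le> integral\<^sup>L M g"
  unfolding seg_def using integrable_segment[OF g] g le
  by (intro integral_mono) (auto simp: indicator_def)

lemma seg_norm_le:
  assumes a: "a \<in> bochner_L2 M" and st: "0 \<le> s" "s \<le> t" "t \<le> T"
  shows "seg T s t (\<lambda>r. norm (a r)) \<le> sqrt (t - s) * bochner_L2_norm M a"
proof -
  have na: "(\<lambda>r. norm (a r)) \<in> bochner_L2 M"
    using a by (simp add: bochner_L2_def strongly_measurable_norm)
  have ind: "indicat_real {s<..t} \<in> bochner_L2 M"
    by (rule L2_bounded[where C = 1])
      (auto simp: indicator_def intro!: strongly_measurable_borel borel_measurable_M)
  have "\<bar>L2_inner M (indicat_real {s<..t}) (\<lambda>r. norm (a r))\<bar>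
      \<le> bochner_L2_norm M (indicat_real {s<..t}) * bochner_L2_norm M (\<lambda>r. norm (a r))"
    by (rule L2_Cauchy_Schwarz[OF ind na])
  moreover have "bochner_L2_norm M (indicat_real {s<..t}) = sqrt (t - s)"
  proof -
    have "(indicat_real {s<..t} r)\<^sup>2 = indicat_real {s<..t} r" for r by (auto simp: indicator_def)
    then show ?thesis using measure_segment[OF st] by (simp add: bochner_L2_norm_def)
  qed
  moreover have "bochner_L2_norm M (\<lambda>r. norm (a r)) = bochner_L2_norm M a"
    by (simp add: bochner_L2_norm_def)
  ultimately show ?thesis by (simp add: L2_inner_def seg_def)
qed

lemma L2_integrable_inner_const: "a \<in> bochner_L2 M \<Longrightarrow> integrable M (\<lambda>r. a r \<bullet> x)"
  by (rule L2_integrable_inner[OF _ L2_const])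

lemma primitive_L2: "primitive_on T a p \<Longrightarrow> a \<in> bochner_L2 M"
  by (simp add: primitive_on_def)

lemma primitive_increment:
  assumes p: "primitive_on T a p" and st: "0 \<le> s" "s \<le> t" "t \<le> T"
  shows "(p t - p s) \<bullet> x = seg T s t (\<lambda>r. a r \<bullet> x)"
proof -
  have "(p t - p 0) \<bullet> x = seg T 0 t (\<lambda>r. a r \<bullet> x)" "(p s - p 0) \<bullet> x = seg T 0 s (\<lambda>r. a r \<bullet> x)"
    using p st by (auto simp: primitive_on_def)
  moreover have "seg T 0 t (\<lambda>r. a r \<bullet> x) = seg T 0 s (\<lambda>r. a r \<bullet> x) + seg T s t (\<lambda>r. a r \<bullet> x)"
    using st by (intro seg_split L2_integrable_inner_const primitive_L2[OF p])
  ultimately show ?thesis by (simp add: inner_diff_left)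
qed

text \<open>
  Testing the increment with itself gives Hoelder continuity with exponent one half.
\<close>

lemma primitive_norm_increment:
  assumes p: "primitive_on T a p" and st: "0 \<le> s" "s \<le> t" "t \<le> T"
  shows "norm (p t - p s) \<le> sqrt (t - s) * bochner_L2_norm M a"
proof -
  let ?d = "p t - p s"
  note a = primitive_L2[OF p]
  have "(norm ?d)\<^sup>2 = seg T s t (\<lambda>r. a r \<bullet> ?d)"
    using primitive_increment[OF p st, of ?d] by (simp add: dot_square_norm)
  also have "\<dots> \<le> seg T s t (\<lambda>r. norm ?d * norm (a r))"
    using seg_abs_le[OF L2_integrable_inner_const[OF a], of "\<lambda>r. norm ?d * norm (a r)" s t ?d]
      L2_integrable_norm[OF a] Cauchy_Schwarz_ineq2[of "a _" ?d] by (simp add: mult.commute)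
  also have "\<dots> \<le> norm ?d * (sqrt (t - s) * bochner_L2_norm M a)"
    unfolding seg_cmult by (intro mult_left_mono seg_norm_le a st) simp
  finally show ?thesis
    by (cases "?d = 0") (use st in \<open>auto simp: power2_eq_square\<close>)
qed

lemma primitive_continuous:
  assumes p: "primitive_on T a p"
  shows "continuous_on {0..T} p"
proof -
  let ?K = "bochner_L2_norm M a + 1"
  have K: "0 < ?K" by (simp add: add_nonneg_pos)
  have le: "norm (p t - p s) \<le> sqrt \<bar>t - s\<bar> * ?K" if "s \<in> {0..T}" "t \<in> {0..T}" for s t
  proof -
    have "norm (p t - p s) \<le> sqrt \<bar>t - s\<bar> * bochner_L2_norm M a"
    proof (cases "s \<le> t")
      case True
      then show ?thesis using primitive_norm_increment[OF p, of s t] that by simp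
    next
      case False
      then show ?thesis
        using primitive_norm_increment[OF p, of t s] that by (simp add: norm_minus_commute)
    qed
    also have "\<dots> \<le> sqrt \<bar>t - s\<bar> * ?K" by (intro mult_left_mono) auto
    finally show ?thesis .
  qed
  show ?thesis
  proof (rule continuous_onI)
    fix s e :: real assume s: "s \<in> {0..T}" and e: "0 < e"
    show "\<exists>d>0. \<forall>t\<in>{0..T}. dist t s < d \<longrightarrow> dist (p t) (p s) \<le> e"
    proof (intro exI[of _ "(e / ?K)\<^sup>2"] conjI ballI impI)
      show "0 < (e / ?K)\<^sup>2" using e K by simp
      fix t assume t: "t \<in> {0..T}" "dist t s < (e / ?K)\<^sup>2"
      then have "sqrt \<bar>t - s\<bar> \<le> sqrt ((e / ?K)\<^sup>2)" by (intro real_sqrt_le_mono) (simp add: dist_real_def)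
      also have "\<dots> = e / ?K" using K e by simp
      finally have "sqrt \<bar>t - s\<bar> * ?K \<le> e" using K by (simp only: pos_le_divide_eq)
      then show "dist (p t) (p s) \<le> e" using le[OF s t(1)] by (simp add: dist_norm)
    qed
  qed
qed

text \<open>
  Rounding the time down to a grid yields simple functions that converge everywhere.
\<close>

lemma continuous_strongly_measurable:
  fixes p :: "real \<Rightarrow> 'b::real_normed_vector"
  assumes p: "continuous_on {0..T} p"
  shows "strongly_measurable M p"
proof -
  define g where "g n t = real_of_int \<lfloor>t * real (Suc n)\<rfloor> / real (Suc n)" for n t
  have le: "g n t \<le> t" for n t
    using of_int_floor_le[of "t * real (Suc n)"] by (simp add: g_def field_simps)
  have ge: "t - 1 / real (Suc n) \<le> g n t" for n t
  proof -
    have "(t * real (Suc n) - 1) / real (Suc n) \<le> g n t"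
      unfolding g_def using real_of_int_floor_gt_diff_one[of "t * real (Suc n)"]
      by (intro divide_right_mono) auto
    then show ?thesis by (simp only: diff_divide_distrib) simp
  qed
  have pos: "0 \<le> g n t" if "0 \<le> t" for n t using that by (simp add: g_def)
  have simple: "simple_function M (g n)" for n
    unfolding simple_function_def
  proof
    have "g n ` space M \<subseteq> (\<lambda>k. real_of_int k / real (Suc n)) ` {0..\<lfloor>T * real (Suc n)\<rfloor>}"
      by (auto simp: g_def intro!: imageI floor_mono mult_right_mono)
    then show "finite (g n ` space M)" by (rule finite_subset) simp
    have "g n \<in> borel_measurable borel" unfolding g_def by measurable
    then have gM: "g n \<in> borel_measurable M" by (rule borel_measurable_M)
    show "\<forall>x\<in>g n ` space M. g n -` {x} \<inter> space M \<in> sets M"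
      by (intro ballI measurable_sets[OF gM]) simp
  qed
  have "(\<lambda>n. p (g n t)) \<longlonglongrightarrow> p t" if t: "t \<in> space M" for t
  proof (rule continuous_on_tendsto_compose[OF p])
    have "norm (g n t - t) \<le> inverse (real (Suc n))" for n
      using le[of n t] ge[of t n] unfolding inverse_eq_divide real_norm_def by linarith
    then have "\<forall>n. norm (g n t - t) \<le> inverse (real (Suc n))" by blast
    from Lim_null_comparison[OF always_eventually[OF this] LIMSEQ_inverse_real_of_nat]
    show "(\<lambda>n. g n t) \<longlonglongrightarrow> t" by (rule LIM_zero_cancel)
    show "t \<in> {0..T}" using t by simp
    show "\<forall>\<^sub>F n in sequentially. g n t \<in> {0..T}"
      using t order_trans[OF le, of t T] pos by (auto intro!: always_eventually)
  qed
  then have "AE t in M. (\<lambda>n. p (g n t)) \<longlonglongrightarrow> p t" by (rule AE_I2)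
  then show ?thesis
    unfolding strongly_measurable_def
    by (intro exI[of _ "\<lambda>n t. p (g n t)"] conjI allI simple_function_compose1[OF simple])
qed

lemma continuous_L2:
  fixes p :: "real \<Rightarrow> 'b::real_normed_vector"
  assumes p: "continuous_on {0..T} p"
  shows "p \<in> bochner_L2 M"
proof -
  have "compact (p ` {0..T})" by (rule compact_continuous_image[OF p]) simp
  then obtain C where "\<And>y. y \<in> p ` {0..T} \<Longrightarrow> norm y \<le> C"
    using compact_imp_bounded bounded_iff by metis
  then show ?thesis
    by (intro L2_bounded[OF continuous_strongly_measurable[OF p], where C = C]) auto
qed

lemma primitive_in_L2: "primitive_on T a p \<Longrightarrow> p \<in> bochner_L2 M"
  by (rule continuous_L2[OF primitive_continuous])

lemma primitive_comb:
  assumes p: "primitive_on T a p" and q: "primitive_on T b q"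
  shows "primitive_on T (\<lambda>t. a t + c *\<^sub>R b t) (\<lambda>t. p t + c *\<^sub>R q t)"
  unfolding primitive_on_def
proof (intro conjI ballI allI)
  note a = primitive_L2[OF p] and b = primitive_L2[OF q]
  show "(\<lambda>t. a t + c *\<^sub>R b t) \<in> bochner_L2 M" using a b by (intro L2_add L2_scaleR)
  fix t x assume t: "t \<in> {0..T}"
  have "seg T 0 t (\<lambda>r. (a r + c *\<^sub>R b r) \<bullet> x) = seg T 0 t (\<lambda>r. a r \<bullet> x) + c * seg T 0 t (\<lambda>r. b r \<bullet> x)"
    using L2_integrable_inner_const[OF a, of x] L2_integrable_inner_const[OF b, of x]
    by (simp add: inner_add_left seg_add seg_cmult)
  also have "\<dots> = (p t - p 0) \<bullet> x + c * ((q t - q 0) \<bullet> x)"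
    using p q t by (simp add: primitive_on_def)
  finally show "(p t + c *\<^sub>R q t - (p 0 + c *\<^sub>R q 0)) \<bullet> x = seg T 0 t (\<lambda>r. (a r + c *\<^sub>R b r) \<bullet> x)"
    by (simp add: algebra_simps)
qed

lemma primitive_shift: "primitive_on T a p \<Longrightarrow> primitive_on T a (\<lambda>t. p t + c)"
  by (simp add: primitive_on_def)

lemma primitive_const: "primitive_on T (\<lambda>_. 0) (\<lambda>_. c)"
  unfolding primitive_on_def by (auto simp: seg_def)

lemma primitive_exists:
  fixes a :: "real \<Rightarrow> 'v::{real_inner,complete_space}"
  assumes a: "a \<in> bochner_L2 M"
  obtains p where "primitive_on T a p" "p 0 = c"
proof -
  have "bounded_linear (\<lambda>x. seg T 0 t (\<lambda>r. a r \<bullet> x))" if t: "t \<in> {0..T}" for t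
  proof (rule bounded_linear_intro[where K = "sqrt t * bochner_L2_norm M a"])
    note int = L2_integrable_inner_const[OF a]
    show "seg T 0 t (\<lambda>r. a r \<bullet> (x + y)) = seg T 0 t (\<lambda>r. a r \<bullet> x) + seg T 0 t (\<lambda>r. a r \<bullet> y)" for x y
      using int by (simp add: inner_add_right seg_add)
    show "seg T 0 t (\<lambda>r. a r \<bullet> (k *\<^sub>R x)) = k *\<^sub>R seg T 0 t (\<lambda>r. a r \<bullet> x)" for k x
      by (simp add: seg_cmult)
    show "norm (seg T 0 t (\<lambda>r. a r \<bullet> x)) \<le> norm x * (sqrt t * bochner_L2_norm M a)" for x
    proof -
      have "\<bar>seg T 0 t (\<lambda>r. a r \<bullet> x)\<bar> \<le> seg T 0 t (\<lambda>r. norm x * norm (a r))"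
        using L2_integrable_norm[OF a] Cauchy_Schwarz_ineq2[of "a _" x]
        by (intro seg_abs_le int) (auto simp: mult.commute)
      also have "\<dots> \<le> norm x * (sqrt (t - 0) * bochner_L2_norm M a)"
        unfolding seg_cmult using t by (intro mult_left_mono seg_norm_le a) auto
      finally show ?thesis by simp
    qed
  qed
  then have rep: "riesz (Blinfun (\<lambda>x. seg T 0 t (\<lambda>r. a r \<bullet> x))) \<bullet> x = seg T 0 t (\<lambda>r. a r \<bullet> x)"
    if "t \<in> {0..T}" for t x
    using that by (simp add: riesz_inner bounded_linear_Blinfun_apply)
  define p where "p t = riesz (Blinfun (\<lambda>x. seg T 0 t (\<lambda>r. a r \<bullet> x))) + c" for t
  have "p 0 = c"
  proof -
    have "riesz (Blinfun (\<lambda>x. seg T 0 0 (\<lambda>r. a r \<bullet> x))) = 0"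
      by (rule eq_if_inner_eq, subst rep) (use T_pos in \<open>auto simp: seg_def\<close>)
    then show ?thesis by (simp add: p_def)
  qed
  moreover from this have "primitive_on T a p"
    unfolding primitive_on_def using a rep by (auto simp: p_def)
  ultimately show ?thesis using that by blast
qed

lemma primitive_bounded_linear:
  fixes h :: "'v::{real_inner,complete_space} \<Rightarrow> 'w::real_inner"
  assumes h: "bounded_linear h" and p: "primitive_on T a p"
  shows "primitive_on T (\<lambda>t. h (a t)) (\<lambda>t. h (p t))"
  unfolding primitive_on_def
proof (intro conjI ballI allI)
  show "(\<lambda>t. h (a t)) \<in> bochner_L2 M" by (rule L2_bounded_linear[OF h primitive_L2[OF p]])
  fix t x assume t: "t \<in> {0..T}"
  define z where "z = riesz (Blinfun (\<lambda>v. h v \<bullet> x))"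
  have z: "v \<bullet> z = h v \<bullet> x" for v
    unfolding z_def
    by (subst inner_commute, subst riesz_inner, subst bounded_linear_Blinfun_apply)
      (auto intro: bounded_linear_compose[OF bounded_linear_inner_left h])
  have "(h (p t) - h (p 0)) \<bullet> x = (p t - p 0) \<bullet> z"
    by (simp add: z linear_diff[OF bounded_linear.linear[OF h]])
  also have "\<dots> = seg T 0 t (\<lambda>r. a r \<bullet> z)" using p t by (simp add: primitive_on_def)
  finally show "(h (p t) - h (p 0)) \<bullet> x = seg T 0 t (\<lambda>r. h (a r) \<bullet> x)" by (simp add: z)
qed

subsection \<open>The product rule\<close>

text \<open>
  Increments telescope over an equidistant partition finer than \<open>d\<close>.
\<close>

lemma uniformly_locally_additive_bound:
  fixes G m :: "real \<Rightarrow> real"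
  assumes d: "0 < d"
    and le: "\<And>s t. 0 \<le> s \<Longrightarrow> s \<le> t \<Longrightarrow> t \<le> T \<Longrightarrow> t - s < d \<Longrightarrow> \<bar>G t - G s\<bar> \<le> m t - m s"
    and u: "u \<in> {0..T}"
  shows "\<bar>G u - G 0\<bar> \<le> m u - m 0"
proof -
  obtain N where N: "u / d < real N" using reals_Archimedean2 by blast
  then have N0: "0 < real N" using u d by (metis atLeastAtMost_iff divide_nonneg_pos order_le_less_trans)
  define \<tau> where "\<tau> k = u * real k / real N" for k :: nat
  have step: "\<bar>G (\<tau> (Suc k)) - G (\<tau> k)\<bar> \<le> m (\<tau> (Suc k)) - m (\<tau> k)" if "k < N" for k
  proof (rule le)
    show "0 \<le> \<tau> k" using u by (simp add: \<tau>_def)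
    show "\<tau> k \<le> \<tau> (Suc k)"
      unfolding \<tau>_def using u N0 by (intro divide_right_mono mult_left_mono) auto
    have "u * real (Suc k) \<le> u * real N" using that u by (intro mult_left_mono) auto
    then have "\<tau> (Suc k) \<le> u" using N0 by (simp add: \<tau>_def field_simps)
    then show "\<tau> (Suc k) \<le> T" using u by simp
    have "\<tau> (Suc k) - \<tau> k = u / real N" by (simp add: \<tau>_def distrib_left add_divide_distrib)
    also have "\<dots> < d" using N N0 d by (simp add: field_simps)
    finally show "\<tau> (Suc k) - \<tau> k < d" .
  qed
  have ends: "\<tau> 0 = 0" "\<tau> N = u" using N0 by (auto simp: \<tau>_def)
  have "\<bar>G u - G 0\<bar> = \<bar>\<Sum>k<N. G (\<tau> (Suc k)) - G (\<tau> k)\<bar>"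
    by (simp add: sum_lessThan_telescope[of "\<lambda>k. G (\<tau> k)"] ends)
  also have "\<dots> \<le> (\<Sum>k<N. \<bar>G (\<tau> (Suc k)) - G (\<tau> k)\<bar>)" by (rule sum_abs)
  also have "\<dots> \<le> (\<Sum>k<N. m (\<tau> (Suc k)) - m (\<tau> k))" using step by (intro sum_mono) auto
  also have "\<dots> = m u - m 0" by (simp add: sum_lessThan_telescope[of "\<lambda>k. m (\<tau> k)"] ends)
  finally show ?thesis .
qed

lemma le_zero_if_le_small_multiples:
  fixes x c :: real
  assumes le: "\<And>e. 0 < e \<Longrightarrow> x \<le> e * c" and c: "0 \<le> c"
  shows "x \<le> 0"
proof (rule ccontr)
  assume x: "\<not> x \<le> 0"
  have "x \<le> x / (2 * (c + 1)) * c" by (rule le) (use x c in simp)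
  then have "x * (2 * (c + 1)) \<le> x * c" using c by (simp add: field_simps)
  then have "2 * (c + 1) \<le> c" using x by simp
  then show False using c by simp
qed

text \<open>
  The increment of \<open>p \<bullet> q\<close> over a short interval is \<open>(p t - p s) \<bullet> q s + (q t - q s) \<bullet> p t\<close>.
  Replacing \<open>q s\<close> and \<open>p t\<close> by the values at the integration variable costs only the moduli of
  continuity times the integral of \<open>norm a + norm b\<close>, and the errors add up to an arbitrarily
  small total.
\<close>

theorem primitive_product_rule:
  fixes p q :: "real \<Rightarrow> 'v::real_inner"
  assumes p: "primitive_on T a p" and q: "primitive_on T b q" and u: "u \<in> {0..T}"
  shows "p u \<bullet> q u - p 0 \<bullet> q 0 = seg T 0 u (\<lambda>r. a r \<bullet> q r + p r \<bullet> b r)"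
proof -
  note a = primitive_L2[OF p] and b = primitive_L2[OF q]
  note pL = primitive_in_L2[OF p] and qL = primitive_in_L2[OF q]
  note int = L2_integrable_inner[OF a qL] L2_integrable_inner[OF pL b]
  define f where "f r = a r \<bullet> q r + p r \<bullet> b r" for r
  have f: "integrable M f" unfolding f_def using int by simp
  define G where "G t = p t \<bullet> q t - seg T 0 t f" for t
  let ?n = "\<lambda>r. norm (a r) + norm (b r)"
  have n: "integrable M ?n" using L2_integrable_norm[OF a] L2_integrable_norm[OF b] by simp
  have "\<bar>G u - G 0\<bar> \<le> e * integral\<^sup>L M ?n" if e: "0 < e" for e
  proof -
    obtain d1 where d1: "0 < d1" "\<And>s t. s \<in> {0..T} \<Longrightarrow> t \<in> {0..T} \<Longrightarrow> dist t s < d1 \<Longrightarrow> dist (p t) (p s) < e"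
      using compact_uniformly_continuous[OF primitive_continuous[OF p]] e
      by (force simp: uniformly_continuous_on_def)
    obtain d2 where d2: "0 < d2" "\<And>s t. s \<in> {0..T} \<Longrightarrow> t \<in> {0..T} \<Longrightarrow> dist t s < d2 \<Longrightarrow> dist (q t) (q s) < e"
      using compact_uniformly_continuous[OF primitive_continuous[OF q]] e
      by (force simp: uniformly_continuous_on_def)
    have "\<bar>G u - G 0\<bar> \<le> seg T 0 u (\<lambda>r. e * ?n r) - seg T 0 0 (\<lambda>r. e * ?n r)"
    proof (rule uniformly_locally_additive_bound[OF _ _ u, where d = "min d1 d2"])
      fix s t assume st: "0 \<le> s" "s \<le> t" "t \<le> T" "t - s < min d1 d2"
      have "p t \<bullet> q t - p s \<bullet> q s = (p t - p s) \<bullet> q s + (q t - q s) \<bullet> p t"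
        by (simp add: algebra_simps inner_commute)
      also have "\<dots> = seg T s t (\<lambda>r. a r \<bullet> q s) + seg T s t (\<lambda>r. b r \<bullet> p t)"
        using primitive_increment[OF p st(1-3)] primitive_increment[OF q st(1-3)] by simp
      also have "\<dots> = seg T s t (\<lambda>r. a r \<bullet> q s + b r \<bullet> p t)"
        by (simp add: seg_add L2_integrable_inner_const[OF a] L2_integrable_inner_const[OF b])
      finally have "G t - G s = seg T s t (\<lambda>r. a r \<bullet> q s + b r \<bullet> p t) - seg T s t f"
        using seg_split[OF f st(1,2)] by (simp add: G_def)
      also have "\<dots> = seg T s t (\<lambda>r. a r \<bullet> q s + b r \<bullet> p t - f r)"
        by (simp add: seg_diff f L2_integrable_inner_const[OF a] L2_integrable_inner_const[OF b])
      finally have "G t - G s = seg T s t (\<lambda>r. a r \<bullet> q s + b r \<bullet> p t - f r)" .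
      also have "\<bar>\<dots>\<bar> \<le> seg T s t (\<lambda>r. e * ?n r)"
      proof (rule seg_abs_le)
        fix r assume r: "r \<in> {0<..<T}" "s < r" "r \<le> t"
        have "a r \<bullet> q s + b r \<bullet> p t - f r = a r \<bullet> (q s - q r) + b r \<bullet> (p t - p r)"
          by (simp add: f_def algebra_simps inner_commute)
        also have "\<bar>\<dots>\<bar> \<le> norm (a r) * norm (q s - q r) + norm (b r) * norm (p t - p r)"
          by (intro order_trans[OF abs_triangle_ineq] add_mono Cauchy_Schwarz_ineq2)
        also have "\<dots> \<le> norm (a r) * e + norm (b r) * e"
          using d1(2)[of r t] d2(2)[of r s] r st
          by (intro add_mono mult_left_mono) (auto simp: dist_norm norm_minus_commute)
        finally show "\<bar>a r \<bullet> q s + b r \<bullet> p t - f r\<bar> \<le> e * ?n r" by (simp add: algebra_simps)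
      qed (use n f L2_integrable_inner_const[OF a] L2_integrable_inner_const[OF b] in auto)
      also have "\<dots> = seg T 0 t (\<lambda>r. e * ?n r) - seg T 0 s (\<lambda>r. e * ?n r)"
        using n by (subst seg_split[OF _ st(1,2)]) auto
      finally show "\<bar>G t - G s\<bar> \<le> seg T 0 t (\<lambda>r. e * ?n r) - seg T 0 s (\<lambda>r. e * ?n r)" .
    qed (use d1 d2 in auto)
    also have "\<dots> = e * seg T 0 u ?n" unfolding seg_cmult by (simp add: seg_def[of T 0 0])
    also have "\<dots> \<le> e * integral\<^sup>L M ?n" using e by (intro mult_left_mono seg_le_full n) auto
    finally show ?thesis .
  qed
  note small = this
  have "\<bar>G u - G 0\<bar> \<le> 0"
    by (rule le_zero_if_le_small_multiples[OF small]) (auto intro!: Bochner_Integration.integral_nonneg)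
  then show ?thesis by (simp add: G_def f_def[abs_def] seg_def)
qed

lemma primitive_product_rule_L2:
  fixes p q :: "real \<Rightarrow> 'v::real_inner"
  assumes p: "primitive_on T a p" and q: "primitive_on T b q"
  shows "p T \<bullet> q T - p 0 \<bullet> q 0 = L2_inner M a q + L2_inner M p b"
  using primitive_product_rule[OF p q, of T] T_pos L2_integrable_inner[OF primitive_L2[OF p] primitive_in_L2[OF q]]
    L2_integrable_inner[OF primitive_in_L2[OF p] primitive_L2[OF q]]
  by (simp add: seg_full L2_inner_def)

end

section \<open>Test functions\<close>

text \<open>
  Smoothness up to a finite order in a form that permits induction on the order for products and
  compositions.
\<close>

fun times_differentiable :: "nat \<Rightarrow> (real \<Rightarrow> real) \<Rightarrow> bool" where
  "times_differentiable 0 f \<longleftrightarrow> True"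
| "times_differentiable (Suc k) f \<longleftrightarrow> (\<forall>t. f differentiable (at t)) \<and> times_differentiable k (deriv f)"

lemma times_differentiable_funpow:
  "times_differentiable (Suc k) f \<longleftrightarrow> (\<forall>n\<le>k. \<forall>t. ((deriv ^^ n) f) differentiable (at t))"
proof (induction k arbitrary: f)
  case 0
  then show ?case by simp
next
  case (Suc k)
  have "(\<forall>n\<le>Suc k. \<forall>t. ((deriv ^^ n) f) differentiable (at t))
      \<longleftrightarrow> (\<forall>t. f differentiable (at t)) \<and> (\<forall>n\<le>k. \<forall>t. ((deriv ^^ Suc n) f) differentiable (at t))"
    by (metis Suc_le_mono bot_nat_0.extremum funpow_0 not0_implies_Suc)
  then show ?case
    using Suc[of "deriv f"] by (simp add: funpow_swap1)
qed

lemma times_differentiable_iff_smooth: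
  "(\<forall>k. times_differentiable k f) \<longleftrightarrow> (\<forall>n t. ((deriv ^^ n) f) differentiable (at t))"
proof
  assume "\<forall>k. times_differentiable k f"
  then have "times_differentiable (Suc n) f" for n by blast
  then show "\<forall>n t. ((deriv ^^ n) f) differentiable (at t)"
    unfolding times_differentiable_funpow by blast
next
  assume *: "\<forall>n t. ((deriv ^^ n) f) differentiable (at t)"
  show "\<forall>k. times_differentiable k f"
  proof
    show "times_differentiable k f" for k
      by (cases k) (use * in \<open>auto simp del: times_differentiable.simps(2) simp: times_differentiable_funpow\<close>)
  qed
qed

lemma times_differentiable_Suc_imp: "times_differentiable (Suc k) f \<Longrightarrow> times_differentiable k f"
  by (induction k arbitrary: f) auto

lemma times_differentiable_SucI:
  assumes "\<And>t. (f has_real_derivative g t) (at t)" "times_differentiable k g"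
  shows "times_differentiable (Suc k) f"
proof -
  have "deriv f = g" using assms(1) by (intro ext DERIV_imp_deriv)
  then show ?thesis using assms by (auto simp: real_differentiable_def)
qed

lemma times_differentiable_SucD:
  "times_differentiable (Suc k) f \<Longrightarrow> (f has_real_derivative deriv f t) (at t)"
  by (auto simp: DERIV_deriv_iff_real_differentiable)

lemma times_differentiable_add:
  "times_differentiable k f \<Longrightarrow> times_differentiable k g \<Longrightarrow> times_differentiable k (\<lambda>t. f t + g t)"
proof (induction k arbitrary: f g)
  case (Suc k)
  show ?case
  proof (rule times_differentiable_SucI)
    show "((\<lambda>t. f t + g t) has_real_derivative deriv f t + deriv g t) (at t)" for t
      by (intro DERIV_add times_differentiable_SucD[OF Suc.prems(1)] times_differentiable_SucD[OF Suc.prems(2)])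
    show "times_differentiable k (\<lambda>t. deriv f t + deriv g t)" using Suc by auto
  qed
qed simp

lemma times_differentiable_mult:
  "times_differentiable k f \<Longrightarrow> times_differentiable k g \<Longrightarrow> times_differentiable k (\<lambda>t. f t * g t)"
proof (induction k arbitrary: f g)
  case (Suc k)
  note fg = times_differentiable_Suc_imp[OF Suc.prems(1)] times_differentiable_Suc_imp[OF Suc.prems(2)]
  show ?case
  proof (rule times_differentiable_SucI)
    show "((\<lambda>t. f t * g t) has_real_derivative deriv f t * g t + deriv g t * f t) (at t)" for t
      by (rule DERIV_mult[OF times_differentiable_SucD[OF Suc.prems(1)] times_differentiable_SucD[OF Suc.prems(2)]])
    show "times_differentiable k (\<lambda>t. deriv f t * g t + deriv g t * f t)"
      using Suc fg by (intro times_differentiable_add Suc.IH) auto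
  qed
qed simp

lemma times_differentiable_const: "times_differentiable k (\<lambda>_. c)"
proof (induction k arbitrary: c)
  case (Suc k)
  show ?case by (rule times_differentiable_SucI[of _ "\<lambda>_. 0"]) (auto intro: Suc)
qed simp

lemma times_differentiable_affine:
  "times_differentiable k f \<Longrightarrow> times_differentiable k (\<lambda>t. f (c * t + d))"
proof (induction k arbitrary: f)
  case (Suc k)
  show ?case
  proof (rule times_differentiable_SucI)
    show "((\<lambda>t. f (c * t + d)) has_real_derivative deriv f (c * t + d) * c) (at t)" for t
      by (rule DERIV_chain2[OF times_differentiable_SucD[OF Suc.prems]]) (auto intro!: derivative_eq_intros)
    show "times_differentiable k (\<lambda>t. deriv f (c * t + d) * c)"
      using Suc by (intro times_differentiable_mult times_differentiable_const) auto
  qed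
qed simp

text \<open>
  The derivative of \<open>p(1/t) exp(-1/t)\<close> has the same form with another polynomial, which makes
  smoothness at \<open>0\<close> an induction.
\<close>

definition flat_exp :: "real poly \<Rightarrow> real \<Rightarrow> real" where
  "flat_exp p t = (if 0 < t then poly p (1 / t) * exp (- (1 / t)) else 0)"

lemma poly_over_exp_tendsto_0: "((\<lambda>x. poly p x * exp (- x)) \<longlongrightarrow> 0) (at_top :: real filter)"
proof -
  have "((\<lambda>x. \<Sum>i\<le>degree p. coeff p i * (x ^ i / exp x)) \<longlongrightarrow> (\<Sum>i\<le>degree p. coeff p i * 0)) at_top"
    by (intro tendsto_intros tendsto_power_div_exp_0)
  then show ?thesis
    by (simp add: poly_altdef sum_distrib_right sum_divide_distrib exp_minus field_simps)
qed

lemma flat_exp_has_derivative: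
  "(flat_exp p has_real_derivative flat_exp ([:0, 0, 1:] * (p - pderiv p)) t) (at t)"
proof -
  consider "0 < t" | "t < 0" | "t = 0" by linarith
  then show ?thesis
  proof cases
    case 1
    have inv: "((\<lambda>t. 1 / t) has_real_derivative - (1 / t\<^sup>2)) (at t)"
      using DERIV_inverse[of t] 1 by (simp add: inverse_eq_divide power2_eq_square)
    have "((\<lambda>t. poly p (1 / t) * exp (- (1 / t))) has_real_derivative
        poly (pderiv p) (1 / t) * - (1 / t\<^sup>2) * exp (- (1 / t))
          + exp (- (1 / t)) * - (- (1 / t\<^sup>2)) * poly p (1 / t)) (at t)"
      by (rule DERIV_mult[OF DERIV_chain2[OF poly_DERIV inv] DERIV_chain2[OF DERIV_exp DERIV_minus[OF inv]]])
    also have "poly (pderiv p) (1 / t) * - (1 / t\<^sup>2) * exp (- (1 / t))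
          + exp (- (1 / t)) * - (- (1 / t\<^sup>2)) * poly p (1 / t)
        = flat_exp ([:0, 0, 1:] * (p - pderiv p)) t"
      using 1 by (simp add: flat_exp_def power2_eq_square algebra_simps)
    finally show ?thesis
      by (rule has_field_derivative_transform_within_open[of _ _ _ "{0<..}"])
        (use 1 in \<open>auto simp: flat_exp_def\<close>)
  next
    case 2
    have "((\<lambda>_. 0) has_real_derivative flat_exp ([:0, 0, 1:] * (p - pderiv p)) t) (at t)"
      using 2 by (simp add: flat_exp_def)
    then show ?thesis
      by (rule has_field_derivative_transform_within_open[of _ _ _ "{..<0}"])
        (use 2 in \<open>auto simp: flat_exp_def\<close>)
  next
    case 3
    have "((\<lambda>h. poly (pCons 0 p) (inverse h) * exp (- inverse h)) \<longlongrightarrow> 0) (at_right 0)"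
      by (rule filterlim_compose[OF poly_over_exp_tendsto_0 filterlim_inverse_at_top_right])
    then have right: "((\<lambda>h. flat_exp p h / h) \<longlongrightarrow> 0) (at_right 0)"
      by (rule Lim_transform_eventually)
        (auto simp: flat_exp_def eventually_at_filter field_simps)
    have left: "((\<lambda>h. flat_exp p h / h) \<longlongrightarrow> 0) (at_left 0)"
      by (rule Lim_transform_eventually[OF tendsto_const])
        (auto simp: flat_exp_def eventually_at_filter)
    have "((\<lambda>h. flat_exp p h / h) \<longlongrightarrow> 0) (at 0)"
      using left right by (simp add: filterlim_at_split)
    then show ?thesis using 3 by (simp add: DERIV_def flat_exp_def)
  qed
qed

lemma times_differentiable_flat_exp: "times_differentiable k (flat_exp p)"
  by (induction k arbitrary: p) (auto intro: times_differentiable_SucI flat_exp_has_derivative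
      simp del: times_differentiable.simps(2))

text \<open>
  For \<open>k \<rightarrow> \<infinity>\<close> these functions increase to the indicator of the open interval from \<open>a\<close> to \<open>b\<close>.
\<close>

definition bump :: "real \<Rightarrow> real \<Rightarrow> real \<Rightarrow> real \<Rightarrow> real" where
  "bump k a b t = flat_exp 1 (k * (t - a)) * flat_exp 1 (k * (b - t))"

lemma times_differentiable_bump: "times_differentiable n (bump k a b)"
proof -
  have "times_differentiable n (\<lambda>t. flat_exp 1 (k * t + (- k * a)) * flat_exp 1 ((- k) * t + k * b))"
    by (intro times_differentiable_mult times_differentiable_affine times_differentiable_flat_exp)
  moreover have "(\<lambda>t. flat_exp 1 (k * t + (- k * a)) * flat_exp 1 ((- k) * t + k * b)) = bump k a b"
    by (simp add: fun_eq_iff bump_def algebra_simps)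
  ultimately show ?thesis by simp
qed

lemma flat_exp_1_bounds: "0 \<le> flat_exp 1 t" "flat_exp 1 t \<le> 1"
  by (auto simp: flat_exp_def)

lemma bump_bounds: "0 \<le> bump k a b t" "bump k a b t \<le> 1"
  using flat_exp_1_bounds by (auto simp: bump_def intro: mult_le_one)

lemma bump_eq_0: "0 \<le> k \<Longrightarrow> t \<notin> {a..b} \<Longrightarrow> bump k a b t = 0"
  by (auto simp: bump_def flat_exp_def zero_less_mult_iff)

lemma flat_exp_1_tendsto: "(flat_exp 1 \<longlongrightarrow> 1) at_top"
proof -
  have "((\<lambda>t :: real. exp (- inverse t)) \<longlongrightarrow> exp (- 0)) at_top"
    by (intro tendsto_intros tendsto_inverse_0_at_top filterlim_ident)
  then have "((\<lambda>t :: real. exp (- inverse t)) \<longlongrightarrow> 1) at_top" by simp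
  moreover have "\<forall>\<^sub>F t :: real in at_top. exp (- inverse t) = flat_exp 1 t"
    using eventually_gt_at_top[of 0] by eventually_elim (simp add: flat_exp_def inverse_eq_divide)
  ultimately show ?thesis by (rule Lim_transform_eventually)
qed

lemma test_functionI:
  assumes smooth: "\<And>k. times_differentiable k f" and supp: "\<And>t. t \<notin> {a..b} \<Longrightarrow> f t = 0"
    and ab: "0 < a" "b < T"
  shows "f \<in> test_functions T"
proof -
  have "{t. f t \<noteq> 0} \<subseteq> {a..b}" using supp by blast
  then have cl: "closure {t. f t \<noteq> 0} \<subseteq> {a..b}" by (rule closure_minimal) simp
  then have "bounded (closure {t. f t \<noteq> 0})" by (rule bounded_subset[rotated]) simp
  then have "compact (closure {t. f t \<noteq> 0})" by (simp add: compact_eq_bounded_closed)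
  moreover have "closure {t. f t \<noteq> 0} \<subseteq> {0<..<T}" using cl ab by fastforce
  ultimately show ?thesis
    using smooth by (simp add: test_functions_def flip: times_differentiable_iff_smooth)
qed

lemma test_function_props:
  assumes "f \<in> test_functions T"
  shows "\<And>t. (f has_real_derivative deriv f t) (at t)" "continuous_on UNIV f" "continuous_on UNIV (deriv f)"
    and "\<And>t. t \<notin> {0<..<T} \<Longrightarrow> f t = 0"
proof -
  have diff: "times_differentiable k f" for k
    using assms times_differentiable_iff_smooth by (auto simp: test_functions_def)
  show d: "(f has_real_derivative deriv f t) (at t)" for t
    using times_differentiable_SucD[OF diff] .
  then show "continuous_on UNIV f" by (auto intro!: DERIV_continuous_on)
  have "(deriv f has_real_derivative deriv (deriv f) t) (at t)" for t
    using diff[of "Suc (Suc 0)"] by (intro times_differentiable_SucD[of 0]) simp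
  then show "continuous_on UNIV (deriv f)" by (auto intro!: DERIV_continuous_on)
  show "f t = 0" if "t \<notin> {0<..<T}" for t
    using assms that closure_subset[of "{t. f t \<noteq> 0}"] by (auto simp: test_functions_def)
qed

context time_interval
begin

lemma seg_FTC:
  assumes F: "\<And>t. (F has_real_derivative f t) (at t)" and f: "continuous_on UNIV f"
    and t: "t \<in> {0..T}"
  shows "seg T 0 t f = F t - F 0"
proof -
  have "seg T 0 t f = (LINT r|lebesgue. indicat_real {0<..<T} r *\<^sub>R (indicat_real {0<..t} r * f r))"
    unfolding seg_def by (subst integral_restrict_space) auto
  also have "\<dots> = (LINT r|lebesgue. f r * indicat_real {0..t} r)"
  proof (rule integral_cong_AE)
    have [measurable]: "f \<in> borel_measurable borel" using f by (rule borel_measurable_continuous_onI)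
    show "(\<lambda>r. indicat_real {0<..<T} r *\<^sub>R (indicat_real {0<..t} r * f r)) \<in> borel_measurable lebesgue"
      by (rule measurable_completion) measurable
    show "(\<lambda>r. f r * indicat_real {0..t} r) \<in> borel_measurable lebesgue"
      by (rule measurable_completion) measurable
    have "AE r in lebesgue. r \<notin> {0, T}" by (rule AE_not_in) simp
    then show "AE r in lebesgue. indicat_real {0<..<T} r *\<^sub>R (indicat_real {0<..t} r * f r)
        = f r * indicat_real {0..t} r"
      by eventually_elim (use t in \<open>auto simp: indicator_def\<close>)
  qed
  also have "\<dots> = (LINT r|lborel. f r * indicat_real {0..t} r)"
    by (rule integral_completion) (use borel_measurable_continuous_onI[OF f] in measurable)
  also have "\<dots> = F t - F 0"
    by (rule integral_FTC_Icc_real) (use t F f in \<open>auto simp: continuous_on_eq_continuous_at\<close>)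
  finally show ?thesis .
qed

lemma continuous_integrable: "continuous_on UNIV f \<Longrightarrow> integrable M (f :: real \<Rightarrow> real)"
  using L2_integrable_inner[OF continuous_L2 L2_const[of 1], of f] continuous_on_subset by fastforce

text \<open>
  The vanishing mean makes the primitive vanish to the right of the support as well.
\<close>

lemma mean_zero_has_test_primitive:
  assumes smooth: "\<And>k. times_differentiable k f" and supp: "\<And>t. t \<notin> {a..b} \<Longrightarrow> f t = 0"
    and ab: "0 < a" "b < T" and mean: "(LINT t|M. f t) = 0"
  obtains F where "F \<in> test_functions T" "deriv F = f"
proof -
  have cont: "continuous_on UNIV f"
    using times_differentiable_SucD[OF smooth] by (auto intro!: DERIV_continuous_on)
  define F where "F t = integral {0..t} f" for t
  have F_left: "F t = 0" if "t < a" for t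
  proof -
    have "integral {0..t} f = integral {0..t} (\<lambda>_. 0)"
      by (rule integral_cong) (use supp that in auto)
    then show ?thesis by (simp add: F_def)
  qed
  have F: "(F has_real_derivative f t) (at t)" for t
  proof (cases "t < a")
    case True
    have "((\<lambda>_. 0) has_real_derivative f t) (at t)" using supp True by simp
    then show ?thesis
      by (rule has_field_derivative_transform_within_open[of _ _ _ "{..<a}"]) (use True F_left in auto)
  next
    case False
    have "((\<lambda>x. integral {0..x} f) has_real_derivative f t) (at t within {0..t + 1})"
      using False ab cont by (intro integral_has_real_derivative) (auto intro: continuous_on_subset)
    then show ?thesis
      unfolding F_def[abs_def] using False ab by (subst (asm) at_within_interior) auto
  qed
  have "F T = 0"
    using seg_FTC[OF F cont, of T] T_pos mean by (simp add: seg_full F_def)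
  have F_right: "F t = 0" if "b < t" for t
  proof -
    have "F t = F T"
    proof (rule DERIV_isconst3[where a = b and b = "max t T + 1" and f = F])
      show "(F has_real_derivative 0) (at x)" if "x \<in> {b<..<max t T + 1}" for x
        using F[of x] supp[of x] that by simp
    qed (use that ab in auto)
    then show ?thesis using \<open>F T = 0\<close> by simp
  qed
  have "times_differentiable k F" for k
    using times_differentiable_Suc_imp[OF times_differentiable_SucI[OF F smooth]] .
  moreover have "F t = 0" if "t \<notin> {a..b}" for t using that F_left F_right by force
  ultimately have "F \<in> test_functions T" by (rule test_functionI) (use ab in auto)
  moreover have "deriv F = f" using F by (intro ext DERIV_imp_deriv)
  ultimately show ?thesis by (rule that)
qed

subsection \<open>The lemma of du Bois-Reymond\<close>

text \<open>
  The positive and the negative part of \<open>h\<close> are densities of two Borel measures that agree on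
  half-lines, hence on Borel sets, hence up to null sets on Lebesgue sets.
\<close>

lemma AE_zero_if_seg_zero:
  assumes h: "integrable M h" and seg: "\<And>s. s \<in> {0..T} \<Longrightarrow> seg T s T h = 0"
  shows "AE t in M. h t = 0"
proof -
  have [measurable]: "h \<in> borel_measurable M" using h by simp
  define \<nu> where "\<nu> f = distr (density M (\<lambda>t. ennreal (f t))) borel (\<lambda>t. t)" for f :: "real \<Rightarrow> real"
  have id: "(\<lambda>t. t) \<in> measurable (density M f) borel" for f
    using borel_measurable_M[of "\<lambda>t. t"] by simp
  let ?p = "\<lambda>t. max 0 (h t)" and ?m = "\<lambda>t. max 0 (- h t)"
  have int: "integrable M ?p" "integrable M ?m" using h by auto
  have ind [measurable]: "indicat_real B \<in> borel_measurable M" if "B \<in> sets borel" for B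
    using that by (intro borel_measurable_M) simp
  have \<nu>_nn: "emeasure (\<nu> f) B = (\<integral>\<^sup>+t. ennreal (f t) * indicator B t \<partial>M)"
    if f: "f \<in> borel_measurable M" and B: "B \<in> sets borel" for f B
  proof -
    have BM: "(\<lambda>t. t) -` B \<inter> space M \<in> sets M"
      using measurable_sets[OF borel_measurable_M[of "\<lambda>t. t"]] B by simp
    have "emeasure (\<nu> f) B = emeasure (density M (\<lambda>t. ennreal (f t))) ((\<lambda>t. t) -` B \<inter> space M)"
      unfolding \<nu>_def by (subst emeasure_distr[OF id B]) simp
    also have "\<dots> = (\<integral>\<^sup>+t. ennreal (f t) * indicator ((\<lambda>t. t) -` B \<inter> space M) t \<partial>M)"
      using f BM by (intro emeasure_density) auto
    also have "\<dots> = (\<integral>\<^sup>+t. ennreal (f t) * indicator B t \<partial>M)"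
      by (intro nn_integral_cong) (auto simp: indicator_def)
    finally show ?thesis .
  qed
  have \<nu>_Ioi: "emeasure (\<nu> f) {x<..} = ennreal (seg T (max 0 x) T f)"
    if f: "integrable M f" "\<And>t. 0 \<le> f t" for f x
  proof -
    have "emeasure (\<nu> f) {x<..} = (\<integral>\<^sup>+t. ennreal (indicat_real {max 0 x<..T} t * f t) \<partial>M)"
      using f by (subst \<nu>_nn) (auto intro!: nn_integral_cong simp: indicator_def)
    also have "\<dots> = ennreal (seg T (max 0 x) T f)"
      unfolding seg_def using f by (intro nn_integral_eq_integral integrable_segment) auto
    finally show ?thesis .
  qed
  have seg_eq: "seg T (max 0 x) T ?p = seg T (max 0 x) T ?m" for x
  proof (cases "x \<le> T")
    case True
    have "seg T (max 0 x) T (\<lambda>t. ?p t - ?m t) = seg T (max 0 x) T h"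
      unfolding seg_def by (intro Bochner_Integration.integral_cong) auto
    also have "\<dots> = 0" using True T_pos by (intro seg) auto
    finally show ?thesis using int by (simp add: seg_diff)
  next
    case False
    then show ?thesis by (simp add: seg_def)
  qed
  have "\<nu> ?p = \<nu> ?m"
  proof (rule measure_eqI_lessThan)
    show "emeasure (\<nu> ?p) {x<..} < \<infinity>" for x using int by (subst \<nu>_Ioi) auto
    show "emeasure (\<nu> ?p) {x<..} = emeasure (\<nu> ?m) {x<..}" for x
      using int seg_eq by (subst (1 2) \<nu>_Ioi) auto
  qed (auto simp: \<nu>_def)
  have "AE t in M. ennreal (?p t) = ennreal (?m t)"
  proof (rule density_unique_finite_measure)
    fix A assume "A \<in> sets M"
    then have A: "A \<in> sets lebesgue" by (simp add: sets_restrict_space_iff)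
    then obtain S N N' where S: "S \<in> sets lborel" "A = S \<union> N" and N: "N \<subseteq> N'" "N' \<in> null_sets lborel"
      by (rule sets_completionE)
    have "AE t in lebesgue. t \<notin> N'" using N by (intro AE_completion AE_not_in)
    then have "AE t in M. t \<notin> N'" by (subst AE_restrict_space_iff) (auto elim: eventually_mono)
    then have AS: "AE t in M. indicator A t = (indicator S t :: ennreal)"
      by eventually_elim (use S N in \<open>auto simp: indicator_def\<close>)
    have eq: "(\<integral>\<^sup>+t. ennreal (f t) * indicator A t \<partial>M) = emeasure (\<nu> f) S"
      if "f \<in> borel_measurable M" for f
    proof -
      have "(\<integral>\<^sup>+t. ennreal (f t) * indicator A t \<partial>M) = (\<integral>\<^sup>+t. ennreal (f t) * indicator S t \<partial>M)"
        using AS by (intro nn_integral_cong_AE) (auto elim: eventually_mono)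
      then show ?thesis using that S(1) by (simp add: \<nu>_nn)
    qed
    show "(\<integral>\<^sup>+t. ennreal (?p t) * indicator A t \<partial>M) = (\<integral>\<^sup>+t. ennreal (?m t) * indicator A t \<partial>M)"
      using \<open>\<nu> ?p = \<nu> ?m\<close> by (subst (1 2) eq) auto
  qed auto
  then show ?thesis by eventually_elim (auto simp: max_def split: if_splits)
qed

text \<open>
  The margin at both ends keeps the support of the bump inside the open interval from \<open>0\<close> to
  \<open>T\<close>. It vanishes like \<open>1/n\<close>, while the bump steepens like \<open>n\<close>, so the limit is still the
  indicator.
\<close>

lemma bump_integral_tendsto:
  assumes h: "integrable M h" and s: "0 \<le> s" "s < T"
  defines "\<epsilon> \<equiv> \<lambda>n. (T - s) / (real n + 3)"
  shows "(\<lambda>n. LINT t|M. bump (real n) (s + \<epsilon> n) (T - \<epsilon> n) t * h t) \<longlonglongrightarrow> seg T s T h"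
  unfolding seg_def
proof (rule integral_dominated_convergence)
  have cont: "continuous_on UNIV (bump k a b)" for k a b
    using times_differentiable_SucD[OF times_differentiable_bump] by (auto intro!: DERIV_continuous_on)
  then have [measurable]: "bump k a b \<in> borel_measurable M" for k a b
    by (intro borel_measurable_M borel_measurable_continuous_onI)
  have hm [measurable]: "h \<in> borel_measurable M" using h by simp
  show "(\<lambda>t. bump (real n) (s + \<epsilon> n) (T - \<epsilon> n) t * h t) \<in> borel_measurable M" for n by measurable
  show "(\<lambda>t. indicat_real {s<..T} t * h t) \<in> borel_measurable M"
    using integrable_segment[OF h] by simp
  show "integrable M (\<lambda>t. \<bar>h t\<bar>)" using h by simp
  show "AE t in M. norm (bump (real n) (s + \<epsilon> n) (T - \<epsilon> n) t * h t) \<le> \<bar>h t\<bar>" for n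
    using bump_bounds by (auto simp: abs_mult intro!: mult_left_le_one_le)
  have large: "((\<lambda>n. flat_exp 1 (real n * (x - \<epsilon> n))) \<longlonglongrightarrow> 1)" if "0 < x" for x
  proof (rule filterlim_compose[OF flat_exp_1_tendsto])
    have "filterlim (\<lambda>n. - (T - s) + x * real n) at_top sequentially"
      by (intro filterlim_tendsto_add_at_top[OF tendsto_const]
          filterlim_tendsto_pos_mult_at_top[OF tendsto_const that] filterlim_real_sequentially)
    then show "filterlim (\<lambda>n. real n * (x - \<epsilon> n)) at_top sequentially"
    proof (rule filterlim_at_top_mono)
      have "real n * \<epsilon> n \<le> T - s" for n
      proof -
        have "real n * (T - s) \<le> (T - s) * (real n + 3)" using s by (simp add: algebra_simps)
        then show ?thesis by (simp add: \<epsilon>_def divide_le_eq)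
      qed
      then show "\<forall>\<^sub>F n in sequentially. - (T - s) + x * real n \<le> real n * (x - \<epsilon> n)"
        by (simp add: algebra_simps)
    qed
  qed
  have lim: "(\<lambda>n. bump (real n) (s + \<epsilon> n) (T - \<epsilon> n) t) \<longlonglongrightarrow> indicat_real {s<..T} t" if t: "t \<in> {0<..<T}" for t
  proof (cases "s < t")
    case True
    have eq: "bump (real n) (s + \<epsilon> n) (T - \<epsilon> n) t
        = flat_exp 1 (real n * ((t - s) - \<epsilon> n)) * flat_exp 1 (real n * ((T - t) - \<epsilon> n))" for n
      by (simp add: bump_def algebra_simps)
    show ?thesis
      unfolding eq using tendsto_mult[OF large[of "t - s"] large[of "T - t"]] True t by simp
  next
    case False
    have "bump (real n) (s + \<epsilon> n) (T - \<epsilon> n) t = 0" for n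
    proof (rule bump_eq_0)
      have "0 < \<epsilon> n" using s by (simp add: \<epsilon>_def)
      then show "t \<notin> {s + \<epsilon> n..T - \<epsilon> n}" using False by simp
    qed simp
    then show ?thesis using False by simp
  qed
  show "AE t in M. (\<lambda>n. bump (real n) (s + \<epsilon> n) (T - \<epsilon> n) t * h t) \<longlonglongrightarrow> indicat_real {s<..T} t * h t"
    by (rule AE_I2) (use lim in \<open>auto intro!: tendsto_mult_right\<close>)
qed

lemma fundamental_lemma:
  assumes h: "integrable M h" and orth: "\<And>\<phi>. \<phi> \<in> test_functions T \<Longrightarrow> (LINT t|M. \<phi> t * h t) = 0"
  shows "AE t in M. h t = 0"
proof (rule AE_zero_if_seg_zero[OF h])
  fix s assume s: "s \<in> {0..T}"
  show "seg T s T h = 0"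
  proof (cases "s < T")
    case True
    define \<epsilon> where "\<epsilon> n = (T - s) / (real n + 3)" for n
    have "0 < \<epsilon> n" for n using True by (simp add: \<epsilon>_def)
    then have "bump (real n) (s + \<epsilon> n) (T - \<epsilon> n) \<in> test_functions T" for n
      using s by (intro test_functionI[of _ "s + \<epsilon> n" "T - \<epsilon> n"] times_differentiable_bump bump_eq_0)
        (auto intro: add_nonneg_pos)
    then have "(LINT t|M. bump (real n) (s + \<epsilon> n) (T - \<epsilon> n) t * h t) = 0" for n by (rule orth)
    then show ?thesis
      using bump_integral_tendsto[OF h _ True] s by (simp add: \<epsilon>_def LIMSEQ_const_iff)
  next
    case False
    then show ?thesis by (simp add: seg_def)
  qed
qed

text \<open>
  Subtracting a multiple of one fixed bump turns any bump into the derivative of a test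
  function; the correction is what produces the constant.
\<close>

theorem du_Bois_Reymond:
  assumes h: "integrable M h" and orth: "\<And>\<phi>. \<phi> \<in> test_functions T \<Longrightarrow> (LINT t|M. deriv \<phi> t * h t) = 0"
  obtains c where "AE t in M. h t = c"
proof -
  define \<epsilon> where "\<epsilon> s n = (T - s) / (real n + 3)" for s :: real and n :: nat
  let ?b = "\<lambda>s n. bump (real n) (s + \<epsilon> s n) (T - \<epsilon> s n)"
  have b_cont: "continuous_on UNIV (?b s n)" for s n
    using times_differentiable_SucD[OF times_differentiable_bump] by (auto intro!: DERIV_continuous_on)
  have b_int: "integrable M (?b s n)" for s n by (rule continuous_integrable[OF b_cont])
  have bh_int: "integrable M (\<lambda>t. ?b s n t * h t)" for s n
  proof (rule Bochner_Integration.integrable_bound[OF h])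
    show "(\<lambda>t. ?b s n t * h t) \<in> borel_measurable M" using b_int[of n s] h by auto
    show "AE t in M. norm (?b s n t * h t) \<le> norm (h t)"
      using bump_bounds by (auto simp: abs_mult intro!: mult_left_le_one_le)
  qed
  have \<epsilon>_pos: "0 < \<epsilon> s n" if "s < T" for s n using that by (simp add: \<epsilon>_def)
  \<comment> \<open>A bump of nonzero mean, used to correct the mean of other bumps.\<close>
  have "(\<lambda>n. LINT t|M. ?b 0 n t * 1) \<longlonglongrightarrow> seg T 0 T (\<lambda>_. 1)"
    using bump_integral_tendsto[of "\<lambda>_. 1" 0] T_pos by (simp add: \<epsilon>_def)
  moreover have "seg T 0 T (\<lambda>_. 1) = T" using measure_segment[of 0 T] T_pos by (simp add: seg_def)
  ultimately have "\<forall>\<^sub>F n in sequentially. 0 < (LINT t|M. ?b 0 n t * 1)"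
    using T_pos by (intro order_tendstoD) auto
  then obtain m where m: "0 < (LINT t|M. ?b 0 m t)"
    using eventually_happens'[OF sequentially_bot] by auto
  define c where "c = (LINT t|M. ?b 0 m t * h t) / (LINT t|M. ?b 0 m t)"
  have bump_orth: "(LINT t|M. ?b s n t * (h t - c)) = 0" if s: "0 \<le> s" "s < T" for s n
  proof -
    define r where "r = - (LINT t|M. ?b s n t) / (LINT t|M. ?b 0 m t)"
    define f where "f t = ?b s n t + r * ?b 0 m t" for t
    define d where "d = min (\<epsilon> s n) (\<epsilon> 0 m)"
    have d: "0 < d" using \<epsilon>_pos s T_pos by (simp add: d_def)
    have supp: "f t = 0" if "t \<notin> {d..T - d}" for t
    proof -
      have "t \<notin> {s + \<epsilon> s n..T - \<epsilon> s n}" "t \<notin> {0 + \<epsilon> 0 m..T - \<epsilon> 0 m}"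
        using that s by (auto simp: d_def)
      then show ?thesis unfolding f_def by (subst (1 2) bump_eq_0) auto
    qed
    have smooth: "times_differentiable k f" for k
      unfolding f_def
      by (intro times_differentiable_add times_differentiable_mult times_differentiable_const times_differentiable_bump)
    have "(LINT t|M. f t) = (LINT t|M. ?b s n t) + r * (LINT t|M. ?b 0 m t)"
      unfolding f_def using b_int[of n s] b_int[of m 0] by simp
    then have mean: "(LINT t|M. f t) = 0" using m by (simp add: r_def)
    obtain F where F: "F \<in> test_functions T" "deriv F = f"
      by (rule mean_zero_has_test_primitive[OF smooth supp _ _ mean]) (use d in auto)
    have "0 = (LINT t|M. f t * h t)" using orth[OF F(1)] F(2) by simp
    also have "\<dots> = (LINT t|M. ?b s n t * h t) + r * (LINT t|M. ?b 0 m t * h t)"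
      unfolding f_def using bh_int[of n s] bh_int[of m 0] by (simp add: distrib_right mult.assoc)
    also have "\<dots> = (LINT t|M. ?b s n t * h t) - c * (LINT t|M. ?b s n t)"
      by (simp add: r_def c_def)
    also have "\<dots> = (LINT t|M. ?b s n t * (h t - c))"
      using bh_int[of n s] b_int[of n s] by (simp add: right_diff_distrib left_diff_distrib mult.commute)
    finally show ?thesis by simp
  qed
  have hc: "integrable M (\<lambda>t. h t - c)" using h by simp
  have "AE t in M. h t - c = 0"
  proof (rule AE_zero_if_seg_zero[OF hc])
    fix s assume s: "s \<in> {0..T}"
    show "seg T s T (\<lambda>t. h t - c) = 0"
    proof (cases "s < T")
      case True
      have "(\<lambda>n. LINT t|M. ?b s n t * (h t - c)) \<longlonglongrightarrow> seg T s T (\<lambda>t. h t - c)"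
        using bump_integral_tendsto[OF hc _ True] s by (simp add: \<epsilon>_def)
      then show ?thesis using bump_orth[OF _ True] s by (simp add: LIMSEQ_const_iff)
    next
      case False
      then show ?thesis by (simp add: seg_def)
    qed
  qed
  then have "AE t in M. h t = c" by eventually_elim simp
  then show ?thesis by (rule that)
qed

end

section \<open>Weak time derivatives in a Gelfand triple\<close>

context complete_finite_measure
begin

text \<open>
  The exceptional null set depends on \<open>x\<close>, and the target space need not be separable. A simple
  function takes only finitely many values, so \<open>w\<close> is orthogonal to simple functions, which are
  dense.
\<close>

lemma L2_weakly_zero:
  assumes w: "w \<in> bochner_L2 M" and zero: "\<And>x. AE t in M. w t \<bullet> x = 0"
  shows "AE t in M. w t = 0"
proof -
  obtain s where s: "\<And>i::nat. simple_function M (s i)"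
    and lim: "(\<lambda>i. bochner_L2_norm M (\<lambda>t. w t - s i t)) \<longlonglongrightarrow> 0"
    using L2_approx_simple[OF w] by blast
  have sL: "s i \<in> bochner_L2 M" for i by (rule L2_simple[OF s])
  have "L2_inner M w (s i) = 0" for i
  proof -
    have "finite (s i ` space M)" using s by (simp add: simple_function_def)
    then have "AE t in M. \<forall>y\<in>s i ` space M. w t \<bullet> y = 0" using zero by (intro AE_finite_allI)
    then have "AE t in M. w t \<bullet> s i t = 0" using AE_space by eventually_elim auto
    then show ?thesis unfolding L2_inner_def by (rule integral_eq_zero_AE)
  qed
  then have "(bochner_L2_norm M w)\<^sup>2 = L2_inner M w (\<lambda>t. w t - s i t)" for i
    using w sL by (simp add: L2_norm_power2 L2_inner_linear)
  then have "(bochner_L2_norm M w)\<^sup>2 \<le> bochner_L2_norm M w * bochner_L2_norm M (\<lambda>t. w t - s i t)" for i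
    using L2_Cauchy_Schwarz[OF w L2_diff[OF w sL]] by (metis abs_le_D1)
  moreover have "(\<lambda>i. bochner_L2_norm M w * bochner_L2_norm M (\<lambda>t. w t - s i t)) \<longlonglongrightarrow> 0"
    using lim by (rule tendsto_mult_right_zero)
  ultimately have "(bochner_L2_norm M w)\<^sup>2 \<le> 0" by (intro LIMSEQ_le_const) auto
  then have "bochner_L2_norm M w = 0" by simp
  then show ?thesis by (simp add: L2_norm_eq_0_iff[OF w])
qed

end

lemma (in time_interval) test_function_primitive:
  assumes \<phi>: "\<phi> \<in> test_functions T"
  shows "primitive_on T (\<lambda>t. deriv \<phi> t *\<^sub>R x) (\<lambda>t. \<phi> t *\<^sub>R x)"
  unfolding primitive_on_def
proof (intro conjI ballI allI)
  have "continuous_on {0..T} (\<lambda>t. deriv \<phi> t *\<^sub>R x)"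
    using test_function_props(3)[OF \<phi>] by (auto intro!: continuous_intros intro: continuous_on_subset)
  then show "(\<lambda>t. deriv \<phi> t *\<^sub>R x) \<in> bochner_L2 M" by (rule continuous_L2)
  fix t y assume t: "t \<in> {0..T}"
  have "seg T 0 t (\<lambda>r. (x \<bullet> y) * deriv \<phi> r) = (x \<bullet> y) * (\<phi> t - \<phi> 0)"
    unfolding seg_cmult seg_FTC[OF test_function_props(1,3)[OF \<phi>] t] ..
  then show "(\<phi> t *\<^sub>R x - \<phi> 0 *\<^sub>R x) \<bullet> y = seg T 0 t (\<lambda>r. deriv \<phi> r *\<^sub>R x \<bullet> y)"
    by (simp add: inner_diff_left algebra_simps)
qed

lemma (in time_interval) continuous_eq_AE:
  fixes c c' :: "real \<Rightarrow> 'b::real_normed_vector"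
  assumes c: "continuous_on {0..T} c" "continuous_on {0..T} c'" and eq: "AE t in M. c t = c' t"
    and t: "t \<in> {0..T}"
  shows "c t = c' t"
proof (rule ccontr)
  assume neq: "c t \<noteq> c' t"
  have cont: "continuous_on {0..T} (\<lambda>s. c s - c' s)" using c by (intro continuous_on_diff)
  obtain d where d: "0 < d" "\<And>s. s \<in> {0..T} \<Longrightarrow> dist s t < d \<Longrightarrow> dist (c s - c' s) (c t - c' t) < norm (c t - c' t)"
    using cont[unfolded continuous_on_iff] t neq by (metis right_minus_eq zero_less_norm_iff)
  define a b where "a = max 0 (t - d / 2)" and "b = min T (t + d / 2)"
  have ab: "0 \<le> a" "a < b" "b \<le> T" using t d(1) T_pos by (auto simp: a_def b_def)
  have "AE s in M. indicat_real {a<..b} s = 0"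
    using eq AE_space
  proof eventually_elim
    fix s assume s: "c s = c' s" "s \<in> space M"
    have "dist s t < d" if "a < s" "s \<le> b" using that d(1) by (auto simp: a_def b_def dist_real_def)
    then have "\<not> (a < s \<and> s \<le> b)" using d(2)[of s] s by (auto simp: dist_norm norm_minus_commute)
    then show "indicat_real {a<..b} s = 0" by auto
  qed
  then have "(LINT s|M. indicat_real {a<..b} s) = 0" by (rule integral_eq_zero_AE)
  then show False using measure_segment[of a b] ab by simp
qed

lemma power2_sum_le: "(a + b :: real)\<^sup>2 \<le> 2 * a\<^sup>2 + 2 * b\<^sup>2"
  using sum_squares_ge_zero[of "a - b" 0] by (simp add: power2_eq_square algebra_simps)

locale gelfand_interval = time_interval T for T :: real +
  fixes j :: "'v::{real_inner,complete_space} \<Rightarrow>\<^sub>L 'h::{real_inner,complete_space}"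
  assumes gelfand: "gelfand_triple j"
begin

abbreviation J :: "'v \<Rightarrow> 'h" where "J \<equiv> blinfun_apply j"

abbreviation S :: "'v \<Rightarrow> 'v" where "S x \<equiv> adj_embed j (J x)"

abbreviation Y :: "(real \<Rightarrow> 'v) set" where "Y \<equiv> bochner_L2 M"

abbreviation L2_norm :: "(real \<Rightarrow> 'v) \<Rightarrow> real" where "L2_norm \<equiv> bochner_L2_norm M"

lemma J_eq_0_iff [simp]: "J x = 0 \<longleftrightarrow> x = 0"
  using gelfand injD[of J x 0] by (auto simp: gelfand_triple_def)

lemma adj_embed_eq_0_iff: "adj_embed j h = 0 \<longleftrightarrow> h = 0"
  using adj_embed_eq_0[of j h] gelfand linear_0[OF bounded_linear.linear[OF bounded_linear_adj_embed]]
  by (auto simp: gelfand_triple_def)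

lemma bounded_linear_J: "bounded_linear J"
  by (rule blinfun.bounded_linear_right)

lemma bounded_linear_S: "bounded_linear (\<lambda>x. S x)"
  by (rule bounded_linear_compose[OF bounded_linear_adj_embed bounded_linear_J])

lemma L2_J [intro, simp]: "u \<in> Y \<Longrightarrow> (\<lambda>t. J (u t)) \<in> bochner_L2 M"
  by (rule L2_bounded_linear[OF bounded_linear_J])

lemma L2_S [intro, simp]: "u \<in> Y \<Longrightarrow> (\<lambda>t. S (u t)) \<in> Y"
  by (rule L2_bounded_linear[OF bounded_linear_S])

lemma S_inner: "S x \<bullet> y = J x \<bullet> J y" "y \<bullet> S x = J x \<bullet> J y"
  by (simp_all add: adj_embed_inner inner_adj_embed)

lemma S_comb: "S (x + c *\<^sub>R y) = S x + c *\<^sub>R S y" "S (x - y) = S x - S y"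
  using linear_add[OF bounded_linear.linear[OF bounded_linear_S]]
    linear_scale[OF bounded_linear.linear[OF bounded_linear_S]]
    linear_diff[OF bounded_linear.linear[OF bounded_linear_S]] by auto

lemma L2_inner_S: "L2_inner M (\<lambda>t. S (u t)) v = L2_inner M (\<lambda>t. J (u t)) (\<lambda>t. J (v t))"
  "L2_inner M v (\<lambda>t. S (u t)) = L2_inner M (\<lambda>t. J (u t)) (\<lambda>t. J (v t))"
  by (simp_all add: L2_inner_def S_inner)

lemma primitive_S: "primitive_on T a p \<Longrightarrow> primitive_on T (\<lambda>t. S (a t)) (\<lambda>t. S (p t))"
  by (rule primitive_bounded_linear[OF bounded_linear_S])

text \<open>
  \<open>z\<close> is the time derivative of \<open>j' j u\<close>, with \<open>V'\<close> identified with \<open>V\<close>. The tests are all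
  primitives that vanish at both ends, a larger class than the test functions: it contains the
  functions that the variational problem produces, and the condition passes to limits at once.
\<close>

definition weak_pair :: "(real \<Rightarrow> 'v) \<Rightarrow> (real \<Rightarrow> 'v) \<Rightarrow> bool" where
  "weak_pair u z \<longleftrightarrow> u \<in> Y \<and> z \<in> Y \<and>
    (\<forall>d q. primitive_on T d q \<and> q 0 = 0 \<and> q T = 0 \<longrightarrow>
      L2_inner M (\<lambda>t. S (u t)) d + L2_inner M z q = 0)"

lemma weak_pairD:
  assumes "weak_pair u z"
  shows "u \<in> Y" "z \<in> Y"
    "primitive_on T d q \<Longrightarrow> q 0 = 0 \<Longrightarrow> q T = 0 \<Longrightarrow> L2_inner M (\<lambda>t. S (u t)) d + L2_inner M z q = 0"
  using assms by (auto simp: weak_pair_def)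

lemma primitive_weak_pair:
  assumes p: "primitive_on T a p"
  shows "weak_pair p (\<lambda>t. S (a t))"
  unfolding weak_pair_def
proof (intro conjI allI impI)
  show "p \<in> Y" "(\<lambda>t. S (a t)) \<in> Y" using primitive_in_L2[OF p] primitive_L2[OF p] by auto
  fix d q :: "real \<Rightarrow> 'v" assume q: "primitive_on T d q \<and> q 0 = 0 \<and> q T = 0"
  show "L2_inner M (\<lambda>t. S (p t)) d + L2_inner M (\<lambda>t. S (a t)) q = 0"
    using primitive_product_rule_L2[OF primitive_S[OF p] conjunct1[OF q]] q by simp
qed

subsection \<open>A variational problem with natural boundary conditions\<close>

text \<open>
  A weak equation without boundary conditions on the test functions: \<open>S y\<close> is a primitive of \<open>b\<close>
  and the values at both ends are the natural boundary conditions. Subtract the primitive of \<open>b\<close>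
  with the right initial value and integrate by parts; constant tests give the terminal value,
  and then the difference is orthogonal to every \<open>a\<close>, in particular to itself.
\<close>

lemma variational_problem:
  assumes y: "y \<in> Y" and b: "b \<in> Y"
    and eq: "\<And>a p. primitive_on T a p \<Longrightarrow>
      L2_inner M (\<lambda>t. S (y t)) a + L2_inner M b p + h0 \<bullet> J (p 0) + hT \<bullet> J (p T) = 0"
  obtains q where "primitive_on T b q" "AE t in M. q t = S (y t)" "q 0 = adj_embed j h0" "q T = - adj_embed j hT"
proof -
  obtain q where q: "primitive_on T b q" "q 0 = adj_embed j h0" by (rule primitive_exists[OF b])
  note qL = primitive_in_L2[OF q(1)]
  have red: "L2_inner M (\<lambda>t. S (y t) - q t) a + (q T + adj_embed j hT) \<bullet> p T = 0"
    if p: "primitive_on T a p" for a p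
    using eq[OF p] primitive_product_rule_L2[OF q(1) p] q(2) primitive_L2[OF p] y qL
    by (simp add: L2_inner_linear inner_add_left adj_embed_inner)
  have qT: "q T = - adj_embed j hT"
  proof -
    have "(q T + adj_embed j hT) \<bullet> x = 0 \<bullet> x" for x
      using red[OF primitive_const, of x] by (simp add: L2_inner_def)
    then have "q T + adj_embed j hT = 0" by (rule eq_if_inner_eq)
    then show ?thesis by (simp add: add_eq_0_iff)
  qed
  have d: "(\<lambda>t. S (y t) - q t) \<in> Y" using y qL by auto
  obtain p where "primitive_on T (\<lambda>t. S (y t) - q t) p" by (rule primitive_exists[OF d, of 0])
  from red[OF this] have "L2_norm (\<lambda>t. S (y t) - q t) = 0"
    by (simp add: qT flip: L2_norm_power2)
  then have "AE t in M. S (y t) - q t = 0" by (simp add: L2_norm_eq_0_iff[OF d])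
  then have "AE t in M. q t = S (y t)" by eventually_elim simp
  then show ?thesis using that q qT by blast
qed

lemma L2_inner_S_self_eq_0:
  assumes u: "u \<in> Y" and 0: "L2_inner M (\<lambda>t. S (u t)) u \<le> 0"
  shows "AE t in M. u t = 0"
proof -
  have "bochner_L2_norm M (\<lambda>t. J (u t)) = 0"
    using 0 by (simp add: L2_inner_S flip: L2_norm_power2)
  then show ?thesis using L2_norm_eq_0_iff[OF L2_J[OF u]] by simp
qed

lemma L2_inner_S_self_nonneg: "0 \<le> L2_inner M (\<lambda>t. S (u t)) u"
  by (simp add: L2_inner_S L2_inner_self_nonneg)

subsection \<open>Weak pairs and the space X\<close>

lemma weak_pair_test:
  assumes uz: "weak_pair u z" and \<phi>: "\<phi> \<in> test_functions T"
  shows "(LINT t|M. deriv \<phi> t * (J (u t) \<bullet> J x)) + (LINT t|M. \<phi> t * (z t \<bullet> x)) = 0"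
proof -
  have "\<phi> 0 = 0" "\<phi> T = 0" using test_function_props(4)[OF \<phi>] by auto
  then show ?thesis
    using weak_pairD(3)[OF uz test_function_primitive[OF \<phi>, of x]] by (simp add: L2_inner_def S_inner)
qed

lemma weak_pair_unique:
  assumes "weak_pair u z" "weak_pair u z'"
  shows "AE t in M. z t = z' t"
proof -
  note z = weak_pairD(2)[OF assms(1)] weak_pairD(2)[OF assms(2)]
  have "AE t in M. z t - z' t = 0"
  proof (rule L2_weakly_zero)
    show "(\<lambda>t. z t - z' t) \<in> Y" using z by (rule L2_diff)
    fix x
    have int: "integrable M (\<lambda>t. (z t - z' t) \<bullet> x)" using L2_diff[OF z] by (rule L2_integrable_inner_const)
    show "AE t in M. (z t - z' t) \<bullet> x = 0"
    proof (rule fundamental_lemma[OF int])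
      fix \<phi> assume \<phi>: "\<phi> \<in> test_functions T"
      have "\<phi> \<in> bochner_L2 M" using test_function_props(2)[OF \<phi>] by (intro continuous_L2) (rule continuous_on_subset, auto)
      then have "integrable M (\<lambda>t. \<phi> t * (z t \<bullet> x))" "integrable M (\<lambda>t. \<phi> t * (z' t \<bullet> x))"
        using L2_integrable_inner[of \<phi> "\<lambda>t. z t \<bullet> x"] L2_integrable_inner[of \<phi> "\<lambda>t. z' t \<bullet> x"]
          L2_bounded_linear[OF bounded_linear_inner_left] z by auto
      then show "(LINT t|M. \<phi> t * ((z t - z' t) \<bullet> x)) = 0"
        using weak_pair_test[OF assms(1) \<phi>, of x] weak_pair_test[OF assms(2) \<phi>, of x]
        by (simp add: inner_diff_left right_diff_distrib)
    qed
  qed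
  then show ?thesis by eventually_elim simp
qed

lemma weak_pair_cong_AE:
  assumes uz: "weak_pair u z" and u': "AE t in M. u t = u' t" and z': "AE t in M. z t = z' t"
  shows "weak_pair u' z'"
proof -
  note uzL = weak_pairD(1,2)[OF uz]
  have L: "u' \<in> Y" "z' \<in> Y" using L2_cong_AE uzL u' z' by blast+
  have "AE t in M. S (u t) = S (u' t)" using u' by eventually_elim simp
  then have "L2_inner M (\<lambda>t. S (u t)) d = L2_inner M (\<lambda>t. S (u' t)) d" if "d \<in> Y" for d
    using that uzL by (intro L2_inner_cong_AE) auto
  moreover have "L2_inner M z q = L2_inner M z' q" if "q \<in> Y" for q
    using that uzL z' by (intro L2_inner_cong_AE) auto
  ultimately show ?thesis
    unfolding weak_pair_def using L weak_pairD(3)[OF uz] primitive_L2 primitive_in_L2 by metis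
qed

text \<open>
  By the lemma of du Bois-Reymond, \<open>S w\<close> differs from the primitive of \<open>riesz \<circ> g\<close> by a function
  that is constant in every direction \<open>x\<close>; the constants fit together to the mean \<open>k\<close> of the
  difference. The product rule then admits all primitives as tests.
\<close>

lemma weak_derivative_weak_pair:
  assumes w: "w \<in> Y" and g: "g \<in> bochner_L2 M"
    and wd: "has_weak_derivative T (\<lambda>t. pivot_embed j (J (w t))) g"
  shows "weak_pair w (\<lambda>t. riesz (g t))"
proof -
  let ?z = "\<lambda>t. riesz (g t)"
  have z: "?z \<in> Y" by (rule L2_bounded_linear[OF bounded_linear_riesz g])
  obtain Q where Q: "primitive_on T ?z Q" "Q 0 = 0" by (rule primitive_exists[OF z])
  define D where "D t = S (w t) - Q t" for t
  have D: "D \<in> Y" unfolding D_def using w primitive_in_L2[OF Q(1)] by auto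
  obtain P where P: "primitive_on T D P" "P 0 = 0" by (rule primitive_exists[OF D])
  define k where "k = (1 / T) *\<^sub>R P T"
  have Dk: "(\<lambda>t. D t - k) \<in> Y" using D by auto
  have "AE t in M. D t - k = 0"
  proof (rule L2_weakly_zero[OF Dk])
    fix x
    have int: "integrable M (\<lambda>t. D t \<bullet> x)" by (rule L2_integrable_inner_const[OF D])
    obtain c where c: "AE t in M. D t \<bullet> x = c"
    proof (rule du_Bois_Reymond[OF int])
      fix \<phi> assume \<phi>: "\<phi> \<in> test_functions T"
      note pr = test_function_primitive[OF \<phi>, of x]
      obtain I where I: "has_strong_integral M (\<lambda>t. deriv \<phi> t *\<^sub>R pivot_embed j (J (w t))) I"
        and I': "has_strong_integral M (\<lambda>t. \<phi> t *\<^sub>R g t) (- I)"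
        using wd \<phi> by (auto simp: has_weak_derivative_def)
      have "(LINT t|M. deriv \<phi> t * (J (w t) \<bullet> J x)) = blinfun_apply I x"
        using has_strong_integral_functional[OF I blinfun.bounded_linear_left[of x] complete_finite_measure_time]
        by (simp add: has_bochner_integral_integral_eq blinfun.scaleR_left pivot_embed_apply)
      moreover have "(LINT t|M. \<phi> t * (?z t \<bullet> x)) = - blinfun_apply I x"
        using has_strong_integral_functional[OF I' blinfun.bounded_linear_left[of x] complete_finite_measure_time]
        by (simp add: has_bochner_integral_integral_eq blinfun.scaleR_left blinfun.minus_left riesz_inner)
      ultimately have "L2_inner M (\<lambda>t. S (w t)) (\<lambda>t. deriv \<phi> t *\<^sub>R x) + L2_inner M ?z (\<lambda>t. \<phi> t *\<^sub>R x) = 0"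
        by (simp add: L2_inner_def S_inner)
      moreover have "L2_inner M ?z (\<lambda>t. \<phi> t *\<^sub>R x) + L2_inner M Q (\<lambda>t. deriv \<phi> t *\<^sub>R x) = 0"
        using primitive_product_rule_L2[OF Q(1) pr] test_function_props(4)[OF \<phi>] by simp
      ultimately have "L2_inner M D (\<lambda>t. deriv \<phi> t *\<^sub>R x) = 0"
        unfolding D_def using w primitive_in_L2[OF Q(1)] primitive_L2[OF pr] by (simp add: L2_inner_linear)
      then show "(LINT t|M. deriv \<phi> t * (D t \<bullet> x)) = 0" by (simp add: L2_inner_def)
    qed
    have "P T \<bullet> x = (LINT t|M. D t \<bullet> x)"
      using primitive_increment[OF P(1), of 0 T x] P(2) T_pos by (simp add: seg_full)
    also have "\<dots> = (LINT t|M. c)" using c int by (intro integral_cong_AE) auto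
    also have "\<dots> = T * c" using T_pos by (simp add: measure_restrict_space)
    finally have "k \<bullet> x = c" using T_pos by (simp add: k_def)
    then show "AE t in M. (D t - k) \<bullet> x = 0" using c by (auto simp: inner_diff_left)
  qed
  then have eq: "AE t in M. S (w t) = Q t + k" by eventually_elim (simp add: D_def algebra_simps)
  show ?thesis
    unfolding weak_pair_def
  proof (intro conjI w z allI impI)
    fix d q :: "real \<Rightarrow> 'v" assume q: "primitive_on T d q \<and> q 0 = 0 \<and> q T = 0"
    have "L2_inner M (\<lambda>t. S (w t)) d = L2_inner M (\<lambda>t. Q t + k) d"
      using eq w primitive_L2[OF conjunct1[OF q]] by (intro L2_inner_cong_AE) auto
    then show "L2_inner M (\<lambda>t. S (w t)) d + L2_inner M ?z q = 0"
      using primitive_product_rule_L2[OF primitive_shift[OF Q(1)] conjunct1[OF q], of k] q by simp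
  qed
qed

text \<open>
  The converse of the preceding lemma: a test function times a vector is a primitive that
  vanishes at both ends.
\<close>

lemma weak_pair_weak_derivative:
  assumes uz: "weak_pair u z"
  shows "(\<lambda>t. pivot_embed j (J (u t))) \<in> bochner_L2 M" and "(\<lambda>t. blinfun_inner_left (z t)) \<in> bochner_L2 M"
    and "has_weak_derivative T (\<lambda>t. pivot_embed j (J (u t))) (\<lambda>t. blinfun_inner_left (z t))"
proof -
  note uzL = weak_pairD(1,2)[OF uz]
  show u: "(\<lambda>t. pivot_embed j (J (u t))) \<in> bochner_L2 M"
    using L2_bounded_linear[OF bounded_linear_pivot_embed L2_J[OF uzL(1)]] .
  show z: "(\<lambda>t. blinfun_inner_left (z t)) \<in> bochner_L2 M"
    using L2_bounded_linear[OF bounded_linear_blinfun_inner_left uzL(2)] .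
  have mult: "(\<lambda>t. f t *\<^sub>R g t) \<in> bochner_L2 M"
    if f: "continuous_on UNIV f" and g: "g \<in> bochner_L2 M" for f :: "real \<Rightarrow> real" and g :: "real \<Rightarrow> 'v \<Rightarrow>\<^sub>L real"
  proof -
    have "compact (f ` {0..T})" by (rule compact_continuous_image[OF continuous_on_subset[OF f]]) auto
    then obtain C where C: "\<And>y. y \<in> f ` {0..T} \<Longrightarrow> norm y \<le> C"
      using compact_imp_bounded bounded_iff by metis
    show ?thesis
    proof (rule L2_dominated[OF g, where C = C])
      show "strongly_measurable M (\<lambda>t. f t *\<^sub>R g t)"
        using f g by (intro strongly_measurable_scaleR strongly_measurable_borel borel_measurable_M
            borel_measurable_continuous_onI L2_strongly_measurable)
      show "AE t in M. norm (f t *\<^sub>R g t) \<le> C * norm (g t)"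
        by (rule AE_I2) (use C in \<open>auto intro!: mult_right_mono\<close>)
    qed
  qed
  show "has_weak_derivative T (\<lambda>t. pivot_embed j (J (u t))) (\<lambda>t. blinfun_inner_left (z t))"
    unfolding has_weak_derivative_def
  proof
    fix \<phi> assume \<phi>: "\<phi> \<in> test_functions T"
    obtain I where I: "has_strong_integral M (\<lambda>t. deriv \<phi> t *\<^sub>R pivot_embed j (J (u t))) I"
      by (rule L2_has_strong_integral[OF mult[OF test_function_props(3)[OF \<phi>] u]])
    have "has_strong_integral M (\<lambda>t. \<phi> t *\<^sub>R blinfun_inner_left (z t)) (- I)"
    proof (rule has_strong_integral_blinfunI[OF mult[OF test_function_props(2)[OF \<phi>] z]])
      fix x
      have "(LINT t|M. deriv \<phi> t * (J (u t) \<bullet> J x)) = blinfun_apply I x"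
        using has_strong_integral_functional[OF I blinfun.bounded_linear_left[of x] complete_finite_measure_time]
        by (simp add: has_bochner_integral_integral_eq blinfun.scaleR_left pivot_embed_apply)
      then show "(LINT t|M. blinfun_apply (\<phi> t *\<^sub>R blinfun_inner_left (z t)) x) = blinfun_apply (- I) x"
        using weak_pair_test[OF uz \<phi>, of x] by (simp add: blinfun.scaleR_left blinfun.minus_left inner_commute)
    qed
    with I show "\<exists>I. has_strong_integral M (\<lambda>t. deriv \<phi> t *\<^sub>R pivot_embed j (J (u t))) I \<and>
        has_strong_integral M (\<lambda>t. \<phi> t *\<^sub>R blinfun_inner_left (z t)) (- I)" by blast
  qed
qed

text \<open>
  The time derivative of an element of \<open>X\<close>, with \<open>V'\<close> identified with \<open>V\<close>.
\<close>

definition rate :: "(real \<Rightarrow> 'v) \<Rightarrow> real \<Rightarrow> 'v" where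
  "rate w t = riesz (weak_derivative T (\<lambda>s. pivot_embed j (J (w s))) t)"

lemma d_t_eq_rate: "d_t T j w v = L2_inner M (rate w) v"
  by (simp add: d_t_def rate_def L2_inner_def riesz_inner)

lemma X_weak_pair:
  assumes "w \<in> X_space T j"
  shows "weak_pair w (rate w)"
proof -
  let ?f = "\<lambda>s. pivot_embed j (J (w s))"
  have "\<exists>g. g \<in> bochner_L2 M \<and> has_weak_derivative T ?f g"
    using assms by (auto simp: X_space_def bochner_H1_def)
  from someI_ex[OF this] show ?thesis
    using assms weak_derivative_weak_pair unfolding rate_def weak_derivative_def by (auto simp: X_space_def)
qed

lemma weak_pair_X:
  assumes "weak_pair u z"
  shows "u \<in> X_space T j" and "AE t in M. rate u t = z t"
proof -
  show X: "u \<in> X_space T j"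
    using weak_pair_weak_derivative[OF assms] weak_pairD(1)[OF assms]
    by (auto simp: X_space_def bochner_H1_def)
  show "AE t in M. rate u t = z t" by (rule weak_pair_unique[OF X_weak_pair[OF X] assms])
qed

subsection \<open>Density of the regular pairs\<close>

lemma weak_pair_limit:
  assumes p: "\<And>n. primitive_on T (a n) (p n)" and u: "u \<in> Y" and z: "z \<in> Y"
    and pu: "(\<lambda>n. L2_norm (\<lambda>t. p n t - u t)) \<longlonglongrightarrow> 0"
    and az: "(\<lambda>n. L2_norm (\<lambda>t. S (a n t) - z t)) \<longlonglongrightarrow> 0"
  shows "weak_pair u z"
  unfolding weak_pair_def
proof (intro conjI u z allI impI)
  fix d q :: "real \<Rightarrow> 'v" assume q: "primitive_on T d q \<and> q 0 = 0 \<and> q T = 0"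
  note dq = primitive_L2[OF conjunct1[OF q]] primitive_in_L2[OF conjunct1[OF q]]
  have const: "(\<lambda>n. L2_norm (\<lambda>t. f t - f t)) \<longlonglongrightarrow> 0" for f by (simp add: bochner_L2_norm_def)
  have Sp: "(\<lambda>n. L2_norm (\<lambda>t. S (p n t) - S (u t))) \<longlonglongrightarrow> 0"
    by (rule L2_tendsto_bounded_linear[OF bounded_linear_S primitive_in_L2[OF p] u pu])
  have "(\<lambda>n. L2_inner M (\<lambda>t. S (p n t)) d + L2_inner M (\<lambda>t. S (a n t)) q)
      \<longlonglongrightarrow> L2_inner M (\<lambda>t. S (u t)) d + L2_inner M z q"
    using Sp az const u z dq primitive_in_L2[OF p] primitive_L2[OF p]
    by (intro tendsto_add L2_inner_tendsto) auto
  moreover have "L2_inner M (\<lambda>t. S (p n t)) d + L2_inner M (\<lambda>t. S (a n t)) q = 0" for n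
    using weak_pairD(3)[OF primitive_weak_pair[OF p]] q by blast
  ultimately show "L2_inner M (\<lambda>t. S (u t)) d + L2_inner M z q = 0" by (simp add: LIMSEQ_const_iff)
qed

lemma L2_Cauchy_from_power2:
  assumes p: "\<And>n::nat. p n \<in> Y"
    and cauchy: "\<And>e. 0 < e \<Longrightarrow> \<exists>N. \<forall>m\<ge>N. \<forall>n\<ge>N. (L2_norm (\<lambda>t. p m t - p n t))\<^sup>2 < e"
  obtains u where "u \<in> Y" "(\<lambda>n. L2_norm (\<lambda>t. p n t - u t)) \<longlonglongrightarrow> 0"
proof -
  have "\<exists>N. \<forall>m\<ge>N. \<forall>n\<ge>N. L2_norm (\<lambda>t. p m t - p n t) < e" if "0 < e" for e
    using cauchy[of "e\<^sup>2"] that power2_less_imp_less[of "L2_norm _" e] by simp blast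
  then show ?thesis using that by (rule L2_complete[OF p])
qed

abbreviation (input) pair_comb ::
    "real \<Rightarrow> (real \<Rightarrow> 'v) \<times> (real \<Rightarrow> 'v) \<Rightarrow> (real \<Rightarrow> 'v) \<times> (real \<Rightarrow> 'v) \<Rightarrow> (real \<Rightarrow> 'v) \<times> (real \<Rightarrow> 'v)" where
  "pair_comb c P Q \<equiv> (\<lambda>t. fst P t + c *\<^sub>R fst Q t, \<lambda>t. snd P t + c *\<^sub>R snd Q t)"

text \<open>
  Functions with a square integrable time derivative in \<open>V\<close>, paired with it. They play the part
  of smooth functions.
\<close>

definition regular_pairs :: "((real \<Rightarrow> 'v) \<times> (real \<Rightarrow> 'v)) set" where
  "regular_pairs = {P. primitive_on T (snd P) (fst P)}"

lemma regular_pairs_L2: "P \<in> regular_pairs \<Longrightarrow> fst P \<in> Y" "P \<in> regular_pairs \<Longrightarrow> snd P \<in> Y"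
  by (auto simp: regular_pairs_def primitive_L2 primitive_in_L2)

lemma regular_pairs_comb: "P \<in> regular_pairs \<Longrightarrow> Q \<in> regular_pairs \<Longrightarrow> pair_comb c P Q \<in> regular_pairs"
  by (simp add: regular_pairs_def primitive_comb)

lemma regular_pairs_nonempty: "regular_pairs \<noteq> {}"
  using primitive_const[of 0] by (auto simp: regular_pairs_def)

text \<open>
  Let \<open>(d, e)\<close> be the part of \<open>(u, z)\<close> that is orthogonal to the regular pairs in the norm of
  \<open>X\<close>. By the variational problem, \<open>d\<close> has a primitive \<open>q = S e\<close> that vanishes at both ends.
  Hence \<open>q\<close> is admissible as a test for \<open>(d, e)\<close>, which gives \<open>\<integral> d \<bullet> S d + e \<bullet> S e = 0\<close>; both
  vanish because \<open>S\<close> is positive and injective.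
\<close>

theorem regular_pairs_dense:
  assumes uz: "weak_pair u z"
  obtains a p where "\<And>n::nat. primitive_on T (a n) (p n)"
    "(\<lambda>n. L2_norm (\<lambda>t. p n t - u t)) \<longlonglongrightarrow> 0" "(\<lambda>n. L2_norm (\<lambda>t. S (a n t) - z t)) \<longlonglongrightarrow> 0"
proof -
  note uzL = weak_pairD(1,2)[OF uz]
  define ip where "ip P Q = L2_inner M (fst P) (fst Q) + L2_inner M (\<lambda>t. S (snd P t)) (\<lambda>t. S (snd Q t))"
    for P Q :: "(real \<Rightarrow> 'v) \<times> (real \<Rightarrow> 'v)"
  define L where "L P = L2_inner M u (fst P) + L2_inner M z (\<lambda>t. S (snd P t))"
    for P :: "(real \<Rightarrow> 'v) \<times> (real \<Rightarrow> 'v)"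
  have ip_self: "ip P P = (L2_norm (fst P))\<^sup>2 + (L2_norm (\<lambda>t. S (snd P t)))\<^sup>2" for P
    by (simp add: ip_def L2_norm_power2)
  obtain P where P: "\<And>n::nat. P n \<in> regular_pairs"
    and cauchy: "\<And>e. 0 < e \<Longrightarrow>
      \<exists>N. \<forall>m\<ge>N. \<forall>n\<ge>N. ip (pair_comb (-1) (P m) (P n)) (pair_comb (-1) (P m) (P n)) < e"
    and lim: "\<And>Q. Q \<in> regular_pairs \<Longrightarrow> (\<lambda>n. ip (P n) Q) \<longlonglongrightarrow> L Q"
  proof (rule minimizing_sequence_represents_functional
      [where S = regular_pairs and ip = ip and L = L and comb = pair_comb and C = "2 * (L2_norm u)\<^sup>2 + 2 * (L2_norm z)\<^sup>2"])
    fix P Q R c assume PQ: "P \<in> regular_pairs" "Q \<in> regular_pairs"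
    show "L (pair_comb c P Q) = L P + c * L Q"
      using regular_pairs_L2[OF PQ(1)] regular_pairs_L2[OF PQ(2)] uzL
      by (simp add: L_def S_comb L2_inner_linear algebra_simps)
    show "ip (pair_comb c P Q) R = ip P R + c * ip Q R" if R: "R \<in> regular_pairs"
      using regular_pairs_L2[OF PQ(1)] regular_pairs_L2[OF PQ(2)] regular_pairs_L2[OF R]
      by (simp add: ip_def S_comb L2_inner_linear algebra_simps)
  next
    fix P assume P: "P \<in> regular_pairs"
    let ?p = "L2_norm (fst P)" and ?a = "L2_norm (\<lambda>t. S (snd P t))"
    have "\<bar>L P\<bar> \<le> L2_norm u * ?p + L2_norm z * ?a"
      using L2_Cauchy_Schwarz[OF uzL(1) regular_pairs_L2(1)[OF P]]
        L2_Cauchy_Schwarz[OF uzL(2) L2_S[OF regular_pairs_L2(2)[OF P]]] by (simp add: L_def)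
    then have "(L P)\<^sup>2 \<le> (L2_norm u * ?p + L2_norm z * ?a)\<^sup>2" by (metis abs_ge_zero power2_abs power_mono)
    also have "\<dots> \<le> 2 * (L2_norm u * ?p)\<^sup>2 + 2 * (L2_norm z * ?a)\<^sup>2" by (rule power2_sum_le)
    also have "\<dots> \<le> (2 * (L2_norm u)\<^sup>2 + 2 * (L2_norm z)\<^sup>2) * ip P P"
      by (simp add: ip_self power_mult_distrib algebra_simps)
    finally show "(L P)\<^sup>2 \<le> (2 * (L2_norm u)\<^sup>2 + 2 * (L2_norm z)\<^sup>2) * ip P P" .
  qed (auto simp: regular_pairs_nonempty regular_pairs_comb ip_self, simp add: ip_def L2_inner_commute)
  have PL: "fst (P n) \<in> Y" "(\<lambda>t. S (snd (P n) t)) \<in> Y" for n using regular_pairs_L2[OF P] by auto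
  have cauchy': "\<exists>N. \<forall>m\<ge>N. \<forall>n\<ge>N. (L2_norm (\<lambda>t. fst (P m) t - fst (P n) t))\<^sup>2
      + (L2_norm (\<lambda>t. S (snd (P m) t) - S (snd (P n) t)))\<^sup>2 < e" if "0 < e" for e
    using cauchy[OF that] by (simp add: ip_self S_comb)
  obtain u' where u': "u' \<in> Y" "(\<lambda>n. L2_norm (\<lambda>t. fst (P n) t - u' t)) \<longlonglongrightarrow> 0"
  proof (rule L2_Cauchy_from_power2[of "\<lambda>n. fst (P n)"])
    show "\<exists>N. \<forall>m\<ge>N. \<forall>n\<ge>N. (L2_norm (\<lambda>t. fst (P m) t - fst (P n) t))\<^sup>2 < e" if "0 < e" for e
      using cauchy'[OF that] by (smt (verit) zero_le_power2)
  qed (use PL in auto)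
  obtain z' where z': "z' \<in> Y" "(\<lambda>n. L2_norm (\<lambda>t. S (snd (P n) t) - z' t)) \<longlonglongrightarrow> 0"
  proof (rule L2_Cauchy_from_power2[of "\<lambda>n t. S (snd (P n) t)"])
    show "\<exists>N. \<forall>m\<ge>N. \<forall>n\<ge>N. (L2_norm (\<lambda>t. S (snd (P m) t) - S (snd (P n) t)))\<^sup>2 < e" if "0 < e" for e
      using cauchy'[OF that] by (smt (verit) zero_le_power2)
  qed (use PL in auto)
  define d e where "d t = u t - u' t" and "e t = z t - z' t" for t
  have de: "d \<in> Y" "e \<in> Y" using uzL u'(1) z'(1) by (auto simp: d_def[abs_def] e_def[abs_def])
  have const: "(\<lambda>n. L2_norm (\<lambda>t. f t - f t)) \<longlonglongrightarrow> 0" for f by (simp add: bochner_L2_norm_def)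
  have orth: "L2_inner M (\<lambda>t. S (e t)) a + L2_inner M d p = 0" if p: "primitive_on T a p" for a p
  proof -
    note pL = primitive_L2[OF p] primitive_in_L2[OF p]
    have "(\<lambda>n. ip (P n) (p, a)) \<longlonglongrightarrow> L2_inner M u' p + L2_inner M z' (\<lambda>t. S (a t))"
      unfolding ip_def using PL u' z' pL const by (auto intro!: tendsto_add L2_inner_tendsto)
    moreover have "(\<lambda>n. ip (P n) (p, a)) \<longlonglongrightarrow> L (p, a)" using p by (intro lim) (simp add: regular_pairs_def)
    ultimately have "L2_inner M u' p + L2_inner M z' (\<lambda>t. S (a t)) = L2_inner M u p + L2_inner M z (\<lambda>t. S (a t))"
      using LIMSEQ_unique by (fastforce simp: L_def)
    then have "L2_inner M d p + L2_inner M e (\<lambda>t. S (a t)) = 0"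
      unfolding d_def e_def using uzL u'(1) z'(1) pL by (simp add: L2_inner_linear)
    then show ?thesis by (simp add: L2_inner_S L2_inner_commute)
  qed
  obtain q where "primitive_on T d q" "AE t in M. q t = S (e t)" "q 0 = adj_embed j 0" "q T = - adj_embed j 0"
    by (rule variational_problem[OF de(2,1), of 0 0]) (use orth in simp)
  then have q: "primitive_on T d q" "AE t in M. q t = S (e t)" "q 0 = 0" "q T = 0"
    using adj_embed_eq_0_iff[of 0] by simp_all
  note qL = primitive_in_L2[OF q(1)]
  have "weak_pair u' z'"
    using P by (intro weak_pair_limit[OF _ u'(1) z'(1) u'(2) z'(2)]) (simp add: regular_pairs_def)
  from weak_pairD(3)[OF this q(1,3,4)] weak_pairD(3)[OF uz q(1,3,4)]
  have "L2_inner M (\<lambda>t. S (d t)) d + L2_inner M e q = 0"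
    unfolding d_def[of _] e_def[of _] S_comb using uzL u'(1) z'(1) qL de by (simp add: L2_inner_linear d_def[symmetric])
  moreover have "L2_inner M e q = L2_inner M e (\<lambda>t. S (e t))"
    using de q(2) qL by (intro L2_inner_cong_AE) auto
  ultimately have "L2_inner M (\<lambda>t. S (d t)) d + L2_inner M (\<lambda>t. S (e t)) e = 0"
    by (simp add: L2_inner_commute)
  then have "AE t in M. d t = 0" "AE t in M. e t = 0"
    using L2_inner_S_self_nonneg[of d] L2_inner_S_self_nonneg[of e]
    by (auto intro!: L2_inner_S_self_eq_0 de)
  then have ue: "AE t in M. u' t = u t" and ze: "AE t in M. z' t = z t"
    by (auto simp: d_def e_def)
  have "L2_norm (\<lambda>t. fst (P n) t - u' t) = L2_norm (\<lambda>t. fst (P n) t - u t)" for n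
    using PL u'(1) ue by (intro L2_norm_cong_AE) (auto elim: eventually_mono)
  moreover have "L2_norm (\<lambda>t. S (snd (P n) t) - z' t) = L2_norm (\<lambda>t. S (snd (P n) t) - z t)" for n
    using PL z'(1) ze by (intro L2_norm_cong_AE) (auto elim: eventually_mono)
  ultimately show ?thesis
    using that[of "\<lambda>n. snd (P n)" "\<lambda>n. fst (P n)"] P u'(2) z'(2) by (simp add: regular_pairs_def)
qed

subsection \<open>The trace\<close>

text \<open>
  The norm of \<open>X\<close> controls the supremum in \<open>H\<close>: compare the value at \<open>t\<close> with the value at \<open>s\<close>
  by the product rule and average over \<open>s\<close>.
\<close>

lemma primitive_sup_bound:
  assumes p: "primitive_on T a p" and t: "t \<in> {0..T}"
  shows "T * (norm (J (p t)))\<^sup>2 \<le> (bochner_L2_norm M (\<lambda>t. J (p t)))\<^sup>2 + 2 * T * (L2_norm p * L2_norm (\<lambda>t. S (a t)))"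
proof -
  note pL = primitive_in_L2[OF p] and aL = primitive_L2[OF p]
  let ?c = "L2_norm p * L2_norm (\<lambda>t. S (a t))"
  define g where "g r = norm (p r) * norm (S (a r))" for r
  have g0: "0 \<le> g r" for r by (simp add: g_def)
  have nL: "(\<lambda>r. norm (f r)) \<in> bochner_L2 M" if "f \<in> Y" for f
    using that by (simp add: bochner_L2_def strongly_measurable_norm)
  have g: "integrable M g" and g_le: "integral\<^sup>L M g \<le> ?c"
    using L2_integrable_inner[OF nL[OF pL] nL[OF L2_S[OF aL]]] L2_Cauchy_Schwarz[OF nL[OF pL] nL[OF L2_S[OF aL]]]
    by (simp_all add: g_def[abs_def] L2_inner_def bochner_L2_norm_def)
  have point: "(norm (J (p t)))\<^sup>2 - 2 * ?c \<le> (norm (J (p s)))\<^sup>2" if s: "s \<in> {0..T}" for s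
  proof -
    define f where "f r = a r \<bullet> S (p r) + p r \<bullet> S (a r)" for r
    have f: "integrable M f"
      unfolding f_def using L2_integrable_inner[OF aL L2_S[OF pL]] L2_integrable_inner[OF pL L2_S[OF aL]] by simp
    have f_le: "\<bar>f r\<bar> \<le> 2 * g r" for r
      using Cauchy_Schwarz_ineq2[of "p r" "S (a r)"] by (simp add: f_def g_def S_inner inner_commute)
    have rule: "(norm (J (p r)))\<^sup>2 - (norm (J (p 0)))\<^sup>2 = seg T 0 r f" if "r \<in> {0..T}" for r
      using primitive_product_rule[OF p primitive_S[OF p] that] by (simp add: f_def[abs_def] S_inner dot_square_norm)
    have "\<bar>seg T s' t' f\<bar> \<le> 2 * ?c" for s' t'
    proof -
      have "\<bar>seg T s' t' f\<bar> \<le> seg T s' t' (\<lambda>r. 2 * g r)" using f g f_le by (intro seg_abs_le) auto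
      also have "\<dots> \<le> integral\<^sup>L M (\<lambda>r. 2 * g r)" using g g0 by (intro seg_le_full) simp_all
      finally show ?thesis using g_le by simp
    qed
    then have "seg T 0 t f - seg T 0 s f \<le> 2 * ?c"
      using seg_split[OF f, of 0 s t] seg_split[OF f, of 0 t s] s t by (cases "s \<le> t") (auto simp: abs_le_iff)
    then show ?thesis using rule[OF t] rule[OF s] by simp
  qed
  have "(LINT s|M. (norm (J (p t)))\<^sup>2 - 2 * ?c) \<le> (LINT s|M. (norm (J (p s)))\<^sup>2)"
  proof (rule integral_mono)
    show "integrable M (\<lambda>s. (norm (J (p s)))\<^sup>2)" by (rule L2_integrable_norm2[OF L2_J[OF pL]])
  qed (use point in auto)
  then show ?thesis
    using T_pos by (simp add: bochner_L2_norm_def measure_restrict_space algebra_simps)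
qed

lemma continuous_rep_eq:
  assumes "continuous_on {0..T} c" "AE t in M. c t = J (u t)" "t \<in> {0..T}"
  shows "trace_at T j t u = c t"
proof -
  have "\<exists>c. continuous_on {0..T} c \<and> (AE t in M. c t = J (u t))" using assms by blast
  from someI_ex[OF this] have r: "continuous_on {0..T} (continuous_rep T j u)"
    "AE t in M. continuous_rep T j u t = J (u t)"
    by (simp_all add: continuous_rep_def)
  have "AE t in M. continuous_rep T j u t = c t" using r(2) assms(2) by eventually_elim simp
  from continuous_eq_AE[OF r(1) assms(1) this assms(3)] show ?thesis by (simp add: trace_at_def)
qed

text \<open>
  By the supremum bound, approximating regular functions converge uniformly in \<open>H\<close>. Their limit
  is continuous, hence is the representative that defines the trace.
\<close>

theorem trace_limit:
  assumes p: "\<And>n. primitive_on T (a n) (p n)" and u: "u \<in> Y" and z: "z \<in> Y"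
    and pu: "(\<lambda>n. L2_norm (\<lambda>t. p n t - u t)) \<longlonglongrightarrow> 0"
    and az: "(\<lambda>n. L2_norm (\<lambda>t. S (a n t) - z t)) \<longlonglongrightarrow> 0"
  shows "continuous_on {0..T} (\<lambda>t. trace_at T j t u)" "AE t in M. trace_at T j t u = J (u t)"
    and "t \<in> {0..T} \<Longrightarrow> (\<lambda>n. J (p n t)) \<longlonglongrightarrow> trace_at T j t u"
proof -
  note pL = primitive_in_L2[OF p] and aL = primitive_L2[OF p]
  have Jpu: "(\<lambda>n. bochner_L2_norm M (\<lambda>t. J (p n t) - J (u t))) \<longlonglongrightarrow> 0"
    by (rule L2_tendsto_bounded_linear[OF bounded_linear_J pL u pu])
  define e where "e n = L2_norm (\<lambda>t. p n t - u t) + L2_norm (\<lambda>t. S (a n t) - z t)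
    + bochner_L2_norm M (\<lambda>t. J (p n t) - J (u t))" for n
  have e: "e \<longlonglongrightarrow> 0" unfolding e_def using pu az Jpu by (auto intro!: tendsto_eq_intros)
  have e0: "0 \<le> e n" for n by (simp add: e_def)
  have bound: "T * (norm (J (p m t) - J (p n t)))\<^sup>2 \<le> (1 + 2 * T) * (e m + e n)\<^sup>2"
    if t: "t \<in> {0..T}" for m n t
  proof -
    have pr: "primitive_on T (\<lambda>t. a m t - a n t) (\<lambda>t. p m t - p n t)"
      using primitive_comb[OF p[of m] p[of n], of "-1"] by simp
    have 1: "L2_norm (\<lambda>t. p m t - p n t) \<le> e m + e n"
      using L2_norm_triangle_diff[OF pL u pL, of m n] L2_norm_nonneg[of M]
      unfolding e_def L2_norm_minus_commute[of u] by (smt (verit))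
    have 2: "L2_norm (\<lambda>t. S (a m t - a n t)) \<le> e m + e n"
      unfolding S_comb(2)
      using L2_norm_triangle_diff[OF L2_S[OF aL] z L2_S[OF aL], of m n] L2_norm_nonneg[of M]
      unfolding e_def L2_norm_minus_commute[of z] by (smt (verit))
    have 3: "bochner_L2_norm M (\<lambda>t. J (p m t - p n t)) \<le> e m + e n"
      unfolding blinfun.diff_right
      using L2_norm_triangle_diff[OF L2_J[OF pL] L2_J[OF u] L2_J[OF pL], of m n] L2_norm_nonneg[of M]
      unfolding e_def L2_norm_minus_commute[of "\<lambda>t. J (u t)"] by (smt (verit))
    have "T * (norm (J (p m t - p n t)))\<^sup>2 \<le> (bochner_L2_norm M (\<lambda>t. J (p m t - p n t)))\<^sup>2
        + 2 * T * (L2_norm (\<lambda>t. p m t - p n t) * L2_norm (\<lambda>t. S (a m t - a n t)))"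
      by (rule primitive_sup_bound[OF pr t])
    also have "\<dots> \<le> (e m + e n)\<^sup>2 + 2 * T * ((e m + e n) * (e m + e n))"
      using 1 2 3 T_pos e0[of m] e0[of n]
      by (intro add_mono power_mono mult_left_mono mult_mono) auto
    finally show ?thesis by (simp add: blinfun.diff_right power2_eq_square algebra_simps)
  qed
  have "uniformly_Cauchy_on {0..T} (\<lambda>n t. J (p n t))"
  proof (rule uniformly_Cauchy_onI)
    fix \<delta> :: real assume \<delta>: "0 < \<delta>"
    define \<eta> where "\<eta> = sqrt (T * \<delta>\<^sup>2 / (1 + 2 * T)) / 2"
    have \<eta>: "0 < \<eta>" using \<delta> T_pos by (simp add: \<eta>_def)
    obtain N where N: "\<And>n. N \<le> n \<Longrightarrow> e n < \<eta>"
      using order_tendstoD(2)[OF e \<eta>] by (auto simp: eventually_sequentially)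
    show "\<exists>N. \<forall>t\<in>{0..T}. \<forall>m\<ge>N. \<forall>n\<ge>N. dist (J (p m t)) (J (p n t)) < \<delta>"
    proof (intro exI[of _ N] ballI allI impI)
      fix t m n assume t: "t \<in> {0..T}" and mn: "N \<le> m" "N \<le> n"
      have "e m + e n < 2 * \<eta>" using N[OF mn(1)] N[OF mn(2)] by simp
      then have "(e m + e n)\<^sup>2 < (2 * \<eta>)\<^sup>2" using e0[of m] e0[of n] by (intro power_strict_mono) auto
      then have "(1 + 2 * T) * (e m + e n)\<^sup>2 < (1 + 2 * T) * (2 * \<eta>)\<^sup>2"
        using T_pos by (intro mult_strict_left_mono) auto
      also have "\<dots> = T * \<delta>\<^sup>2" using T_pos by (simp add: \<eta>_def)
      finally have "T * (norm (J (p m t) - J (p n t)))\<^sup>2 < T * \<delta>\<^sup>2"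
        using bound[OF t, of m n] by simp
      then have "(norm (J (p m t) - J (p n t)))\<^sup>2 < \<delta>\<^sup>2" using T_pos by simp
      then show "dist (J (p m t)) (J (p n t)) < \<delta>"
        using \<delta> power2_less_imp_less[of _ \<delta>] by (simp add: dist_norm)
    qed
  qed
  then obtain c where c: "uniform_limit {0..T} (\<lambda>n t. J (p n t)) c sequentially"
    unfolding uniformly_convergent_eq_Cauchy[symmetric] uniformly_convergent_on_def by blast
  have cont: "continuous_on {0..T} c"
  proof (rule uniform_limit_theorem[OF _ c])
    show "\<forall>\<^sub>F n in sequentially. continuous_on {0..T} (\<lambda>t. J (p n t))"
      by (intro always_eventually allI bounded_linear.continuous_on[OF bounded_linear_J primitive_continuous[OF p]])
  qed simp
  have cL: "c \<in> bochner_L2 M" by (rule continuous_L2[OF cont])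
  have cp: "(\<lambda>n. bochner_L2_norm M (\<lambda>t. c t - J (p n t))) \<longlonglongrightarrow> 0"
  proof (rule LIMSEQ_I)
    fix \<delta> :: real assume \<delta>: "0 < \<delta>"
    define \<eta> where "\<eta> = \<delta> / (2 * sqrt T)"
    have \<eta>: "0 < \<eta>" using \<delta> T_pos by (simp add: \<eta>_def)
    obtain N where N: "\<And>n t. N \<le> n \<Longrightarrow> t \<in> {0..T} \<Longrightarrow> dist (J (p n t)) (c t) < \<eta>"
      using c \<eta> unfolding uniform_limit_sequentially_iff by blast
    have "bochner_L2_norm M (\<lambda>t. c t - J (p n t)) < \<delta>" if n: "N \<le> n" for n
    proof -
      have "(LINT t|M. (norm (c t - J (p n t)))\<^sup>2) \<le> (LINT t|M. \<eta>\<^sup>2)"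
      proof (rule integral_mono)
        show "integrable M (\<lambda>t. (norm (c t - J (p n t)))\<^sup>2)"
          by (rule L2_integrable_norm2[OF L2_diff[OF cL L2_J[OF pL]]])
        show "(norm (c t - J (p n t)))\<^sup>2 \<le> \<eta>\<^sup>2" if "t \<in> space M" for t
          using N[OF n, of t] that by (intro power_mono) (auto simp: dist_norm norm_minus_commute)
      qed simp
      also have "\<dots> = T * \<eta>\<^sup>2" using T_pos by (simp add: measure_restrict_space)
      finally have "bochner_L2_norm M (\<lambda>t. c t - J (p n t)) \<le> sqrt (T * \<eta>\<^sup>2)"
        unfolding bochner_L2_norm_def by (rule real_sqrt_le_mono)
      also have "\<dots> = \<delta> / 2" using T_pos \<delta> by (simp add: \<eta>_def real_sqrt_mult)
      finally show ?thesis using \<delta> by simp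
    qed
    then show "\<exists>N. \<forall>n\<ge>N. norm (bochner_L2_norm M (\<lambda>t. c t - J (p n t)) - 0) < \<delta>" by auto
  qed
  have "bochner_L2_norm M (\<lambda>t. c t - J (u t)) \<le> 0"
  proof (rule LIMSEQ_le_const)
    show "(\<lambda>n. bochner_L2_norm M (\<lambda>t. c t - J (p n t)) + bochner_L2_norm M (\<lambda>t. J (p n t) - J (u t))) \<longlonglongrightarrow> 0"
      using tendsto_add[OF cp Jpu] by simp
    show "\<exists>N. \<forall>n\<ge>N. bochner_L2_norm M (\<lambda>t. c t - J (u t))
        \<le> bochner_L2_norm M (\<lambda>t. c t - J (p n t)) + bochner_L2_norm M (\<lambda>t. J (p n t) - J (u t))"
      using L2_norm_triangle_diff[OF cL L2_J[OF pL] L2_J[OF u]] by blast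
  qed
  then have "bochner_L2_norm M (\<lambda>t. c t - J (u t)) = 0" by (simp add: antisym)
  then have "AE t in M. c t - J (u t) = 0" using L2_norm_eq_0_iff[OF L2_diff[OF cL L2_J[OF u]]] by simp
  then have AE: "AE t in M. c t = J (u t)" by eventually_elim simp
  have eq: "trace_at T j t u = c t" if "t \<in> {0..T}" for t by (rule continuous_rep_eq[OF cont AE that])
  show "continuous_on {0..T} (\<lambda>t. trace_at T j t u)"
    using cont by (rule continuous_on_eq) (simp add: eq)
  show "AE t in M. trace_at T j t u = J (u t)"
    using AE AE_space by eventually_elim (simp add: eq)
  show "(\<lambda>n. J (p n t)) \<longlonglongrightarrow> trace_at T j t u" if "t \<in> {0..T}" for t
    using tendsto_uniform_limitI[OF c that] by (simp add: eq[OF that])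
qed

lemma weak_pair_trace:
  assumes "weak_pair u z"
  shows "continuous_on {0..T} (\<lambda>t. trace_at T j t u)" "AE t in M. trace_at T j t u = J (u t)"
proof -
  obtain a p where "\<And>n::nat. primitive_on T (a n) (p n)"
    "(\<lambda>n. L2_norm (\<lambda>t. p n t - u t)) \<longlonglongrightarrow> 0" "(\<lambda>n. L2_norm (\<lambda>t. S (a n t) - z t)) \<longlonglongrightarrow> 0"
    by (rule regular_pairs_dense[OF assms]) blast
  from trace_limit(1,2)[OF this(1) weak_pairD(1,2)[OF assms] this(2,3)]
  show "continuous_on {0..T} (\<lambda>t. trace_at T j t u)" "AE t in M. trace_at T j t u = J (u t)" by auto
qed

lemma trace_cong_AE:
  assumes "AE t in M. u t = u' t"
  shows "trace_at T j t u = trace_at T j t u'"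
proof -
  have "(AE t in M. c t = J (u t)) \<longleftrightarrow> (AE t in M. c t = J (u' t))" for c
  proof
    show "AE t in M. c t = J (u' t)" if "AE t in M. c t = J (u t)"
      using that assms by eventually_elim simp
    show "AE t in M. c t = J (u t)" if "AE t in M. c t = J (u' t)"
      using that assms by eventually_elim simp
  qed
  then show ?thesis by (simp add: trace_at_def continuous_rep_def)
qed

text \<open>
  The product rule for regular pairs, extended by density.
\<close>

theorem integration_by_parts:
  assumes uz: "weak_pair u z" and vy: "weak_pair v y"
  shows "L2_inner M z v + L2_inner M u y
    = trace_at T j T u \<bullet> trace_at T j T v - trace_at T j 0 u \<bullet> trace_at T j 0 v"
proof -
  note uL = weak_pairD(1,2)[OF uz] and vL = weak_pairD(1,2)[OF vy]
  obtain a p where p: "\<And>n::nat. primitive_on T (a n) (p n)"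
    and pu: "(\<lambda>n. L2_norm (\<lambda>t. p n t - u t)) \<longlonglongrightarrow> 0" "(\<lambda>n. L2_norm (\<lambda>t. S (a n t) - z t)) \<longlonglongrightarrow> 0"
    by (rule regular_pairs_dense[OF uz]) blast
  obtain b q where q: "\<And>n::nat. primitive_on T (b n) (q n)"
    and qv: "(\<lambda>n. L2_norm (\<lambda>t. q n t - v t)) \<longlonglongrightarrow> 0" "(\<lambda>n. L2_norm (\<lambda>t. S (b n t) - y t)) \<longlonglongrightarrow> 0"
    by (rule regular_pairs_dense[OF vy]) blast
  note p_lim = trace_limit(3)[OF p uL pu] and q_lim = trace_limit(3)[OF q vL qv]
  have ends: "0 \<in> {0..T}" "T \<in> {0..T}" using T_pos by auto
  have eq: "L2_inner M (\<lambda>t. S (a n t)) (q n) + L2_inner M (p n) (\<lambda>t. S (b n t))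
      = J (p n T) \<bullet> J (q n T) - J (p n 0) \<bullet> J (q n 0)" for n
    using primitive_product_rule_L2[OF primitive_S[OF p] q, of n n]
    by (simp add: S_inner L2_inner_S L2_inner_commute)
  have "(\<lambda>n. L2_inner M (\<lambda>t. S (a n t)) (q n) + L2_inner M (p n) (\<lambda>t. S (b n t)))
      \<longlonglongrightarrow> L2_inner M z v + L2_inner M u y"
    using pu qv uL vL primitive_in_L2[OF p] primitive_L2[OF p] primitive_in_L2[OF q] primitive_L2[OF q]
    by (intro tendsto_add L2_inner_tendsto) auto
  moreover have "(\<lambda>n. J (p n T) \<bullet> J (q n T) - J (p n 0) \<bullet> J (q n 0))
      \<longlonglongrightarrow> trace_at T j T u \<bullet> trace_at T j T v - trace_at T j 0 u \<bullet> trace_at T j 0 v"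
    by (intro tendsto_intros p_lim q_lim ends)
  ultimately show ?thesis unfolding eq by (rule LIMSEQ_unique)
qed

end

section \<open>The linear problem\<close>

context gelfand_interval
begin

lemma energy_identity:
  assumes "weak_pair u z"
  shows "2 * L2_inner M z u = (norm (trace_at T j T u))\<^sup>2 - (norm (trace_at T j 0 u))\<^sup>2"
  using integration_by_parts[OF assms assms] by (simp add: L2_inner_commute[of M u] dot_square_norm)

lemma weak_pair_diff:
  assumes uz: "weak_pair u z" and vy: "weak_pair v y"
  shows "weak_pair (\<lambda>t. u t - v t) (\<lambda>t. z t - y t)"
  unfolding weak_pair_def
proof (intro conjI allI impI)
  note uL = weak_pairD(1,2)[OF uz] and vL = weak_pairD(1,2)[OF vy]
  show "(\<lambda>t. u t - v t) \<in> Y" "(\<lambda>t. z t - y t) \<in> Y" using uL vL by auto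
  fix d q :: "real \<Rightarrow> 'v" assume q: "primitive_on T d q \<and> q 0 = 0 \<and> q T = 0"
  show "L2_inner M (\<lambda>t. S (u t - v t)) d + L2_inner M (\<lambda>t. z t - y t) q = 0"
    using weak_pairD(3)[OF uz, of d q] weak_pairD(3)[OF vy, of d q] q uL vL
      primitive_L2[of d q] primitive_in_L2[of d q]
    by (simp add: S_comb L2_inner_linear)
qed

lemma trace_diff:
  assumes uz: "weak_pair u z" and vy: "weak_pair v y" and t: "t \<in> {0..T}"
  shows "trace_at T j t (\<lambda>t. u t - v t) = trace_at T j t u - trace_at T j t v"
proof (rule continuous_rep_eq[OF _ _ t])
  show "continuous_on {0..T} (\<lambda>t. trace_at T j t u - trace_at T j t v)"
    by (intro continuous_on_diff weak_pair_trace(1)[OF uz] weak_pair_trace(1)[OF vy])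
  show "AE t in M. trace_at T j t u - trace_at T j t v = J (u t - v t)"
    using weak_pair_trace(2)[OF uz] weak_pair_trace(2)[OF vy]
    by eventually_elim (simp add: blinfun.diff_right)
qed

lemma trace_primitive:
  assumes p: "primitive_on T a p" and t: "t \<in> {0..T}"
  shows "trace_at T j t p = J (p t)"
proof (rule continuous_rep_eq[OF _ _ t])
  show "continuous_on {0..T} (\<lambda>t. J (p t))"
    by (rule bounded_linear.continuous_on[OF bounded_linear_J primitive_continuous[OF p]])
qed simp

lemma L2_eq_AE:
  assumes f: "f \<in> Y" and g: "g \<in> Y" and eq: "\<And>v. v \<in> Y \<Longrightarrow> L2_inner M f v = L2_inner M g v"
  shows "AE t in M. f t = g t"
proof -
  have d: "(\<lambda>t. f t - g t) \<in> Y" using f g by auto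
  have "L2_inner M (\<lambda>t. f t - g t) (\<lambda>t. f t - g t) = 0"
    using eq[OF d] f g d by (simp add: L2_inner_diff_left[of f g])
  then have "L2_norm (\<lambda>t. f t - g t) = 0" by (simp flip: L2_norm_power2)
  then have "AE t in M. f t - g t = 0" by (simp add: L2_norm_eq_0_iff[OF d])
  then show ?thesis by eventually_elim simp
qed

text \<open>
  Minimize over regular pairs the squared norm of \<open>S a + \<kappa> p - g\<close> plus the initial error \<open>2 \<kappa> |j
  (p 0) - u0|\<^sup>2\<close>. With this weight the quadratic part of the energy equals \<open>\<parallel>S a\<parallel>\<^sup>2 + \<kappa>\<^sup>2 \<parallel>p\<parallel>\<^sup>2\<close>
  plus nonnegative boundary terms, so minimizing sequences converge in \<open>X\<close>. The residual \<open>y\<close> of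
  the limit satisfies the backward equation \<open>(S y)' = \<kappa> y\<close> with \<open>S y = 0\<close> at \<open>T\<close>, and testing it
  with \<open>S y\<close> forces \<open>y\<close> and the initial error to vanish.
\<close>

theorem linear_problem_solvable:
  assumes g: "g \<in> Y" and \<kappa>: "0 < \<kappa>"
  obtains u z where "weak_pair u z" "AE t in M. z t + \<kappa> *\<^sub>R u t = g t" "trace_at T j 0 u = u0"
proof -
  define K where "K P t = S (snd P t) + \<kappa> *\<^sub>R fst P t" for P :: "(real \<Rightarrow> 'v) \<times> (real \<Rightarrow> 'v)" and t
  define ip where "ip P Q = L2_inner M (K P) (K Q) + 2 * \<kappa> * (J (fst P 0) \<bullet> J (fst Q 0))"
    for P Q :: "(real \<Rightarrow> 'v) \<times> (real \<Rightarrow> 'v)"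
  define L where "L P = L2_inner M g (K P) + 2 * \<kappa> * (u0 \<bullet> J (fst P 0))"
    for P :: "(real \<Rightarrow> 'v) \<times> (real \<Rightarrow> 'v)"
  have KL: "K P \<in> Y" if "P \<in> regular_pairs" for P
    unfolding K_def[abs_def] using regular_pairs_L2[OF that] by auto
  have K_comb: "K (pair_comb c P Q) = (\<lambda>t. K P t + c *\<^sub>R K Q t)" for c P Q
    by (simp add: K_def fun_eq_iff S_comb algebra_simps)
  have ip_self: "ip P P = (L2_norm (K P))\<^sup>2 + 2 * \<kappa> * (norm (J (fst P 0)))\<^sup>2" for P
    by (simp add: ip_def L2_norm_power2 dot_square_norm)
  have coercive: "(L2_norm (\<lambda>t. S (snd P t)))\<^sup>2 + \<kappa>\<^sup>2 * (L2_norm (fst P))\<^sup>2 \<le> ip P P"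
    if P: "P \<in> regular_pairs" for P
  proof -
    have pr: "primitive_on T (snd P) (fst P)" using P by (simp add: regular_pairs_def)
    note PL = regular_pairs_L2[OF P]
    have "2 * L2_inner M (\<lambda>t. S (snd P t)) (fst P) = (norm (J (fst P T)))\<^sup>2 - (norm (J (fst P 0)))\<^sup>2"
      using primitive_product_rule_L2[OF primitive_S[OF pr] pr]
      by (simp add: L2_inner_S S_inner dot_square_norm L2_inner_commute)
    from arg_cong[OF this, of "\<lambda>x. \<kappa> * x"]
    have "2 * \<kappa> * L2_inner M (\<lambda>t. S (snd P t)) (fst P)
        = \<kappa> * (norm (J (fst P T)))\<^sup>2 - \<kappa> * (norm (J (fst P 0)))\<^sup>2"
      by (simp only: right_diff_distrib mult.assoc mult.left_commute)
    moreover have "(L2_norm (K P))\<^sup>2 = (L2_norm (\<lambda>t. S (snd P t)))\<^sup>2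
        + 2 * \<kappa> * L2_inner M (\<lambda>t. S (snd P t)) (fst P) + \<kappa>\<^sup>2 * (L2_norm (fst P))\<^sup>2"
      unfolding K_def[abs_def] L2_norm_power2 using PL L2_S[OF PL(2)]
      by (simp add: L2_inner_linear L2_inner_commute[of M "fst P" "\<lambda>t. S (snd P t)"] power2_eq_square algebra_simps)
    moreover have "0 \<le> \<kappa> * (norm (J (fst P T)))\<^sup>2" "0 \<le> \<kappa> * (norm (J (fst P 0)))\<^sup>2" using \<kappa> by auto
    ultimately show ?thesis unfolding ip_self by linarith
  qed
  let ?C = "2 * (L2_norm g)\<^sup>2 + 4 * \<kappa> * (norm u0)\<^sup>2"
  obtain P where P: "\<And>n::nat. P n \<in> regular_pairs"
    and cauchy: "\<And>e. 0 < e \<Longrightarrow>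
      \<exists>N. \<forall>m\<ge>N. \<forall>n\<ge>N. ip (pair_comb (-1) (P m) (P n)) (pair_comb (-1) (P m) (P n)) < e"
    and lim: "\<And>Q. Q \<in> regular_pairs \<Longrightarrow> (\<lambda>n. ip (P n) Q) \<longlonglongrightarrow> L Q"
  proof (rule minimizing_sequence_represents_functional
      [where S = regular_pairs and ip = ip and L = L and comb = pair_comb and C = ?C])
    fix P Q R c assume PQ: "P \<in> regular_pairs" "Q \<in> regular_pairs"
    show "L (pair_comb c P Q) = L P + c * L Q"
      using KL[OF PQ(1)] KL[OF PQ(2)] g
      by (simp add: L_def K_comb L2_inner_linear blinfun.bilinear_simps inner_add_right algebra_simps)
    show "ip (pair_comb c P Q) R = ip P R + c * ip Q R" if R: "R \<in> regular_pairs"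
      using KL[OF PQ(1)] KL[OF PQ(2)] KL[OF R]
      by (simp add: ip_def K_comb L2_inner_linear blinfun.bilinear_simps inner_add_left algebra_simps)
  next
    fix P assume P: "P \<in> regular_pairs"
    let ?k = "L2_norm (K P)" and ?h = "norm (J (fst P 0))"
    have "\<bar>L P\<bar> \<le> L2_norm g * ?k + 2 * \<kappa> * (norm u0 * ?h)"
      unfolding L_def using L2_Cauchy_Schwarz[OF g KL[OF P]] Cauchy_Schwarz_ineq2[of u0 "J (fst P 0)"] \<kappa>
      by (intro order_trans[OF abs_triangle_ineq] add_mono) (auto simp: abs_mult)
    then have "(L P)\<^sup>2 \<le> (L2_norm g * ?k + 2 * \<kappa> * (norm u0 * ?h))\<^sup>2"
      by (metis abs_ge_zero power2_abs power_mono)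
    also have "\<dots> \<le> 2 * (L2_norm g * ?k)\<^sup>2 + 2 * (2 * \<kappa> * (norm u0 * ?h))\<^sup>2" by (rule power2_sum_le)
    also have "\<dots> = 2 * (L2_norm g)\<^sup>2 * ?k\<^sup>2 + 4 * \<kappa> * (norm u0)\<^sup>2 * (2 * \<kappa> * ?h\<^sup>2)"
      by (simp add: power_mult_distrib power2_eq_square)
    also have "\<dots> \<le> ?C * ip P P"
      using \<kappa> by (simp add: ip_self algebra_simps)
    finally show "(L P)\<^sup>2 \<le> ?C * ip P P" .
  next
    show "0 \<le> ?C" using \<kappa> by simp
  qed (use \<kappa> in \<open>auto simp: regular_pairs_nonempty regular_pairs_comb ip_self\<close>,
      simp add: ip_def L2_inner_commute inner_commute)
  have PL: "fst (P n) \<in> Y" "(\<lambda>t. S (snd (P n) t)) \<in> Y" for n using regular_pairs_L2[OF P] by auto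
  have pr: "primitive_on T (snd (P n)) (fst (P n))" for n using P[of n] by (simp add: regular_pairs_def)
  have cauchy': "\<exists>N. \<forall>m\<ge>N. \<forall>n\<ge>N. (L2_norm (\<lambda>t. S (snd (P m) t) - S (snd (P n) t)))\<^sup>2
      + \<kappa>\<^sup>2 * (L2_norm (\<lambda>t. fst (P m) t - fst (P n) t))\<^sup>2 < e" if "0 < e" for e
  proof -
    have "(L2_norm (\<lambda>t. S (snd (P m) t) - S (snd (P n) t)))\<^sup>2 + \<kappa>\<^sup>2 * (L2_norm (\<lambda>t. fst (P m) t - fst (P n) t))\<^sup>2
        \<le> ip (pair_comb (-1) (P m) (P n)) (pair_comb (-1) (P m) (P n))" for m n
      using coercive[OF regular_pairs_comb[OF P[of m] P[of n], of "-1"]] by (simp add: S_comb)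
    then show ?thesis using cauchy[OF that] by (meson order_le_less_trans)
  qed
  obtain u where u: "u \<in> Y" "(\<lambda>n. L2_norm (\<lambda>t. fst (P n) t - u t)) \<longlonglongrightarrow> 0"
  proof (rule L2_Cauchy_from_power2[of "\<lambda>n. fst (P n)"])
    fix e :: real assume "0 < e"
    then obtain N where N: "\<And>m n. N \<le> m \<Longrightarrow> N \<le> n \<Longrightarrow> (L2_norm (\<lambda>t. S (snd (P m) t) - S (snd (P n) t)))\<^sup>2
      + \<kappa>\<^sup>2 * (L2_norm (\<lambda>t. fst (P m) t - fst (P n) t))\<^sup>2 < \<kappa>\<^sup>2 * e"
      using cauchy'[of "\<kappa>\<^sup>2 * e"] \<kappa> by auto
    have "(L2_norm (\<lambda>t. fst (P m) t - fst (P n) t))\<^sup>2 < e" if "N \<le> m" "N \<le> n" for m n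
    proof -
      have "\<kappa>\<^sup>2 * (L2_norm (\<lambda>t. fst (P m) t - fst (P n) t))\<^sup>2 < \<kappa>\<^sup>2 * e"
        using N[OF that] zero_le_power2[of "L2_norm (\<lambda>t. S (snd (P m) t) - S (snd (P n) t))"] by linarith
      then show ?thesis using \<kappa> by simp
    qed
    then show "\<exists>N. \<forall>m\<ge>N. \<forall>n\<ge>N. (L2_norm (\<lambda>t. fst (P m) t - fst (P n) t))\<^sup>2 < e" by blast
  qed (use PL in auto)
  obtain z where z: "z \<in> Y" "(\<lambda>n. L2_norm (\<lambda>t. S (snd (P n) t) - z t)) \<longlonglongrightarrow> 0"
  proof (rule L2_Cauchy_from_power2[of "\<lambda>n t. S (snd (P n) t)"])
    fix e :: real assume "0 < e"
    from cauchy'[OF this]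
    show "\<exists>N. \<forall>m\<ge>N. \<forall>n\<ge>N. (L2_norm (\<lambda>t. S (snd (P m) t) - S (snd (P n) t)))\<^sup>2 < e"
      by (meson add_increasing2 le_less_trans mult_nonneg_nonneg order_refl zero_le_power2)
  qed (use PL in auto)
  have uz: "weak_pair u z" by (rule weak_pair_limit[OF pr u(1) z(1) u(2) z(2)])
  have tr: "(\<lambda>n. J (fst (P n) 0)) \<longlonglongrightarrow> trace_at T j 0 u"
    by (rule trace_limit(3)[OF pr u(1) z(1) u(2) z(2)]) (use T_pos in simp)
  define y where "y t = z t + \<kappa> *\<^sub>R u t - g t" for t
  define h where "h = (2 * \<kappa>) *\<^sub>R (trace_at T j 0 u - u0)"
  have y: "y \<in> Y" unfolding y_def by (rule L2_diff[OF L2_add[OF z(1) L2_scaleR[OF u(1)]] g])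
  have const: "(\<lambda>n. L2_norm (\<lambda>t. f t - f t)) \<longlonglongrightarrow> 0" for f by (simp add: bochner_L2_norm_def)
  have orth: "L2_inner M (\<lambda>t. S (y t)) a + L2_inner M (\<lambda>t. \<kappa> *\<^sub>R y t) p + h \<bullet> J (p 0) + 0 \<bullet> J (p T) = 0"
    if p: "primitive_on T a p" for a p
  proof -
    note pL = primitive_L2[OF p] primitive_in_L2[OF p]
    define k where "k = K (p, a)"
    have k: "k \<in> Y" unfolding k_def using p by (intro KL) (simp add: regular_pairs_def)
    have "(\<lambda>n. L2_inner M (\<lambda>t. S (snd (P n) t)) k + \<kappa> * L2_inner M (fst (P n)) k + 2 * \<kappa> * (J (fst (P n) 0) \<bullet> J (p 0)))
        \<longlonglongrightarrow> L2_inner M z k + \<kappa> * L2_inner M u k + 2 * \<kappa> * (trace_at T j 0 u \<bullet> J (p 0))"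
      by (intro tendsto_intros L2_inner_tendsto tr PL u z k const)
    moreover have "ip (P n) (p, a)
        = L2_inner M (\<lambda>t. S (snd (P n) t)) k + \<kappa> * L2_inner M (fst (P n)) k + 2 * \<kappa> * (J (fst (P n) 0) \<bullet> J (p 0))" for n
      using PL[of n] k by (simp add: ip_def K_def[of "P n", abs_def] k_def[symmetric] L2_inner_linear)
    moreover have "(\<lambda>n. ip (P n) (p, a)) \<longlonglongrightarrow> L (p, a)" using p by (intro lim) (simp add: regular_pairs_def)
    ultimately have "L2_inner M z k + \<kappa> * L2_inner M u k + 2 * \<kappa> * (trace_at T j 0 u \<bullet> J (p 0))
        = L2_inner M g k + 2 * \<kappa> * (u0 \<bullet> J (p 0))"
      using LIMSEQ_unique by (fastforce simp: L_def k_def)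
    then have "L2_inner M y k + h \<bullet> J (p 0) = 0"
      unfolding y_def[abs_def] using u(1) z(1) g k
      by (simp add: L2_inner_linear h_def inner_diff_left algebra_simps)
    moreover have "L2_inner M y k = L2_inner M (\<lambda>t. S (y t)) a + L2_inner M (\<lambda>t. \<kappa> *\<^sub>R y t) p"
      unfolding k_def K_def[abs_def] using y pL
      by (simp add: L2_inner_linear L2_S) (simp add: L2_inner_S L2_inner_commute)
    ultimately show ?thesis by simp
  qed
  obtain q where q: "primitive_on T (\<lambda>t. \<kappa> *\<^sub>R y t) q" "AE t in M. q t = S (y t)"
    "q 0 = adj_embed j h" "q T = - adj_embed j 0"
    by (rule variational_problem[OF y L2_scaleR[OF y] orth])
  have "q T = 0" using q(4) adj_embed_eq_0_iff[of 0] by simp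
  then have "- (norm (q 0))\<^sup>2 = 2 * \<kappa> * L2_inner M y q"
    using primitive_product_rule_L2[OF q(1) q(1)]
    by (simp add: L2_inner_linear L2_inner_commute[of M q] dot_square_norm)
  also have "L2_inner M y q = L2_inner M y (\<lambda>t. S (y t))"
    using q(2) y primitive_in_L2[OF q(1)] by (intro L2_inner_cong_AE) auto
  also have "\<dots> = L2_inner M (\<lambda>t. S (y t)) y" by (rule L2_inner_commute)
  finally have eq: "- (norm (q 0))\<^sup>2 = 2 * \<kappa> * L2_inner M (\<lambda>t. S (y t)) y" .
  have "0 \<le> 2 * \<kappa> * L2_inner M (\<lambda>t. S (y t)) y"
    using \<kappa> L2_inner_S_self_nonneg[of y] by simp
  then have "(norm (q 0))\<^sup>2 \<le> 0" using eq by linarith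
  then have q0: "q 0 = 0" by simp
  then have "L2_inner M (\<lambda>t. S (y t)) y = 0" using eq \<kappa> by simp
  then have "AE t in M. y t = 0" by (intro L2_inner_S_self_eq_0 y) simp
  then have "AE t in M. z t + \<kappa> *\<^sub>R u t = g t" by eventually_elim (simp add: y_def)
  moreover have "trace_at T j 0 u = u0"
    using q0 q(3) \<kappa> by (simp add: adj_embed_eq_0_iff h_def)
  ultimately show ?thesis using that uz by blast
qed

end

section \<open>The nonlinear problem\<close>

lemma (in complete_finite_measure) L2_contraction_fixed_point:
  fixes F :: "('a \<Rightarrow> 'b::{real_inner,complete_space}) \<Rightarrow> 'a \<Rightarrow> 'b"
  assumes F: "\<And>w. w \<in> bochner_L2 M \<Longrightarrow> F w \<in> bochner_L2 M"
    and k: "0 \<le> k" "k < 1"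
    and contr: "\<And>v w. v \<in> bochner_L2 M \<Longrightarrow> w \<in> bochner_L2 M \<Longrightarrow>
      bochner_L2_norm M (\<lambda>t. F v t - F w t) \<le> k * bochner_L2_norm M (\<lambda>t. v t - w t)"
  obtains w where "w \<in> bochner_L2 M" "AE t in M. F w t = w t"
proof -
  let ?N = "bochner_L2_norm M"
  define s where "s n = (F ^^ n) (\<lambda>_. 0)" for n
  have s_Suc: "s (Suc n) = F (s n)" for n by (simp add: s_def)
  have sL: "s n \<in> bochner_L2 M" for n by (induction n) (auto simp: s_Suc F, auto simp: s_def)
  define B where "B = ?N (\<lambda>t. s 1 t - s 0 t) / (1 - k)"
  have B0: "0 \<le> B" using k by (simp add: B_def)
  have B: "?N (\<lambda>t. s n t - s 0 t) \<le> B" for n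
  proof (induction n)
    case 0
    then show ?case using B0 by (simp add: bochner_L2_norm_def)
  next
    case (Suc n)
    have "?N (\<lambda>t. s (Suc n) t - s 0 t) \<le> ?N (\<lambda>t. s (Suc n) t - s 1 t) + ?N (\<lambda>t. s 1 t - s 0 t)"
      by (rule L2_norm_triangle_diff[OF sL sL sL])
    also have "?N (\<lambda>t. s (Suc n) t - s 1 t) \<le> k * ?N (\<lambda>t. s n t - s 0 t)"
      using contr[OF sL sL, of n 0] by (simp add: s_Suc)
    also have "\<dots> \<le> k * B" using Suc k by (intro mult_left_mono) auto
    also have "?N (\<lambda>t. s 1 t - s 0 t) = (1 - k) * B" using k by (simp add: B_def)
    finally show ?case by (simp add: algebra_simps)
  qed
  have dist: "?N (\<lambda>t. s (i + n) t - s n t) \<le> k ^ n * B" for i n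
  proof (induction n)
    case 0
    then show ?case using B by simp
  next
    case (Suc n)
    have "?N (\<lambda>t. s (i + Suc n) t - s (Suc n) t) \<le> k * ?N (\<lambda>t. s (i + n) t - s n t)"
      using contr[OF sL sL, of "i + n" n] by (simp add: s_Suc)
    also have "\<dots> \<le> k * (k ^ n * B)" using Suc k by (intro mult_left_mono) auto
    finally show ?case by simp
  qed
  have k_lim: "(\<lambda>n. k ^ n * B) \<longlonglongrightarrow> 0"
    using k by (intro tendsto_mult_left_zero LIMSEQ_power_zero) simp
  have "\<exists>N. \<forall>m\<ge>N. \<forall>n\<ge>N. ?N (\<lambda>t. s m t - s n t) < e" if e: "0 < e" for e
  proof -
    obtain N where N: "\<And>n. N \<le> n \<Longrightarrow> k ^ n * B < e"
      using order_tendstoD(2)[OF k_lim e] by (auto simp: eventually_sequentially)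
    have le: "?N (\<lambda>t. s m t - s n t) < e" if "N \<le> n" "n \<le> m" for m n
      using dist[of "m - n" n] N[OF that(1)] that(2) by simp
    show ?thesis
    proof (intro exI[of _ N] allI impI)
      fix m n assume "N \<le> m" "N \<le> n"
      then show "?N (\<lambda>t. s m t - s n t) < e"
        using le[of m n] le[of n m] L2_norm_minus_commute[of "s m" "s n"] by (cases "n \<le> m") auto
    qed
  qed
  then obtain w where w: "w \<in> bochner_L2 M" and lim: "(\<lambda>n. ?N (\<lambda>t. s n t - w t)) \<longlonglongrightarrow> 0"
    by (rule L2_complete[OF sL])
  have "?N (\<lambda>t. F w t - w t) \<le> 0"
  proof (rule LIMSEQ_le_const)
    show "(\<lambda>n. k * ?N (\<lambda>t. s n t - w t) + ?N (\<lambda>t. s (Suc n) t - w t)) \<longlonglongrightarrow> 0"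
      using tendsto_add[OF tendsto_mult_right_zero[OF lim, of k] LIMSEQ_Suc[OF lim]] by simp
    have "?N (\<lambda>t. F w t - w t) \<le> k * ?N (\<lambda>t. s n t - w t) + ?N (\<lambda>t. s (Suc n) t - w t)" for n
      using L2_norm_triangle_diff[OF F[OF w] sL w, of "Suc n"] contr[OF w sL, of n]
      by (simp add: s_Suc L2_norm_minus_commute[of w])
    then show "\<exists>N. \<forall>n\<ge>N. ?N (\<lambda>t. F w t - w t) \<le> k * ?N (\<lambda>t. s n t - w t) + ?N (\<lambda>t. s (Suc n) t - w t)"
      by blast
  qed
  then have "?N (\<lambda>t. F w t - w t) = 0" by (simp add: antisym)
  then have "AE t in M. F w t - w t = 0" using L2_norm_eq_0_iff[OF L2_diff[OF F[OF w] w]] by simp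
  then have "AE t in M. F w t = w t" by eventually_elim simp
  then show ?thesis using that w by blast
qed

locale monotone_parabolic = gelfand_interval T j
  for T :: real and j :: "'v::{real_inner,complete_space} \<Rightarrow>\<^sub>L 'h::{real_inner,complete_space}" +
  fixes L_A m_A :: real and A :: "real \<Rightarrow> 'v \<Rightarrow> 'v \<Rightarrow>\<^sub>L real" and l :: "(real \<Rightarrow> 'v) \<Rightarrow> real" and u0 :: 'h
  assumes L_pos: "0 < L_A" and m_pos: "0 < m_A"
    and maps: "maps_Y_to_dual T A" and lip: "lipschitz_op T A L_A" and mono: "strongly_monotone_op T A m_A"
    and l_dual: "l \<in> bochner_L2_dual M"
begin

definition A_rep :: "(real \<Rightarrow> 'v) \<Rightarrow> real \<Rightarrow> 'v" where
  "A_rep w = (SOME a. a \<in> Y \<and> (\<forall>v\<in>Y. induced_op T A w v = L2_inner M a v))"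

definition l_rep :: "real \<Rightarrow> 'v" where
  "l_rep = (SOME a. a \<in> Y \<and> (\<forall>v\<in>Y. l v = L2_inner M a v))"

lemma L2_Riesz_ex: "F \<in> bochner_L2_dual M \<Longrightarrow> \<exists>a. a \<in> Y \<and> (\<forall>v\<in>Y. F v = L2_inner M a v)"
  by (rule L2_Riesz[of F]) auto

lemma A_rep:
  assumes "w \<in> Y"
  shows "A_rep w \<in> Y" "v \<in> Y \<Longrightarrow> induced_op T A w v = L2_inner M (A_rep w) v"
proof -
  have "induced_op T A w \<in> bochner_L2_dual M"
    using maps assms by (simp add: maps_Y_to_dual_def Y_space_def)
  from someI_ex[OF L2_Riesz_ex[OF this]]
  show "A_rep w \<in> Y" "v \<in> Y \<Longrightarrow> induced_op T A w v = L2_inner M (A_rep w) v"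
    by (auto simp: A_rep_def)
qed

lemma l_rep: "l_rep \<in> Y" "v \<in> Y \<Longrightarrow> l v = L2_inner M l_rep v"
  using someI_ex[OF L2_Riesz_ex[OF l_dual]] by (auto simp: l_rep_def)

text \<open>
  The dual norm is a supremum of values, and the normalized difference of the representatives
  attains it.
\<close>

lemma A_rep_lipschitz:
  assumes w: "w \<in> Y" and v: "v \<in> Y"
  shows "L2_norm (\<lambda>t. A_rep w t - A_rep v t) \<le> L_A * L2_norm (\<lambda>t. w t - v t)"
proof -
  define d where "d t = A_rep w t - A_rep v t" for t
  define F where "F z = induced_op T A w z - induced_op T A v z" for z
  have d: "d \<in> Y" unfolding d_def by (rule L2_diff[OF A_rep(1)[OF w] A_rep(1)[OF v]])
  have F: "F z = L2_inner M d z" if "z \<in> Y" for z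
    unfolding F_def d_def using that A_rep[OF w] A_rep[OF v] by (simp add: L2_inner_diff_left)
  have F_le: "\<bar>F z\<bar> \<le> L2_norm d" if "z \<in> Y" "L2_norm z \<le> 1" for z
    using L2_Cauchy_Schwarz[OF d that(1)] F[OF that(1)] mult_left_mono[OF that(2), of "L2_norm d"] by simp
  have "L2_norm d \<le> bochner_L2_dual_norm M F"
  proof (cases "L2_norm d = 0")
    case True
    have "\<bar>F (\<lambda>_. 0)\<bar> \<le> bochner_L2_dual_norm M F"
      unfolding bochner_L2_dual_norm_def
      by (rule cSUP_upper) (auto simp: bochner_L2_norm_def intro!: bdd_aboveI2[where M = "L2_norm d"] F_le)
    then show ?thesis using True by simp
  next
    case False
    then have pos: "0 < L2_norm d" using L2_norm_nonneg[of M d] by linarith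
    define z where "z t = (1 / L2_norm d) *\<^sub>R d t" for t
    have z: "z \<in> Y" unfolding z_def by (rule L2_scaleR[OF d])
    have "F z = L2_norm d"
      unfolding F[OF z] unfolding z_def L2_inner_scaleR_right
      using pos by (simp add: L2_norm_power2[symmetric] power2_eq_square)
    moreover have "L2_norm z \<le> 1" unfolding z_def L2_norm_scaleR using pos by simp
    then have "\<bar>F z\<bar> \<le> bochner_L2_dual_norm M F"
      unfolding bochner_L2_dual_norm_def using z
      by (intro cSUP_upper) (auto intro!: bdd_aboveI2[where M = "L2_norm d"] F_le)
    ultimately show ?thesis by simp
  qed
  also have "\<dots> \<le> L_A * L2_norm (\<lambda>t. w t - v t)"
    using lip w v by (simp add: lipschitz_op_def Y_space_def F_def[abs_def])
  finally show ?thesis by (simp add: d_def[abs_def])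
qed

lemma A_rep_monotone:
  assumes w: "w \<in> Y" and v: "v \<in> Y"
  shows "m_A * (L2_norm (\<lambda>t. w t - v t))\<^sup>2 \<le> L2_inner M (\<lambda>t. A_rep w t - A_rep v t) (\<lambda>t. w t - v t)"
proof -
  have d: "(\<lambda>t. w t - v t) \<in> Y" using w v by (rule L2_diff)
  have "m_A * (L2_norm (\<lambda>t. w t - v t))\<^sup>2 \<le> induced_op T A w (\<lambda>t. w t - v t) - induced_op T A v (\<lambda>t. w t - v t)"
    using mono w v by (simp add: strongly_monotone_op_def Y_space_def)
  then show ?thesis
    unfolding A_rep(2)[OF w d] A_rep(2)[OF v d] L2_inner_diff_left[OF A_rep(1)[OF w] A_rep(1)[OF v] d] .
qed

lemma A_rep_cong_AE:
  assumes w: "w \<in> Y" and v: "v \<in> Y" and eq: "AE t in M. w t = v t"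
  shows "AE t in M. A_rep w t = A_rep v t"
proof -
  have d: "(\<lambda>t. w t - v t) \<in> Y" using w v by (rule L2_diff)
  have "AE t in M. w t - v t = 0" using eq by eventually_elim simp
  then have "L2_norm (\<lambda>t. w t - v t) = 0" by (simp add: L2_norm_eq_0_iff[OF d])
  then have "L2_norm (\<lambda>t. A_rep w t - A_rep v t) \<le> 0" using A_rep_lipschitz[OF w v] by simp
  then have "L2_norm (\<lambda>t. A_rep w t - A_rep v t) = 0" by (simp add: antisym)
  then have "AE t in M. A_rep w t - A_rep v t = 0"
    by (simp add: L2_norm_eq_0_iff[OF L2_diff[OF A_rep(1)[OF w] A_rep(1)[OF v]]])
  then show ?thesis by eventually_elim simp
qed

lemma eq_AE_if_monotone:
  assumes w: "w \<in> Y" and v: "v \<in> Y"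
    and le: "L2_inner M (\<lambda>t. A_rep w t - A_rep v t) (\<lambda>t. w t - v t) \<le> 0"
  shows "AE t in M. w t = v t"
proof -
  have "m_A * (L2_norm (\<lambda>t. w t - v t))\<^sup>2 \<le> 0" using A_rep_monotone[OF w v] le by linarith
  then have "(L2_norm (\<lambda>t. w t - v t))\<^sup>2 \<le> 0" using m_pos by (simp add: mult_le_0_iff)
  then have "L2_norm (\<lambda>t. w t - v t) = 0" by simp
  then have "AE t in M. w t - v t = 0" by (simp add: L2_norm_eq_0_iff[OF L2_diff[OF w v]])
  then show ?thesis by eventually_elim simp
qed

text \<open>
  Zarantonello's estimate: expand the square and use monotonicity in the mixed term.
\<close>

lemma A_rep_relaxed_contraction:
  assumes w: "w \<in> Y" and v: "v \<in> Y" and \<kappa>: "0 \<le> \<kappa>"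
  shows "(L2_norm (\<lambda>t. (\<kappa> *\<^sub>R w t - A_rep w t) - (\<kappa> *\<^sub>R v t - A_rep v t)))\<^sup>2
    \<le> (\<kappa>\<^sup>2 - 2 * \<kappa> * m_A + L_A\<^sup>2) * (L2_norm (\<lambda>t. w t - v t))\<^sup>2"
proof -
  define d where "d t = w t - v t" for t
  define a where "a t = A_rep w t - A_rep v t" for t
  have d: "d \<in> Y" unfolding d_def by (rule L2_diff[OF w v])
  have a: "a \<in> Y" unfolding a_def by (rule L2_diff[OF A_rep(1)[OF w] A_rep(1)[OF v]])
  have "(\<lambda>t. (\<kappa> *\<^sub>R w t - A_rep w t) - (\<kappa> *\<^sub>R v t - A_rep v t)) = (\<lambda>t. \<kappa> *\<^sub>R d t - a t)"
    by (simp add: d_def a_def fun_eq_iff algebra_simps)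
  moreover have "(L2_norm (\<lambda>t. \<kappa> *\<^sub>R d t - a t))\<^sup>2
      = \<kappa>\<^sup>2 * (L2_norm d)\<^sup>2 - 2 * \<kappa> * L2_inner M a d + (L2_norm a)\<^sup>2"
    unfolding L2_norm_power2 using d a
    by (simp add: L2_inner_linear L2_inner_commute[of M d a] power2_eq_square algebra_simps)
  moreover have "2 * \<kappa> * L2_inner M a d \<ge> 2 * \<kappa> * (m_A * (L2_norm d)\<^sup>2)"
    using A_rep_monotone[OF w v] \<kappa> by (intro mult_left_mono) (simp_all add: a_def[abs_def] d_def[abs_def])
  moreover have "(L2_norm a)\<^sup>2 \<le> L_A\<^sup>2 * (L2_norm d)\<^sup>2"
    using power_mono[OF A_rep_lipschitz[OF w v], of 2] by (simp add: a_def[abs_def] d_def[abs_def] power_mult_distrib)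
  ultimately have "(L2_norm (\<lambda>t. (\<kappa> *\<^sub>R w t - A_rep w t) - (\<kappa> *\<^sub>R v t - A_rep v t)))\<^sup>2
      \<le> \<kappa>\<^sup>2 * (L2_norm d)\<^sup>2 - 2 * \<kappa> * (m_A * (L2_norm d)\<^sup>2) + L_A\<^sup>2 * (L2_norm d)\<^sup>2"
    by simp
  also have "\<dots> = (\<kappa>\<^sup>2 - 2 * \<kappa> * m_A + L_A\<^sup>2) * (L2_norm d)\<^sup>2" by (simp add: algebra_simps)
  finally show ?thesis by (simp only: d_def[abs_def])
qed

lemma dissipation_nonneg:
  assumes "weak_pair u z" "trace_at T j 0 u = 0"
  shows "0 \<le> L2_inner M z u"
proof -
  have "2 * L2_inner M z u = (norm (trace_at T j T u))\<^sup>2" using energy_identity[OF assms(1)] assms(2) by simp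
  then have "0 \<le> 2 * L2_inner M z u" by (simp only: zero_le_power2)
  then show ?thesis by simp
qed

lemma B_e_solution_iff:
  "B_e_solution T j A l u0 u \<longleftrightarrow>
    u \<in> X_space T j \<and> (AE t in M. rate u t + A_rep u t = l_rep t) \<and> trace_at T j 0 u = u0"
proof (cases "u \<in> X_space T j")
  case True
  have u: "u \<in> Y" "rate u \<in> Y" using weak_pairD(1,2)[OF X_weak_pair[OF True]] by auto
  note L = u(2) A_rep(1)[OF u(1)]
  have "(\<forall>v\<in>Y. d_t T j u v + induced_op T A u v = l v) \<longleftrightarrow> (AE t in M. rate u t + A_rep u t = l_rep t)"
  proof
    assume *: "\<forall>v\<in>Y. d_t T j u v + induced_op T A u v = l v"
    show "AE t in M. rate u t + A_rep u t = l_rep t"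
    proof (rule L2_eq_AE[OF L2_add[OF L] l_rep(1)])
      fix v assume v: "v \<in> Y"
      show "L2_inner M (\<lambda>t. rate u t + A_rep u t) v = L2_inner M l_rep v"
        using *[rule_format, OF v] A_rep(2)[OF u(1) v] l_rep(2)[OF v] L2_inner_add_left[OF L v]
        by (simp add: d_t_eq_rate)
    qed
  next
    assume *: "AE t in M. rate u t + A_rep u t = l_rep t"
    show "\<forall>v\<in>Y. d_t T j u v + induced_op T A u v = l v"
    proof
      fix v assume v: "v \<in> Y"
      have "L2_inner M (\<lambda>t. rate u t + A_rep u t) v = L2_inner M l_rep v"
        by (rule L2_inner_cong_AE[OF L2_add[OF L] v *]) simp
      then show "d_t T j u v + induced_op T A u v = l v"
        using A_rep(2)[OF u(1) v] l_rep(2)[OF v] L2_inner_add_left[OF L v]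
        by (simp add: d_t_eq_rate)
    qed
  qed
  then show ?thesis by (simp add: B_e_solution_def B_e_def dual_eq_def Y_space_def True)
qed (simp add: B_e_solution_def)

lemma B_e_solution_cong_AE:
  assumes u: "B_e_solution T j A l u0 u" and w: "w \<in> X_space T j" and eq: "AE t in M. w t = u t"
  shows "B_e_solution T j A l u0 w"
proof -
  have uX: "u \<in> X_space T j" using u by (simp add: B_e_solution_iff)
  note uw = X_weak_pair[OF uX] and wz = X_weak_pair[OF w]
  have eq': "AE t in M. u t = w t" using eq by eventually_elim simp
  have "AE t in M. rate w t = rate u t"
    by (rule weak_pair_X(2)[OF weak_pair_cong_AE[OF uw eq']]) simp
  moreover have "AE t in M. A_rep w t = A_rep u t"
    by (rule A_rep_cong_AE[OF weak_pairD(1)[OF wz] weak_pairD(1)[OF uw] eq])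
  moreover have "AE t in M. rate u t + A_rep u t = l_rep t" using u by (simp add: B_e_solution_iff)
  ultimately have "AE t in M. rate w t + A_rep w t = l_rep t" by eventually_elim simp
  then show ?thesis
    using u w trace_cong_AE[OF eq] by (simp add: B_e_solution_iff)
qed

lemma B_e_solution_unique:
  assumes u: "B_e_solution T j A l u0 u" and w: "B_e_solution T j A l u0 w"
  shows "AE t in M. w t = u t"
proof -
  have u': "weak_pair u (rate u)" "AE t in M. rate u t + A_rep u t = l_rep t" "trace_at T j 0 u = u0"
    and w': "weak_pair w (rate w)" "AE t in M. rate w t + A_rep w t = l_rep t" "trace_at T j 0 w = u0"
    using u w X_weak_pair by (auto simp: B_e_solution_iff)
  note uL = weak_pairD(1,2)[OF u'(1)] and wL = weak_pairD(1,2)[OF w'(1)]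
  let ?d = "\<lambda>t. w t - u t" and ?z = "\<lambda>t. rate w t - rate u t"
  have dz: "weak_pair ?d ?z" by (rule weak_pair_diff[OF w'(1) u'(1)])
  have "trace_at T j 0 ?d = 0" using trace_diff[OF w'(1) u'(1), of 0] u'(3) w'(3) T_pos by simp
  then have nonneg: "0 \<le> L2_inner M ?z ?d" by (rule dissipation_nonneg[OF dz])
  have "AE t in M. A_rep w t - A_rep u t = - 1 *\<^sub>R ?z t"
    using u'(2) w'(2) by eventually_elim (simp add: algebra_simps)
  then have "L2_inner M (\<lambda>t. A_rep w t - A_rep u t) ?d = L2_inner M (\<lambda>t. - 1 *\<^sub>R ?z t) ?d"
    by (rule L2_inner_cong_AE[OF L2_diff[OF A_rep(1)[OF wL(1)] A_rep(1)[OF uL(1)]] L2_diff[OF wL(1) uL(1)]]) simp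
  also have "\<dots> = - L2_inner M ?z ?d" by (simp only: L2_inner_scaleR_left)
  finally have "L2_inner M (\<lambda>t. A_rep w t - A_rep u t) ?d \<le> 0" using nonneg by simp
  then show ?thesis by (rule eq_AE_if_monotone[OF wL(1) uL(1)])
qed

text \<open>
  A solution is a fixed point of the map that sends \<open>w\<close> to the solution \<open>u\<close> of the linear
  problem \<open>d\<^sub>t u + \<kappa> u = l - A w + \<kappa> w\<close>. The linear solution map has norm at most \<open>1/\<kappa>\<close>, and the
  right-hand side is Lipschitz with constant below \<open>\<kappa>\<close> for \<open>\<kappa> = L\<^sub>A\<^sup>2 / m\<^sub>A\<close>.
\<close>

theorem B_e_solution_exists: "\<exists>u. B_e_solution T j A l u0 u"
proof -
  define \<kappa> where "\<kappa> = L_A\<^sup>2 / m_A"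
  have \<kappa>: "0 < \<kappa>" using L_pos m_pos by (simp add: \<kappa>_def)
  define solves where "solves g P \<longleftrightarrow> weak_pair (fst P) (snd P) \<and>
    (AE t in M. snd P t + \<kappa> *\<^sub>R fst P t = g t) \<and> trace_at T j 0 (fst P) = u0" for g P
  have ex: "\<exists>P. solves g P" if g: "g \<in> Y" for g
  proof -
    obtain u z where "weak_pair u z" "AE t in M. z t + \<kappa> *\<^sub>R u t = g t" "trace_at T j 0 u = u0"
      by (rule linear_problem_solvable[OF g \<kappa>])
    then have "solves g (u, z)" by (simp add: solves_def)
    then show ?thesis by (rule exI)
  qed
  define sol rt where "sol g = fst (SOME P. solves g P)" and "rt g = snd (SOME P. solves g P)" for g
  have "solves g (SOME P. solves g P)" if "g \<in> Y" for g using ex[OF that] by (rule someI_ex)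
  then have sol: "\<And>g. g \<in> Y \<Longrightarrow> weak_pair (sol g) (rt g)"
    "\<And>g. g \<in> Y \<Longrightarrow> AE t in M. rt g t + \<kappa> *\<^sub>R sol g t = g t" "\<And>g. g \<in> Y \<Longrightarrow> trace_at T j 0 (sol g) = u0"
    by (simp_all add: solves_def sol_def rt_def)
  have sol_lip: "\<kappa> * L2_norm (\<lambda>t. sol g t - sol g' t) \<le> L2_norm (\<lambda>t. g t - g' t)"
    if g: "g \<in> Y" "g' \<in> Y" for g g'
  proof -
    let ?d = "\<lambda>t. sol g t - sol g' t" and ?z = "\<lambda>t. rt g t - rt g' t"
    have dz: "weak_pair ?d ?z" by (rule weak_pair_diff[OF sol(1)[OF g(1)] sol(1)[OF g(2)]])
    note dL = weak_pairD(1,2)[OF dz]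
    have "trace_at T j 0 ?d = 0"
      using trace_diff[OF sol(1)[OF g(1)] sol(1)[OF g(2)], of 0] sol(3)[OF g(1)] sol(3)[OF g(2)] T_pos by simp
    then have nonneg: "0 \<le> L2_inner M ?z ?d" by (rule dissipation_nonneg[OF dz])
    have "AE t in M. ?z t + \<kappa> *\<^sub>R ?d t = g t - g' t"
      using sol(2)[OF g(1)] sol(2)[OF g(2)] by eventually_elim (simp add: algebra_simps)
    then have "L2_inner M (\<lambda>t. ?z t + \<kappa> *\<^sub>R ?d t) ?d = L2_inner M (\<lambda>t. g t - g' t) ?d"
      by (intro L2_inner_cong_AE L2_add L2_scaleR dL) auto
    then have "L2_inner M ?z ?d + \<kappa> * (L2_norm ?d)\<^sup>2 = L2_inner M (\<lambda>t. g t - g' t) ?d"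
      by (simp only: L2_inner_add_left[OF dL(2) L2_scaleR[OF dL(1)] dL(1)] L2_inner_scaleR_left L2_norm_power2)
    then have "\<kappa> * (L2_norm ?d)\<^sup>2 \<le> L2_norm (\<lambda>t. g t - g' t) * L2_norm ?d"
      using L2_Cauchy_Schwarz[OF L2_diff[OF g] dL(1)] nonneg by linarith
    then show ?thesis
      using L2_norm_nonneg[of M ?d] by (cases "L2_norm ?d = 0") (auto simp: power2_eq_square)
  qed
  define g where "g w t = l_rep t + (\<kappa> *\<^sub>R w t - A_rep w t)" for w t
  have gY: "g w \<in> Y" if "w \<in> Y" for w
    unfolding g_def by (rule L2_add[OF l_rep(1) L2_diff[OF L2_scaleR[OF that] A_rep(1)[OF that]]])
  define K where "K = max 0 (\<kappa>\<^sup>2 - 2 * \<kappa> * m_A + L_A\<^sup>2)"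
  have "2 * \<kappa> * m_A = 2 * L_A\<^sup>2" using m_pos by (simp add: \<kappa>_def)
  moreover have "0 < L_A\<^sup>2" using L_pos by simp
  ultimately have "\<kappa>\<^sup>2 - 2 * \<kappa> * m_A + L_A\<^sup>2 < \<kappa>\<^sup>2" by linarith
  then have K: "0 \<le> K" "K < \<kappa>\<^sup>2" using \<kappa> by (auto simp: K_def)
  obtain w where w: "w \<in> Y" "AE t in M. sol (g w) t = w t"
  proof (rule L2_contraction_fixed_point[of "\<lambda>w. sol (g w)" "sqrt K / \<kappa>"])
    show "sol (g w) \<in> Y" if "w \<in> Y" for w by (rule weak_pairD(1)[OF sol(1)[OF gY[OF that]]])
    show "0 \<le> sqrt K / \<kappa>" using K \<kappa> by simp
    have "sqrt K < \<kappa>" using real_sqrt_less_mono[OF K(2)] \<kappa> by simp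
    then show "sqrt K / \<kappa> < 1" using \<kappa> by simp
    fix v w assume vw: "v \<in> Y" "w \<in> Y"
    have "(L2_norm (\<lambda>t. g v t - g w t))\<^sup>2 \<le> (\<kappa>\<^sup>2 - 2 * \<kappa> * m_A + L_A\<^sup>2) * (L2_norm (\<lambda>t. v t - w t))\<^sup>2"
      using A_rep_relaxed_contraction[OF vw, of \<kappa>] \<kappa> by (simp add: g_def)
    also have "\<dots> \<le> K * (L2_norm (\<lambda>t. v t - w t))\<^sup>2" by (intro mult_right_mono) (auto simp: K_def)
    also have "\<dots> = (sqrt K * L2_norm (\<lambda>t. v t - w t))\<^sup>2" using K(1) by (simp add: power_mult_distrib)
    finally have "L2_norm (\<lambda>t. g v t - g w t) \<le> sqrt K * L2_norm (\<lambda>t. v t - w t)"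
      by (rule power2_le_imp_le) (use K(1) in simp)
    then have "\<kappa> * L2_norm (\<lambda>t. sol (g v) t - sol (g w) t) \<le> sqrt K * L2_norm (\<lambda>t. v t - w t)"
      using sol_lip[OF gY[OF vw(1)] gY[OF vw(2)]] by linarith
    then show "L2_norm (\<lambda>t. sol (g v) t - sol (g w) t) \<le> sqrt K / \<kappa> * L2_norm (\<lambda>t. v t - w t)"
      using \<kappa> by (simp add: field_simps)
  qed
  define u where "u = sol (g w)"
  have uz: "weak_pair u (rt (g w))" unfolding u_def by (rule sol(1)[OF gY[OF w(1)]])
  have "AE t in M. A_rep u t = A_rep w t"
    using w(2) by (intro A_rep_cong_AE weak_pairD(1)[OF uz] w(1)) (simp add: u_def)
  then have "AE t in M. rate u t + A_rep u t = l_rep t"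
    using sol(2)[OF gY[OF w(1)]] w(2) weak_pair_X(2)[OF uz]
  proof eventually_elim
    case (elim t)
    then have "rt (g w) t + \<kappa> *\<^sub>R w t = l_rep t + (\<kappa> *\<^sub>R w t - A_rep w t)" by (simp add: g_def)
    then show ?case using elim by (simp add: algebra_simps)
  qed
  then show ?thesis
    using weak_pair_X(1)[OF uz] sol(3)[OF gY[OF w(1)]] by (auto simp: B_e_solution_iff u_def)
qed

section \<open>The system\<close>

lemma system_first_equation:
  assumes \<theta>: "\<theta> \<in> Y" and w: "w \<in> X_space T j"
  shows "dual_eq (Y_space T) (\<lambda>v. induced_op T A \<theta> v + d_t T j w v) l \<longleftrightarrow>
    (AE t in M. rate w t + A_rep \<theta> t = l_rep t)"
proof -
  have r: "rate w \<in> Y" by (rule weak_pairD(2)[OF X_weak_pair[OF w]])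
  note L = r A_rep(1)[OF \<theta>]
  have "dual_eq (Y_space T) (\<lambda>v. induced_op T A \<theta> v + d_t T j w v) l \<longleftrightarrow>
      (\<forall>v\<in>Y. L2_inner M (\<lambda>t. rate w t + A_rep \<theta> t) v = L2_inner M l_rep v)"
    using A_rep(2)[OF \<theta>] l_rep(2) L2_inner_add_left[OF L]
    by (simp add: dual_eq_def Y_space_def d_t_eq_rate add.commute)
  also have "\<dots> \<longleftrightarrow> (AE t in M. rate w t + A_rep \<theta> t = l_rep t)"
  proof
    assume "\<forall>v\<in>Y. L2_inner M (\<lambda>t. rate w t + A_rep \<theta> t) v = L2_inner M l_rep v"
    then show "AE t in M. rate w t + A_rep \<theta> t = l_rep t"
      by (intro L2_eq_AE[OF L2_add[OF L] l_rep(1)]) blast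
  next
    assume *: "AE t in M. rate w t + A_rep \<theta> t = l_rep t"
    show "\<forall>v\<in>Y. L2_inner M (\<lambda>t. rate w t + A_rep \<theta> t) v = L2_inner M l_rep v"
      by (intro ballI L2_inner_cong_AE[OF L2_add[OF L] _ *]) auto
  qed
  finally show ?thesis .
qed

text \<open>
  Eliminating \<open>l\<close> by the first equation and integrating by parts turns the second equation into
  a homogeneous one for \<open>\<theta> - w\<close> and the initial error.
\<close>

lemma system_second_equation:
  assumes \<theta>: "\<theta> \<in> Y" and w: "w \<in> X_space T j"
    and first: "AE t in M. rate w t + A_rep \<theta> t = l_rep t"
    and vy: "weak_pair v y"
  shows "d_t_adj T j \<theta> v - (induced_op T A w v + trace_adj T j T (trace_at T j T w) v)
      = - (l v + trace_adj T j 0 u0 v) \<longleftrightarrow>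
    L2_inner M (\<lambda>t. \<theta> t - w t) y + L2_inner M (\<lambda>t. A_rep \<theta> t - A_rep w t) v
      + (u0 - trace_at T j 0 w) \<bullet> trace_at T j 0 v = 0"
proof -
  note ww = X_weak_pair[OF w]
  note wL = weak_pairD(1,2)[OF ww] and vL = weak_pairD(1,2)[OF vy]
  have "L2_inner M (rate v) \<theta> = L2_inner M y \<theta>"
    using weak_pairD(2)[OF X_weak_pair[OF weak_pair_X(1)[OF vy]]] weak_pair_X(2)[OF vy] \<theta>
    by (intro L2_inner_cong_AE) auto
  moreover have "l v = L2_inner M (rate w) v + L2_inner M (A_rep \<theta>) v"
  proof -
    have "L2_inner M (\<lambda>t. rate w t + A_rep \<theta> t) v = L2_inner M l_rep v"
      by (rule L2_inner_cong_AE[OF L2_add[OF wL(2) A_rep(1)[OF \<theta>]] vL(1) first]) simp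
    then show ?thesis using l_rep(2)[OF vL(1)] L2_inner_add_left[OF wL(2) A_rep(1)[OF \<theta>] vL(1)] by simp
  qed
  moreover have "L2_inner M (rate w) v + L2_inner M w y
      = trace_at T j T w \<bullet> trace_at T j T v - trace_at T j 0 w \<bullet> trace_at T j 0 v"
    by (rule integration_by_parts[OF ww vy])
  moreover have "L2_inner M (\<lambda>t. \<theta> t - w t) y = L2_inner M y \<theta> - L2_inner M w y"
    using L2_inner_diff_left[OF \<theta> wL(1) vL(2)] by (simp add: L2_inner_commute)
  moreover have "L2_inner M (\<lambda>t. A_rep \<theta> t - A_rep w t) v = L2_inner M (A_rep \<theta>) v - L2_inner M (A_rep w) v"
    by (rule L2_inner_diff_left[OF A_rep(1)[OF \<theta>] A_rep(1)[OF wL(1)] vL(1)])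
  moreover have "induced_op T A w v = L2_inner M (A_rep w) v" by (rule A_rep(2)[OF wL(1) vL(1)])
  ultimately show ?thesis
    by (simp only: d_t_adj_def d_t_eq_rate trace_adj_def inner_diff_left) linarith
qed

text \<open>
  The reduced second equation is a variational problem for \<open>y = \<theta> - w\<close>. It shows that \<open>y\<close> lies
  in \<open>X\<close>, has the time derivative \<open>A \<theta> - A w\<close> and vanishes at \<open>T\<close>. The energy identity gives \<open>(A
  \<theta> - A w)(\<theta> - w) \<le> 0\<close>, hence \<open>\<theta> = w\<close>; then \<open>y = 0\<close> also kills the initial error.
\<close>

lemma system_solution_components:
  assumes sys: "system_solution T j A l u0 \<theta> w"
  shows "AE t in M. \<theta> t = w t" "B_e_solution T j A l u0 w"
proof -
  have \<theta>: "\<theta> \<in> Y" and w: "w \<in> X_space T j" using sys by (auto simp: system_solution_def Y_space_def)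
  note ww = X_weak_pair[OF w]
  note wL = weak_pairD(1,2)[OF ww]
  have first: "AE t in M. rate w t + A_rep \<theta> t = l_rep t"
    using sys system_first_equation[OF \<theta> w] by (simp add: system_solution_def)
  define y where "y t = \<theta> t - w t" for t
  define b where "b t = A_rep \<theta> t - A_rep w t" for t
  define h where "h = u0 - trace_at T j 0 w"
  have y: "y \<in> Y" unfolding y_def by (rule L2_diff[OF \<theta> wL(1)])
  have b: "b \<in> Y" unfolding b_def by (rule L2_diff[OF A_rep(1)[OF \<theta>] A_rep(1)[OF wL(1)]])
  have "L2_inner M (\<lambda>t. S (y t)) a + L2_inner M b p + h \<bullet> J (p 0) + 0 \<bullet> J (p T) = 0"
    if p: "primitive_on T a p" for a p
  proof -
    have ps: "weak_pair p (\<lambda>t. S (a t))" by (rule primitive_weak_pair[OF p])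
    have "p \<in> X_space T j" by (rule weak_pair_X(1)[OF ps])
    then have "L2_inner M y (\<lambda>t. S (a t)) + L2_inner M b p + h \<bullet> trace_at T j 0 p = 0"
      using sys system_second_equation[OF \<theta> w first ps]
      by (simp add: system_solution_def dual_eq_def y_def[abs_def] b_def[abs_def] h_def)
    moreover have "L2_inner M y (\<lambda>t. S (a t)) = L2_inner M (\<lambda>t. S (y t)) a"
      by (simp add: L2_inner_S L2_inner_commute)
    ultimately show ?thesis using trace_primitive[OF p, of 0] T_pos by simp
  qed
  then obtain q where q: "primitive_on T b q" "AE t in M. q t = S (y t)"
    "q 0 = adj_embed j h" "q T = - adj_embed j 0"
    using variational_problem[OF y b] by blast
  have yb: "weak_pair y b"
    unfolding weak_pair_def
  proof (intro conjI y b allI impI)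
    fix d p :: "real \<Rightarrow> 'v" assume p: "primitive_on T d p \<and> p 0 = 0 \<and> p T = 0"
    have "L2_inner M (\<lambda>t. S (y t)) d = L2_inner M q d"
      using q(2) primitive_L2[of d p] primitive_in_L2[OF q(1)] p y by (intro L2_inner_cong_AE) (auto elim: eventually_mono)
    then show "L2_inner M (\<lambda>t. S (y t)) d + L2_inner M b p = 0"
      using primitive_product_rule_L2[OF q(1) conjunct1[OF p]] p by simp
  qed
  have q_trace: "q t = adj_embed j (trace_at T j t y)" if "t \<in> {0..T}" for t
  proof (rule continuous_eq_AE[OF primitive_continuous[OF q(1)] _ _ that])
    show "continuous_on {0..T} (\<lambda>t. adj_embed j (trace_at T j t y))"
      by (rule bounded_linear.continuous_on[OF bounded_linear_adj_embed weak_pair_trace(1)[OF yb]])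
    show "AE t in M. q t = adj_embed j (trace_at T j t y)"
      using q(2) weak_pair_trace(2)[OF yb] by eventually_elim simp
  qed
  have "adj_embed j 0 = 0" by (simp add: adj_embed_eq_0_iff)
  then have "adj_embed j (trace_at T j T y) = 0" using q_trace[of T] q(4) T_pos by simp
  then have "trace_at T j T y = 0" by (simp only: adj_embed_eq_0_iff)
  then have "2 * L2_inner M b y = - (norm (trace_at T j 0 y))\<^sup>2" using energy_identity[OF yb] by simp
  then have "2 * L2_inner M b y \<le> 0" by (simp only: neg_le_0_iff_le zero_le_power2)
  then have "L2_inner M b y \<le> 0" by simp
  then show eq: "AE t in M. \<theta> t = w t"
    unfolding y_def[abs_def] b_def[abs_def] by (rule eq_AE_if_monotone[OF \<theta> wL(1)])
  have "AE t in M. q t = 0"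
    using q(2) eq by eventually_elim (use adj_embed_eq_0_iff[of 0] in \<open>simp add: y_def\<close>)
  then have "q 0 = 0"
    using T_pos by (intro continuous_eq_AE[OF primitive_continuous[OF q(1)], of "\<lambda>_. 0"]) auto
  then have tr: "trace_at T j 0 w = u0" using q(3) by (simp add: adj_embed_eq_0_iff h_def)
  have "AE t in M. A_rep \<theta> t = A_rep w t" by (rule A_rep_cong_AE[OF \<theta> wL(1) eq])
  with first have "AE t in M. rate w t + A_rep w t = l_rep t" by eventually_elim simp
  then show "B_e_solution T j A l u0 w" using w tr by (simp add: B_e_solution_iff)
qed

lemma system_solutionI:
  assumes w: "B_e_solution T j A l u0 w" and \<theta>: "\<theta> \<in> Y" and eq: "AE t in M. \<theta> t = w t"
  shows "system_solution T j A l u0 \<theta> w"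
proof -
  have wX: "w \<in> X_space T j" and tr: "trace_at T j 0 w = u0"
    and AE: "AE t in M. rate w t + A_rep w t = l_rep t"
    using w by (auto simp: B_e_solution_iff)
  have wY: "w \<in> Y" by (rule weak_pairD(1)[OF X_weak_pair[OF wX]])
  have A: "AE t in M. A_rep \<theta> t = A_rep w t" by (rule A_rep_cong_AE[OF \<theta> wY eq])
  from AE A have first: "AE t in M. rate w t + A_rep \<theta> t = l_rep t" by eventually_elim simp
  have "AE t in M. \<theta> t - w t = 0" using eq by eventually_elim simp
  have zero: "L2_inner M (\<lambda>t. f t - g t) v = 0" if "AE t in M. f t = g t" for f g v :: "real \<Rightarrow> 'v"
    unfolding L2_inner_def by (rule integral_eq_zero_AE) (use that in \<open>auto elim: eventually_mono\<close>)
  have "d_t_adj T j \<theta> v - (induced_op T A w v + trace_adj T j T (trace_at T j T w) v)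
      = - (l v + trace_adj T j 0 u0 v)" if "v \<in> X_space T j" for v
    unfolding system_second_equation[OF \<theta> wX first X_weak_pair[OF that]] zero[OF eq] zero[OF A] tr by simp
  then show ?thesis
    using \<theta> wX first system_first_equation[OF \<theta> wX]
    by (auto simp: system_solution_def dual_eq_def[of "X_space T j"] Y_space_def)
qed

end

theorem theorem4p1:
  fixes T L_A m_A :: real
    and j :: "'v::{real_inner,complete_space} \<Rightarrow>\<^sub>L 'h::{real_inner,complete_space}"
    and A :: "real \<Rightarrow> 'v \<Rightarrow> ('v \<Rightarrow>\<^sub>L real)"
    and l :: "(real \<Rightarrow> 'v) \<Rightarrow> real"
    and u0 :: 'h
  assumes "gelfand_triple j"
    and "T > 0" and "L_A > 0" and "m_A > 0"
    and "maps_Y_to_dual T A"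
    and "lipschitz_op T A L_A"
    and "strongly_monotone_op T A m_A"
    and "l \<in> bochner_L2_dual (time_measure T)"
  shows "\<exists>u. B_e_solution T j A l u0 u \<and>
    (\<forall>w. B_e_solution T j A l u0 w \<longleftrightarrow>
       w \<in> X_space T j \<and> (AE t in time_measure T. w t = u t)) \<and>
    (\<forall>\<theta> w. system_solution T j A l u0 \<theta> w \<longleftrightarrow>
       \<theta> \<in> Y_space T \<and> w \<in> X_space T j \<and>
       (AE t in time_measure T. \<theta> t = u t) \<and> (AE t in time_measure T. w t = u t))"
proof -
  interpret monotone_parabolic T j L_A m_A A l u0
    using assms by unfold_locales auto
  obtain u where u: "B_e_solution T j A l u0 u" using B_e_solution_exists by blast
  have B: "B_e_solution T j A l u0 w \<longleftrightarrow> w \<in> X_space T j \<and> (AE t in M. w t = u t)" for w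
    using B_e_solution_unique[OF u] B_e_solution_cong_AE[OF u] by (auto simp: B_e_solution_def)
  have "system_solution T j A l u0 \<theta> w \<longleftrightarrow> \<theta> \<in> Y_space T \<and> w \<in> X_space T j \<and>
      (AE t in M. \<theta> t = u t) \<and> (AE t in M. w t = u t)" for \<theta> w
  proof
    assume sys: "system_solution T j A l u0 \<theta> w"
    note c = system_solution_components[OF sys]
    have wu: "AE t in M. w t = u t" using c(2) B by blast
    with c(1) have "AE t in M. \<theta> t = u t" by eventually_elim simp
    then show "\<theta> \<in> Y_space T \<and> w \<in> X_space T j \<and> (AE t in M. \<theta> t = u t) \<and> (AE t in M. w t = u t)"
      using sys wu by (simp add: system_solution_def)
  next
    assume *: "\<theta> \<in> Y_space T \<and> w \<in> X_space T j \<and> (AE t in M. \<theta> t = u t) \<and> (AE t in M. w t = u t)"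
    then have "AE t in M. \<theta> t = u t" "AE t in M. w t = u t" by auto
    then have "AE t in M. \<theta> t = w t" by eventually_elim simp
    then show "system_solution T j A l u0 \<theta> w"
      using * B by (intro system_solutionI) (auto simp: Y_space_def)
  qed
  then show ?thesis using u B by blast
qed

end
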